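(* Let $(\epsilon_n)_{n \ge 1}$ be a decreasing sequence of positive numbers converging to $0$, and let $(a_n)_{n\ge 0}$ be a strictly increasing sequence of positive integers with $a_{n+m} \ge a_n a_m$ for all $n,m$, chosen such that $a_0 = 1$ and $$a_n \ \geq\ \max\Big\{ \frac{2^k}{\epsilon_{n-k}}\, a_k\, a_{n-k} : k = 1, \dots, n-1 \Big\}$$ for all $n \ge 2$. Let $\omega : [0,\infty) \to (0,\infty)$ be the associated staircase weight, $\omega(t) = 1/a_n$ for $t \in [n,n+1)$, $n = 0,1,2,\dots$. Then the operator algebra $\mathcal{A}(\omega)$ is not compact, but is weakly compact, and hence is an ideal in its bidual. Also, $\mathcal{A}(\omega)$ is a commutative approximately unital radical operator algebra, which is not reflexive as a Banach space, and which is topologically singly generated.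
   Context: An operator algebra is a norm closed algebra of operators on a complex Hilbert space; its bidual is an operator algebra with the Arens product. A weight is a measurable function $\omega : [0,\infty) \to (0,\infty)$ with $\omega(0)=1$ and $\omega(s+t) \le \omega(s)\omega(t)$ for all $s,t \ge 0$. For $1 \le p < \infty$, $L^p(\omega)$ is the Banach space of (classes of) measurable $f:[0,\infty)\to\mathbb{C}$ with $\|f\|_p = (\int_0^\infty |f(t)|^p \omega(t)^p\,dt)^{1/p} < \infty$. $L^1(\omega)$ is a Banach algebra under convolution $(f*g)(t)=\int_0^t f(t-s)g(s)\,ds$, and $f \mapsto M_f$, $M_f(g) = f*g$, is a contractive homomorphism from $L^1(\omega)$ into $B(L^2(\omega))$. $\mathcal{A}(\omega)$ denotes the operator-norm closure of $\{M_f : f \in L^1(\omega)\}$ in $B(L^2(\omega))$. A Banach algebra $A$ is compact (resp. weakly compact) if for every $a \in A$ the map $x \mapsto axa$ on $A$ is compact (resp. weakly compact). Approximately unital means having a contractive approximate identity. An algebra is radical if it equals its Jacobson radical. Topologically singly generated means that some single element generates $A$ as a norm closed algebra. *)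

theory Defs
  imports "HOL-Analysis.Analysis" "HOL-Library.Function_Algebras"
begin

section \<open>Complex vector spaces\<close>

class complex_vector = ab_group_add +
  fixes scaleC :: "complex \<Rightarrow> 'a \<Rightarrow> 'a"  (infixr \<open>*\<^sub>C\<close> 75)
  assumes scaleC_add_right: "c *\<^sub>C (x + y) = c *\<^sub>C x + c *\<^sub>C y"
    and scaleC_add_left: "(c + d) *\<^sub>C x = c *\<^sub>C x + d *\<^sub>C x"
    and scaleC_scaleC: "c *\<^sub>C d *\<^sub>C x = (c * d) *\<^sub>C x"
    and scaleC_one: "1 *\<^sub>C x = x"

global_interpretation complex_vector: vector_space "scaleC :: complex \<Rightarrow> 'a \<Rightarrow> 'a::complex_vector"
  defines csubspace = complex_vector.subspace
  by unfold_locales (rule scaleC_add_right scaleC_add_left scaleC_scaleC scaleC_one)+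

instantiation complex :: complex_vector
begin

definition scaleC_complex :: "complex \<Rightarrow> complex \<Rightarrow> complex"
  where "scaleC_complex c z = c * z"

instance
  by standard (simp_all add: scaleC_complex_def algebra_simps)

end

instantiation "fun" :: (type, complex_vector) complex_vector
begin

definition scaleC_fun :: "complex \<Rightarrow> ('a \<Rightarrow> 'b) \<Rightarrow> 'a \<Rightarrow> 'b"
  where "scaleC_fun c f = (\<lambda>x. c *\<^sub>C f x)"

instance
  by standard
    (simp_all add: scaleC_fun_def fun_eq_iff scaleC_add_right scaleC_add_left scaleC_scaleC scaleC_one)

end


section \<open>Normed spaces, bounded operators and duals\<close>

text \<open>
  A normed space is a subspace \<open>V\<close> of a complex vector space together with a function \<open>N\<close>
  of which only the values on \<open>V\<close> matter.
\<close>

definition normed_space_on :: "'a::complex_vector set \<Rightarrow> ('a \<Rightarrow> real) \<Rightarrow> bool"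
  where "normed_space_on V N \<longleftrightarrow> csubspace V \<and>
    (\<forall>x\<in>V. 0 \<le> N x \<and> (N x = 0 \<longleftrightarrow> x = 0)) \<and>
    (\<forall>x\<in>V. \<forall>y\<in>V. N (x + y) \<le> N x + N y) \<and>
    (\<forall>c. \<forall>x\<in>V. N (c *\<^sub>C x) = cmod c * N x)"

text \<open>
  The locale \<open>Metric_space\<close> asks for nonnegativity and symmetry on the whole type, hence the
  value 0 off the carrier.
\<close>

definition norm_dist :: "'a::complex_vector set \<Rightarrow> ('a \<Rightarrow> real) \<Rightarrow> 'a \<Rightarrow> 'a \<Rightarrow> real"
  where "norm_dist V N x y = (if x \<in> V \<and> y \<in> V then N (x - y) else 0)"

definition norm_topology :: "'a::complex_vector set \<Rightarrow> ('a \<Rightarrow> real) \<Rightarrow> 'a topology"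
  where "norm_topology V N = Metric_space.mtopology V (norm_dist V N)"

lemma Metric_space_norm_dist:
  assumes "normed_space_on V N"
  shows "Metric_space V (norm_dist V N)"
proof -
  have V: "csubspace V" and pos: "\<And>x. x \<in> V \<Longrightarrow> 0 \<le> N x"
    and zero: "\<And>x. x \<in> V \<Longrightarrow> N x = 0 \<longleftrightarrow> x = 0"
    and tri: "\<And>x y. x \<in> V \<Longrightarrow> y \<in> V \<Longrightarrow> N (x + y) \<le> N x + N y"
    and hom: "\<And>c x. x \<in> V \<Longrightarrow> N (c *\<^sub>C x) = cmod c * N x"
    using assms unfolding normed_space_on_def by blast+
  have sub: "x - y \<in> V" if "x \<in> V" "y \<in> V" for x y
    using V that by (rule complex_vector.subspace_diff)
  have sym: "N (x - y) = N (y - x)" if "x \<in> V" "y \<in> V" for x y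
    using hom[OF sub[OF that], of "- 1"] by simp
  show ?thesis
  proof
    show "0 \<le> norm_dist V N x y" for x y
      by (simp add: norm_dist_def pos sub)
    show "norm_dist V N x y = norm_dist V N y x" for x y
      unfolding norm_dist_def using sym[of x y] by presburger
    show "norm_dist V N x y = 0 \<longleftrightarrow> x = y" if "x \<in> V" "y \<in> V" for x y
      using zero[OF sub[OF that]] that by (simp add: norm_dist_def)
    show "norm_dist V N x z \<le> norm_dist V N x y + norm_dist V N y z"
      if "x \<in> V" "y \<in> V" "z \<in> V" for x y z
      using tri[OF sub[OF that(1,2)] sub[OF that(2,3)]] that by (simp add: norm_dist_def)
  qed
qed

definition banach_space_on :: "'a::complex_vector set \<Rightarrow> ('a \<Rightarrow> real) \<Rightarrow> bool"
  where "banach_space_on V N \<longleftrightarrow> normed_space_on V N \<and> Metric_space.mcomplete V (norm_dist V N)"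

definition inner_product_on :: "'a::complex_vector set \<Rightarrow> ('a \<Rightarrow> 'a \<Rightarrow> complex) \<Rightarrow> bool"
  where "inner_product_on H ip \<longleftrightarrow>
    (\<forall>x\<in>H. \<forall>y\<in>H. \<forall>z\<in>H. ip (x + y) z = ip x z + ip y z) \<and>
    (\<forall>c. \<forall>x\<in>H. \<forall>y\<in>H. ip (c *\<^sub>C x) y = c * ip x y) \<and>
    (\<forall>x\<in>H. \<forall>y\<in>H. ip y x = cnj (ip x y)) \<and>
    (\<forall>x\<in>H. 0 \<le> Re (ip x x) \<and> (ip x x = 0 \<longleftrightarrow> x = 0))"

definition hilbert_space_on :: "'a::complex_vector set \<Rightarrow> ('a \<Rightarrow> real) \<Rightarrow> bool"
  where "hilbert_space_on H N \<longleftrightarrow> banach_space_on H N \<and>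
    (\<exists>ip. inner_product_on H ip \<and> (\<forall>x\<in>H. N x = sqrt (Re (ip x x))))"

definition clinear_on :: "'a::complex_vector set \<Rightarrow> ('a \<Rightarrow> 'b::complex_vector) \<Rightarrow> bool"
  where "clinear_on V T \<longleftrightarrow>
    (\<forall>x\<in>V. \<forall>y\<in>V. T (x + y) = T x + T y) \<and> (\<forall>c. \<forall>x\<in>V. T (c *\<^sub>C x) = c *\<^sub>C T x)"

text \<open>
  Operators on \<open>V\<close> are extended by 0 off \<open>V\<close>, so that two of them are equal as functions iff
  they agree on \<open>V\<close>; sums, scalar multiples and compositions respect this convention.
\<close>

definition bounded_ops ::
    "'a::complex_vector set \<Rightarrow> ('a \<Rightarrow> real) \<Rightarrow> 'b::complex_vector set \<Rightarrow> ('b \<Rightarrow> real) \<Rightarrow> ('a \<Rightarrow> 'b) set"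
  where "bounded_ops V N W M = {T. (\<forall>x\<in>V. T x \<in> W) \<and> clinear_on V T \<and>
    (\<exists>C. \<forall>x\<in>V. M (T x) \<le> C * N x) \<and> (\<forall>x. x \<notin> V \<longrightarrow> T x = 0)}"

definition op_norm ::
    "'a::complex_vector set \<Rightarrow> ('a \<Rightarrow> real) \<Rightarrow> ('b \<Rightarrow> real) \<Rightarrow> ('a \<Rightarrow> 'b::complex_vector) \<Rightarrow> real"
  where "op_norm V N M T = (SUP x\<in>{x\<in>V. N x \<le> 1}. M (T x))"

definition dual :: "'a::complex_vector set \<Rightarrow> ('a \<Rightarrow> real) \<Rightarrow> ('a \<Rightarrow> complex) set"
  where "dual V N = bounded_ops V N UNIV cmod"

definition dual_norm :: "'a::complex_vector set \<Rightarrow> ('a \<Rightarrow> real) \<Rightarrow> ('a \<Rightarrow> complex) \<Rightarrow> real"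
  where "dual_norm V N = op_norm V N cmod"

definition bidual :: "'a::complex_vector set \<Rightarrow> ('a \<Rightarrow> real) \<Rightarrow> (('a \<Rightarrow> complex) \<Rightarrow> complex) set"
  where "bidual V N = dual (dual V N) (dual_norm V N)"

definition bidual_embedding ::
    "'a::complex_vector set \<Rightarrow> ('a \<Rightarrow> real) \<Rightarrow> 'a \<Rightarrow> ('a \<Rightarrow> complex) \<Rightarrow> complex"
  where "bidual_embedding V N x = (\<lambda>\<phi>. if \<phi> \<in> dual V N then \<phi> x else 0)"

definition reflexive_space :: "'a::complex_vector set \<Rightarrow> ('a \<Rightarrow> real) \<Rightarrow> bool"
  where "reflexive_space V N \<longleftrightarrow> bidual_embedding V N ` V = bidual V N"

definition weak_topology :: "'a::complex_vector set \<Rightarrow> ('a \<Rightarrow> real) \<Rightarrow> 'a topology"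
  where "weak_topology V N =
    topology_generated_by {{x\<in>V. \<phi> x \<in> U} |\<phi> U. \<phi> \<in> dual V N \<and> open U}"

definition compact_map_on :: "'a::complex_vector set \<Rightarrow> ('a \<Rightarrow> real) \<Rightarrow> ('a \<Rightarrow> 'a) \<Rightarrow> bool"
  where "compact_map_on V N T \<longleftrightarrow>
    compactin (norm_topology V N) (norm_topology V N closure_of (T ` {x\<in>V. N x \<le> 1}))"

definition weakly_compact_map_on :: "'a::complex_vector set \<Rightarrow> ('a \<Rightarrow> real) \<Rightarrow> ('a \<Rightarrow> 'a) \<Rightarrow> bool"
  where "weakly_compact_map_on V N T \<longleftrightarrow>
    compactin (weak_topology V N) (weak_topology V N closure_of (T ` {x\<in>V. N x \<le> 1}))"


section \<open>Normed algebras\<close>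

text \<open>
  A normed algebra is a normed space \<open>A\<close>, \<open>N\<close> as above with a product \<open>m\<close>; no unit is assumed.
\<close>

definition subalgebra_of :: "'a::complex_vector set \<Rightarrow> 'a set \<Rightarrow> ('a \<Rightarrow> 'a \<Rightarrow> 'a) \<Rightarrow> bool"
  where "subalgebra_of B A m \<longleftrightarrow> B \<subseteq> A \<and> csubspace B \<and> (\<forall>x\<in>B. \<forall>y\<in>B. m x y \<in> B)"

definition left_ideal_of :: "'a::complex_vector set \<Rightarrow> 'a set \<Rightarrow> ('a \<Rightarrow> 'a \<Rightarrow> 'a) \<Rightarrow> bool"
  where "left_ideal_of L A m \<longleftrightarrow> L \<subseteq> A \<and> csubspace L \<and> (\<forall>a\<in>A. \<forall>x\<in>L. m a x \<in> L)"

definition ideal_of :: "'a::complex_vector set \<Rightarrow> 'a set \<Rightarrow> ('a \<Rightarrow> 'a \<Rightarrow> 'a) \<Rightarrow> bool"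
  where "ideal_of I A m \<longleftrightarrow> left_ideal_of I A m \<and> (\<forall>a\<in>A. \<forall>x\<in>I. m x a \<in> I)"

definition modular_left_ideal :: "'a::complex_vector set \<Rightarrow> 'a set \<Rightarrow> ('a \<Rightarrow> 'a \<Rightarrow> 'a) \<Rightarrow> bool"
  where "modular_left_ideal L A m \<longleftrightarrow> left_ideal_of L A m \<and> (\<exists>u\<in>A. \<forall>a\<in>A. a - m a u \<in> L)"

definition maximal_modular_left_ideal ::
    "'a::complex_vector set \<Rightarrow> 'a set \<Rightarrow> ('a \<Rightarrow> 'a \<Rightarrow> 'a) \<Rightarrow> bool"
  where "maximal_modular_left_ideal L A m \<longleftrightarrow> modular_left_ideal L A m \<and> L \<noteq> A \<and>
    (\<forall>L'. left_ideal_of L' A m \<and> L \<subseteq> L' \<longrightarrow> L' = L \<or> L' = A)"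

definition jacobson_radical :: "'a::complex_vector set \<Rightarrow> ('a \<Rightarrow> 'a \<Rightarrow> 'a) \<Rightarrow> 'a set"
  where "jacobson_radical A m = {a\<in>A. \<forall>L. maximal_modular_left_ideal L A m \<longrightarrow> a \<in> L}"

definition radical_algebra :: "'a::complex_vector set \<Rightarrow> ('a \<Rightarrow> 'a \<Rightarrow> 'a) \<Rightarrow> bool"
  where "radical_algebra A m \<longleftrightarrow> jacobson_radical A m = A"

definition commutative_algebra :: "'a set \<Rightarrow> ('a \<Rightarrow> 'a \<Rightarrow> 'a) \<Rightarrow> bool"
  where "commutative_algebra A m \<longleftrightarrow> (\<forall>x\<in>A. \<forall>y\<in>A. m x y = m y x)"

definition compact_algebra :: "'a::complex_vector set \<Rightarrow> ('a \<Rightarrow> real) \<Rightarrow> ('a \<Rightarrow> 'a \<Rightarrow> 'a) \<Rightarrow> bool"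
  where "compact_algebra A N m \<longleftrightarrow> (\<forall>a\<in>A. compact_map_on A N (\<lambda>x. m (m a x) a))"

definition weakly_compact_algebra ::
    "'a::complex_vector set \<Rightarrow> ('a \<Rightarrow> real) \<Rightarrow> ('a \<Rightarrow> 'a \<Rightarrow> 'a) \<Rightarrow> bool"
  where "weakly_compact_algebra A N m \<longleftrightarrow> (\<forall>a\<in>A. weakly_compact_map_on A N (\<lambda>x. m (m a x) a))"

text \<open>The net is given by a proper filter on the algebra.\<close>

definition approximately_unital ::
    "'a::complex_vector set \<Rightarrow> ('a \<Rightarrow> real) \<Rightarrow> ('a \<Rightarrow> 'a \<Rightarrow> 'a) \<Rightarrow> bool"
  where "approximately_unital A N m \<longleftrightarrow> (\<exists>F. F \<noteq> bot \<and> (\<forall>\<^sub>F e in F. e \<in> A \<and> N e \<le> 1) \<and>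
    (\<forall>a\<in>A. ((\<lambda>e. N (m e a - a)) \<longlongrightarrow> 0) F \<and> ((\<lambda>e. N (m a e - a)) \<longlongrightarrow> 0) F))"

definition closed_subalgebra_generated ::
    "'a::complex_vector set \<Rightarrow> ('a \<Rightarrow> real) \<Rightarrow> ('a \<Rightarrow> 'a \<Rightarrow> 'a) \<Rightarrow> 'a set \<Rightarrow> 'a set"
  where "closed_subalgebra_generated A N m S =
    \<Inter> {B. subalgebra_of B A m \<and> closedin (norm_topology A N) B \<and> S \<subseteq> B}"

definition topologically_singly_generated ::
    "'a::complex_vector set \<Rightarrow> ('a \<Rightarrow> real) \<Rightarrow> ('a \<Rightarrow> 'a \<Rightarrow> 'a) \<Rightarrow> bool"
  where "topologically_singly_generated A N m \<longleftrightarrow>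
    (\<exists>x\<in>A. closed_subalgebra_generated A N m {x} = A)"

text \<open>
  The first Arens product: \<open>\<langle>\<mu> \<box> \<eta>, \<phi>\<rangle> = \<langle>\<mu>, \<eta> \<cdot> \<phi>\<rangle>\<close>, \<open>\<langle>\<eta> \<cdot> \<phi>, a\<rangle> = \<langle>\<eta>, \<phi> \<cdot> a\<rangle>\<close>,
  \<open>\<langle>\<phi> \<cdot> a, b\<rangle> = \<langle>\<phi>, a b\<rangle>\<close>.  It agrees with the second one on operator algebras.
\<close>

definition arens_product ::
    "'a::complex_vector set \<Rightarrow> ('a \<Rightarrow> real) \<Rightarrow> ('a \<Rightarrow> 'a \<Rightarrow> 'a) \<Rightarrow>
     (('a \<Rightarrow> complex) \<Rightarrow> complex) \<Rightarrow> (('a \<Rightarrow> complex) \<Rightarrow> complex) \<Rightarrow> (('a \<Rightarrow> complex) \<Rightarrow> complex)"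
  where "arens_product A N m \<mu> \<eta> =
    (\<lambda>\<phi>. if \<phi> \<in> dual A N
      then \<mu> (\<lambda>a. if a \<in> A then \<eta> (\<lambda>b. if b \<in> A then \<phi> (m a b) else 0) else 0) else 0)"

definition ideal_in_bidual :: "'a::complex_vector set \<Rightarrow> ('a \<Rightarrow> real) \<Rightarrow> ('a \<Rightarrow> 'a \<Rightarrow> 'a) \<Rightarrow> bool"
  where "ideal_in_bidual A N m \<longleftrightarrow>
    ideal_of (bidual_embedding A N ` A) (bidual A N) (arens_product A N m)"

definition operator_algebra_on ::
    "'a::complex_vector set \<Rightarrow> ('a \<Rightarrow> real) \<Rightarrow> ('a \<Rightarrow> 'a) set \<Rightarrow> bool"
  where "operator_algebra_on H N A \<longleftrightarrow> hilbert_space_on H N \<and>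
    subalgebra_of A (bounded_ops H N H N) (\<circ>) \<and>
    closedin (norm_topology (bounded_ops H N H N) (op_norm H N N)) A"


section \<open>Classes of measurable functions on the half-line\<close>

definition half_line :: "real measure"
  where "half_line = restrict_space lborel {0..}"

definition ae_eq :: "(real \<Rightarrow> complex) \<Rightarrow> (real \<Rightarrow> complex) \<Rightarrow> bool"
  where "ae_eq f g \<longleftrightarrow> f \<in> borel_measurable half_line \<and> g \<in> borel_measurable half_line \<and>
    (AE t in half_line. f t = g t)"

text \<open>
  The values of a representative on the negative reals are ignored.  Every class of Lebesgue
  measurable functions has a Borel representative, so Borel measurability loses nothing.
\<close>

quotient_type mfun = "real \<Rightarrow> complex" / partial: ae_eq
proof (rule part_equivpI)
  show "\<exists>f. ae_eq f f"
    by (rule exI[of _ "\<lambda>_. 0"]) (simp add: ae_eq_def)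
  show "symp ae_eq"
    by (rule sympI) (auto simp: ae_eq_def)
  show "transp ae_eq"
    by (rule transpI) (auto simp: ae_eq_def)
qed

instantiation mfun :: complex_vector
begin

lift_definition zero_mfun :: mfun is "\<lambda>_. 0"
  by (simp add: ae_eq_def)

lift_definition plus_mfun :: "mfun \<Rightarrow> mfun \<Rightarrow> mfun" is "\<lambda>f g t. f t + g t"
  by (auto simp: ae_eq_def)

lift_definition minus_mfun :: "mfun \<Rightarrow> mfun \<Rightarrow> mfun" is "\<lambda>f g t. f t - g t"
  by (auto simp: ae_eq_def)

lift_definition uminus_mfun :: "mfun \<Rightarrow> mfun" is "\<lambda>f t. - f t"
  by (auto simp: ae_eq_def)

lift_definition scaleC_mfun :: "complex \<Rightarrow> mfun \<Rightarrow> mfun" is "\<lambda>c f t. c * f t"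
  by (auto simp: ae_eq_def)

instance
  by standard (transfer, auto simp: ae_eq_def algebra_simps)+

end

lift_definition mfun_Lp_integral :: "(real \<Rightarrow> real) \<Rightarrow> real \<Rightarrow> mfun \<Rightarrow> ennreal"
  is "\<lambda>\<omega> p f. \<integral>\<^sup>+ t. ennreal (cmod (f t) powr p * \<omega> t powr p) \<partial>half_line"
  by (rule nn_integral_cong_AE) (auto simp: ae_eq_def)

definition Lp_space :: "(real \<Rightarrow> real) \<Rightarrow> real \<Rightarrow> mfun set"
  where "Lp_space \<omega> p = {f. mfun_Lp_integral \<omega> p f < \<infinity>}"

definition Lp_norm :: "(real \<Rightarrow> real) \<Rightarrow> real \<Rightarrow> mfun \<Rightarrow> real"
  where "Lp_norm \<omega> p f = enn2real (mfun_Lp_integral \<omega> p f) powr (1 / p)"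

lemma AE_half_line_iff: "(AE t in half_line. P t) \<longleftrightarrow> (AE t in lborel. 0 \<le> t \<longrightarrow> P t)"
  unfolding half_line_def by (subst AE_restrict_space_iff) auto

lemma measurable_half_line_iff:
  fixes f :: "real \<Rightarrow> complex"
  shows "f \<in> borel_measurable half_line \<longleftrightarrow> (\<lambda>t. indicator {0..} t *\<^sub>R f t) \<in> borel_measurable borel"
  unfolding half_line_def by (subst borel_measurable_restrict_space_iff) auto

text \<open>
  For \<open>f\<close> in \<open>L\<^sup>1(\<omega>)\<close> and \<open>g\<close> in \<open>L\<^sup>2(\<omega>)\<close>, with \<open>\<omega>\<close> a weight, the integral below exists for
  almost all \<open>t\<close>.
\<close>

lift_definition convolution :: "mfun \<Rightarrow> mfun \<Rightarrow> mfun"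
  is "\<lambda>f g t. LINT s:{0..t}|lborel. f (t - s) * g s"
proof -
  fix f f' g g' :: "real \<Rightarrow> complex"
  assume f: "ae_eq f f'" and g: "ae_eq g g'"
  have meas: "(\<lambda>t. LINT s:{0..t}|lborel. u (t - s) * v s) \<in> borel_measurable half_line"
    if u: "u \<in> borel_measurable half_line" and v: "v \<in> borel_measurable half_line"
    for u v :: "real \<Rightarrow> complex"
  proof -
    define U where "U t = indicator {0..} t *\<^sub>R u t" for t :: real
    define V where "V t = indicator {0..} t *\<^sub>R v t" for t :: real
    have [measurable]: "U \<in> borel_measurable borel" "V \<in> borel_measurable borel"
      using u v unfolding measurable_half_line_iff U_def V_def by auto
    have eq: "(\<lambda>t. LINT s:{0..t}|lborel. u (t - s) * v s) = (\<lambda>t. LINT s|lborel. U (t - s) * V s)"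
      unfolding set_lebesgue_integral_def U_def V_def
      by (intro ext Bochner_Integration.integral_cong) (auto simp: indicator_def)
    have "(\<lambda>t. LINT s|lborel. U (t - s) * V s) \<in> borel_measurable borel"
      by measurable
    then show ?thesis
      unfolding eq half_line_def by (intro measurable_restrict_space1) simp
  qed
  have "(LINT s:{0..t}|lborel. f (t - s) * g s) = (LINT s:{0..t}|lborel. f' (t - s) * g' s)" for t
  proof -
    define F where "F r = indicator {0..} r *\<^sub>R f r" for r :: real
    define F' where "F' r = indicator {0..} r *\<^sub>R f' r" for r :: real
    define G where "G r = indicator {0..} r *\<^sub>R g r" for r :: real
    define G' where "G' r = indicator {0..} r *\<^sub>R g' r" for r :: real
    have [measurable]: "F \<in> borel_measurable borel" "F' \<in> borel_measurable borel"
      "G \<in> borel_measurable borel" "G' \<in> borel_measurable borel"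
      using f g unfolding ae_eq_def measurable_half_line_iff F_def F'_def G_def G'_def by auto
    have FF: "AE r in lborel. F r = F' r"
      using f unfolding ae_eq_def AE_half_line_iff F_def F'_def
      by (auto simp: indicator_def elim: eventually_mono)
    have GG: "AE r in lborel. G r = G' r"
      using g unfolding ae_eq_def AE_half_line_iff G_def G'_def
      by (auto simp: indicator_def elim: eventually_mono)
    have "AE s in lborel. F (t - s) = F' (t - s)"
    proof -
      have "AE s in lborel. F (t + (- 1) * s) = F' (t + (- 1) * s)"
        by (rule AE_borel_affine[OF _ _ FF]) measurable
      then show ?thesis by simp
    qed
    then have "(LINT s|lborel. F (t - s) * G s) = (LINT s|lborel. F' (t - s) * G' s)"
      using GG by (intro integral_cong_AE) auto
    moreover have "(LINT s:{0..t}|lborel. f (t - s) * g s) = (LINT s|lborel. F (t - s) * G s)"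
      unfolding set_lebesgue_integral_def F_def G_def
      by (intro Bochner_Integration.integral_cong) (auto simp: indicator_def)
    moreover have "(LINT s:{0..t}|lborel. f' (t - s) * g' s) = (LINT s|lborel. F' (t - s) * G' s)"
      unfolding set_lebesgue_integral_def F'_def G'_def
      by (intro Bochner_Integration.integral_cong) (auto simp: indicator_def)
    ultimately show ?thesis by simp
  qed
  then show "ae_eq (\<lambda>t. LINT s:{0..t}|lborel. f (t - s) * g s)
      (\<lambda>t. LINT s:{0..t}|lborel. f' (t - s) * g' s)"
    using f g by (simp add: ae_eq_def meas)
qed


section \<open>The algebra \<open>\<A>(\<omega>)\<close>\<close>

definition conv_op :: "(real \<Rightarrow> real) \<Rightarrow> mfun \<Rightarrow> mfun \<Rightarrow> mfun"
  where "conv_op \<omega> f = (\<lambda>g. if g \<in> Lp_space \<omega> 2 then convolution f g else 0)"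

definition L2_ops :: "(real \<Rightarrow> real) \<Rightarrow> (mfun \<Rightarrow> mfun) set"
  where "L2_ops \<omega> = bounded_ops (Lp_space \<omega> 2) (Lp_norm \<omega> 2) (Lp_space \<omega> 2) (Lp_norm \<omega> 2)"

definition L2_op_norm :: "(real \<Rightarrow> real) \<Rightarrow> (mfun \<Rightarrow> mfun) \<Rightarrow> real"
  where "L2_op_norm \<omega> = op_norm (Lp_space \<omega> 2) (Lp_norm \<omega> 2) (Lp_norm \<omega> 2)"

definition conv_algebra :: "(real \<Rightarrow> real) \<Rightarrow> (mfun \<Rightarrow> mfun) set"
  where "conv_algebra \<omega> =
    norm_topology (L2_ops \<omega>) (L2_op_norm \<omega>) closure_of (conv_op \<omega> ` Lp_space \<omega> 1)"

end

theory Submission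
  imports Defs
begin

text \<open>
  The growth condition gives \<open>\<omega>(r + s) \<le> C (e\<^bsup>-r/2\<^esup> + e\<^bsup>-s/2\<^esup>) \<omega>(r) \<omega>(s)\<close>.  By Young's and the
  Cauchy--Schwarz inequality, convolution therefore maps \<open>L\<^sup>2(\<omega>) \<times> L\<^sup>2(\<omega>)\<close> boundedly into
  \<open>L\<^sup>2(\<omega>)\<close>, and \<open>\<A>(\<omega>)\<close> is the closure of the multiplication operators \<open>L h\<close> with \<open>h\<close> in the
  Hilbert space \<open>H = L\<^sup>2(\<omega>)\<close>.

  For \<open>x\<close> in \<open>\<A>(\<omega>)\<close> we have \<open>x \<circ> L h = L (x h)\<close>, so multiplication by \<open>L h\<close> factors through \<open>H\<close> and is
  weakly compact; by density the second adjoint of every multiplier maps the bidual into the algebra,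
  which gives the ideal property and, with the Banach--Alaoglu theorem, weak compactness.

  The monomials \<open>p n = t\<^sup>n / n!\<close> satisfy \<open>p n * p m = p (n + m + 1)\<close> and span a dense subspace of \<open>H\<close>
  because \<open>\<omega>\<close> decays faster than every exponential.  Hence convolution is associative on \<open>H\<close>,
  \<open>L (p 0)\<close> generates the algebra, and the algebra is quasinilpotent since
  \<open>L (p 0)\<^sup>n = L (p (n - 1))\<close> is small.  A reflexive algebra would contain a cluster point of the
  approximate unit \<open>n 1\<^bsub>[0,1/n]\<^esub>\<close>, that is, a unit.  Compactness fails because \<open>\<omega>\<close> is constant on
  \<open>[n, n + 1)\<close>: the functions \<open>1\<^bsub>[n,n+1)\<^esub> / \<omega>(n)\<close> have norm 1 in \<open>L\<^sup>1(\<omega>)\<close>, while their products with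
  \<open>L (p 0)\<^sup>2\<close> stay uniformly apart.
\<close>

section \<open>Normed spaces on a carrier\<close>

locale cnormed =
  fixes V :: "'a::complex_vector set" and N :: "'a \<Rightarrow> real"
  assumes normed: "normed_space_on V N"
begin

lemma csubspace_carrier: "csubspace V"
  using normed unfolding normed_space_on_def by blast

lemma zero_mem [simp]: "0 \<in> V"
  using complex_vector.subspace_0[OF csubspace_carrier] .

lemma add_mem [simp]: "x \<in> V \<Longrightarrow> y \<in> V \<Longrightarrow> x + y \<in> V"
  using complex_vector.subspace_add[OF csubspace_carrier] .

lemma diff_mem [simp]: "x \<in> V \<Longrightarrow> y \<in> V \<Longrightarrow> x - y \<in> V"
  using complex_vector.subspace_diff[OF csubspace_carrier] .

lemma scale_mem [simp]: "x \<in> V \<Longrightarrow> c *\<^sub>C x \<in> V"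
  using complex_vector.subspace_scale[OF csubspace_carrier] .

lemma sum_mem: "(\<And>i. i \<in> I \<Longrightarrow> x i \<in> V) \<Longrightarrow> (\<Sum>i\<in>I. x i) \<in> V"
  using complex_vector.subspace_sum[OF csubspace_carrier] .

lemma N_nonneg [simp]: "x \<in> V \<Longrightarrow> 0 \<le> N x"
  using normed unfolding normed_space_on_def by blast

lemma N_eq_0_iff [simp]: "x \<in> V \<Longrightarrow> N x = 0 \<longleftrightarrow> x = 0"
  using normed unfolding normed_space_on_def by blast

lemma N_zero [simp]: "N 0 = 0"
  by simp

lemma N_add_le: "x \<in> V \<Longrightarrow> y \<in> V \<Longrightarrow> N (x + y) \<le> N x + N y"
  using normed unfolding normed_space_on_def by blast

lemma N_scale [simp]: "x \<in> V \<Longrightarrow> N (c *\<^sub>C x) = cmod c * N x"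
  using normed unfolding normed_space_on_def by blast

lemma N_diff_commute: "x \<in> V \<Longrightarrow> y \<in> V \<Longrightarrow> N (x - y) = N (y - x)"
  using N_scale[of "x - y" "- 1"] by simp

lemma N_diff_triangle: "x \<in> V \<Longrightarrow> y \<in> V \<Longrightarrow> z \<in> V \<Longrightarrow> N (x - z) \<le> N (x - y) + N (y - z)"
  using N_add_le[of "x - y" "y - z"] by simp

lemma N_le_diff_add: "x \<in> V \<Longrightarrow> y \<in> V \<Longrightarrow> N x \<le> N (x - y) + N y"
  using N_add_le[of "x - y" y] by simp

lemma abs_N_diff_le: "x \<in> V \<Longrightarrow> y \<in> V \<Longrightarrow> \<bar>N x - N y\<bar> \<le> N (x - y)"
  using N_le_diff_add[of x y] N_le_diff_add[of y x] N_diff_commute[of x y] by linarith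

lemma N_sum_le: "(\<And>i. i \<in> I \<Longrightarrow> x i \<in> V) \<Longrightarrow> N (\<Sum>i\<in>I. x i) \<le> (\<Sum>i\<in>I. N (x i))"
proof (induction I rule: infinite_finite_induct)
  case (insert i I)
  then have "N (x i + (\<Sum>i\<in>I. x i)) \<le> N (x i) + N (\<Sum>i\<in>I. x i)"
    by (intro N_add_le sum_mem) auto
  with insert show ?case by fastforce
qed simp_all

sublocale M: Metric_space V "norm_dist V N"
  by (rule Metric_space_norm_dist[OF normed])

lemma topspace_norm_topology [simp]: "topspace (norm_topology V N) = V"
  by (simp add: norm_topology_def)

lemma Hausdorff_norm_topology: "Hausdorff_space (norm_topology V N)"
  unfolding norm_topology_def by (rule M.Hausdorff_space_mtopology)

lemma limitin_norm_iff:
  "limitin (norm_topology V N) x l F \<longleftrightarrow>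
    l \<in> V \<and> (\<forall>\<^sub>F i in F. x i \<in> V) \<and> ((\<lambda>i. N (x i - l)) \<longlongrightarrow> 0) F"
proof -
  have "((\<lambda>i. norm_dist V N (x i) l) \<longlongrightarrow> 0) F \<longleftrightarrow> ((\<lambda>i. N (x i - l)) \<longlongrightarrow> 0) F"
    if "l \<in> V" "\<forall>\<^sub>F i in F. x i \<in> V"
    by (rule tendsto_cong) (use that in \<open>auto simp: norm_dist_def elim: eventually_mono\<close>)
  then show ?thesis
    unfolding norm_topology_def M.limitin_metric_dist_null by blast
qed

lemma limitin_norm_squeeze:
  assumes "l \<in> V" "\<forall>\<^sub>F i in F. x i \<in> V \<and> N (x i - l) \<le> b i" "(b \<longlongrightarrow> 0) F"
  shows "limitin (norm_topology V N) x l F"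
proof -
  have "\<forall>\<^sub>F i in F. norm (N (x i - l)) \<le> b i"
    using assms(2) by eventually_elim (simp add: assms(1))
  then have "((\<lambda>i. N (x i - l)) \<longlongrightarrow> 0) F"
    using assms(3) by (rule Lim_null_comparison)
  then show ?thesis
    using assms by (auto simp: limitin_norm_iff elim: eventually_mono)
qed

lemma limitin_normI:
  "l \<in> V \<Longrightarrow> (\<And>i. x i \<in> V) \<Longrightarrow> (\<And>i. N (x i - l) \<le> b i) \<Longrightarrow> (b \<longlongrightarrow> 0) F \<Longrightarrow>
    limitin (norm_topology V N) x l F"
  by (rule limitin_norm_squeeze[of l]) simp_all

lemma limitin_norm_mem: "limitin (norm_topology V N) x l F \<Longrightarrow> l \<in> V"
  by (simp add: limitin_norm_iff)

lemma limitin_norm_unique: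
  "limitin (norm_topology V N) x l F \<Longrightarrow> limitin (norm_topology V N) x l' F \<Longrightarrow> F \<noteq> bot \<Longrightarrow> l = l'"
  by (rule limitin_Hausdorff_unique[OF _ _ _ Hausdorff_norm_topology])

lemma tendsto_N:
  assumes "limitin (norm_topology V N) x l F"
  shows "((\<lambda>i. N (x i)) \<longlongrightarrow> N l) F"
proof (rule LIM_zero_cancel, rule Lim_null_comparison)
  show "((\<lambda>i. N (x i - l)) \<longlongrightarrow> 0) F"
    using assms by (simp add: limitin_norm_iff)
  show "\<forall>\<^sub>F i in F. norm (N (x i) - N l) \<le> N (x i - l)"
    using assms abs_N_diff_le unfolding limitin_norm_iff by (auto elim: eventually_mono)
qed

lemma limitin_add:
  assumes "limitin (norm_topology V N) x l F" "limitin (norm_topology V N) y k F"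
  shows "limitin (norm_topology V N) (\<lambda>i. x i + y i) (l + k) F"
proof (rule limitin_norm_squeeze)
  have limits_mem: "l \<in> V" "k \<in> V" using assms by (simp_all add: limitin_norm_iff)
  then show "l + k \<in> V" by simp
  have "\<forall>\<^sub>F i in F. x i \<in> V" "\<forall>\<^sub>F i in F. y i \<in> V"
    using assms by (simp_all add: limitin_norm_iff)
  then show "\<forall>\<^sub>F i in F. x i + y i \<in> V \<and> N (x i + y i - (l + k)) \<le> N (x i - l) + N (y i - k)"
  proof eventually_elim
    case (elim i)
    then show ?case using limits_mem N_add_le[of "x i - l" "y i - k"] by (simp add: algebra_simps)
  qed
  show "((\<lambda>i. N (x i - l) + N (y i - k)) \<longlongrightarrow> 0) F"
    using assms tendsto_add[of "\<lambda>i. N (x i - l)" 0 F] by (fastforce simp: limitin_norm_iff)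
qed

lemma limitin_scale:
  assumes "limitin (norm_topology V N) x l F"
  shows "limitin (norm_topology V N) (\<lambda>i. c *\<^sub>C x i) (c *\<^sub>C l) F"
proof (rule limitin_norm_squeeze)
  have l_mem: "l \<in> V" and eventually_mem: "\<forall>\<^sub>F i in F. x i \<in> V"
    using assms by (simp_all add: limitin_norm_iff)
  show "c *\<^sub>C l \<in> V" using l_mem by simp
  show "\<forall>\<^sub>F i in F. c *\<^sub>C x i \<in> V \<and> N (c *\<^sub>C x i - c *\<^sub>C l) \<le> cmod c * N (x i - l)"
    using eventually_mem
  proof eventually_elim
    case (elim i)
    then show ?case
      using l_mem N_scale[of "x i - l" c] by (simp add: complex_vector.scale_right_diff_distrib)
  qed
  show "((\<lambda>i. cmod c * N (x i - l)) \<longlongrightarrow> 0) F"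
    using assms by (intro tendsto_mult_right_zero) (simp add: limitin_norm_iff)
qed

lemma limitin_diff:
  assumes "limitin (norm_topology V N) x l F" "limitin (norm_topology V N) y k F"
  shows "limitin (norm_topology V N) (\<lambda>i. x i - y i) (l - k) F"
  using limitin_add[OF assms(1) limitin_scale[OF assms(2), of "- 1"]] by simp

lemma closedin_sequentially:
  "closedin (norm_topology V N) S \<longleftrightarrow>
    S \<subseteq> V \<and> (\<forall>x l. range x \<subseteq> S \<and> limitin (norm_topology V N) x l sequentially \<longrightarrow> l \<in> S)"
  unfolding norm_topology_def by (rule M.metric_closedin_iff_sequentially_closed)

lemma closedin_limit:
  "closedin (norm_topology V N) S \<Longrightarrow> limitin (norm_topology V N) x l F \<Longrightarrow> (\<And>i. x i \<in> S) \<Longrightarrow>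
    F \<noteq> bot \<Longrightarrow> l \<in> S"
  by (rule limitin_closedin) (auto intro: always_eventually)

lemma subset_closure_of: "S \<subseteq> V \<Longrightarrow> S \<subseteq> norm_topology V N closure_of S"
  by (simp add: closure_of_subset)

lemma closure_of_iff_approx:
  assumes "S \<subseteq> V"
  shows "x \<in> norm_topology V N closure_of S \<longleftrightarrow> x \<in> V \<and> (\<forall>e>0. \<exists>y\<in>S. N (x - y) < e)"
  using assms unfolding norm_topology_def M.metric_closure_of
  by (auto simp: norm_dist_def subset_iff)

lemma closure_of_sequentially:
  assumes "S \<subseteq> V" "l \<in> norm_topology V N closure_of S"
  obtains x where "\<And>n. x n \<in> S" "limitin (norm_topology V N) x l sequentially"
proof -
  have l_adherent: "l \<in> V" "\<And>e. e > 0 \<Longrightarrow> \<exists>y\<in>S. N (l - y) < e"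
    using assms by (auto simp: closure_of_iff_approx)
  then have "\<forall>n. \<exists>y\<in>S. N (l - y) < inverse (real (Suc n))"
    by simp
  then obtain x where x_approx: "\<And>n. x n \<in> S" "\<And>n. N (l - x n) < inverse (real (Suc n))"
    by metis
  have "limitin (norm_topology V N) x l sequentially"
  proof (rule limitin_normI[OF l_adherent(1) _ _ LIMSEQ_inverse_real_of_nat])
    show x_mem: "x n \<in> V" for n using x_approx(1) assms(1) by blast
    show "N (x n - l) \<le> inverse (real (Suc n))" for n
      using x_approx(2)[of n] N_diff_commute[OF x_mem l_adherent(1)] by simp
  qed
  with x_approx(1) show ?thesis by (rule that)
qed

lemma csubspace_closure_of:
  assumes "csubspace S" "S \<subseteq> V"
  shows "csubspace (norm_topology V N closure_of S)"
proof (rule complex_vector.subspaceI)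
  note closed = closedin_limit[OF closedin_closure_of[of _ S] _ _ sequentially_bot]
  note sub = subsetD[OF subset_closure_of[OF assms(2)]]
  show "0 \<in> norm_topology V N closure_of S"
    using sub complex_vector.subspace_0[OF assms(1)] .
  show "l + k \<in> norm_topology V N closure_of S"
    if l_mem: "l \<in> norm_topology V N closure_of S"
      and k_mem: "k \<in> norm_topology V N closure_of S" for l k
  proof -
    obtain x where "\<And>n. x n \<in> S" "limitin (norm_topology V N) x l sequentially"
      using closure_of_sequentially[OF assms(2) l_mem] by blast
    moreover obtain y where "\<And>n. y n \<in> S" "limitin (norm_topology V N) y k sequentially"
      using closure_of_sequentially[OF assms(2) k_mem] by blast
    ultimately show ?thesis
      by (intro closed[OF limitin_add[of x l _ y k]] sub complex_vector.subspace_add[OF assms(1)])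
  qed
  show "c *\<^sub>C l \<in> norm_topology V N closure_of S"
    if l_mem: "l \<in> norm_topology V N closure_of S" for c l
  proof -
    obtain x where "\<And>n. x n \<in> S" "limitin (norm_topology V N) x l sequentially"
      using closure_of_sequentially[OF assms(2) l_mem] by blast
    then show ?thesis
      by (intro closed[OF limitin_scale[of x l]] sub complex_vector.subspace_scale[OF assms(1)])
  qed
qed

lemma MCauchy_iff:
  "M.MCauchy x \<longleftrightarrow> (\<forall>n. x n \<in> V) \<and> (\<forall>e>0. \<exists>k. \<forall>m\<ge>k. \<forall>n\<ge>k. N (x m - x n) < e)"
  unfolding M.MCauchy_def by (auto simp: norm_dist_def image_subset_iff)

lemma limitin_imp_MCauchy:
  "(\<And>n. x n \<in> V) \<Longrightarrow> limitin (norm_topology V N) x l sequentially \<Longrightarrow> M.MCauchy x"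
  unfolding norm_topology_def by (rule M.convergent_imp_MCauchy[of x l]) auto

lemma banach_space_on_iff:
  "banach_space_on V N \<longleftrightarrow>
    (\<forall>x. M.MCauchy x \<longrightarrow> (\<exists>l. limitin (norm_topology V N) x l sequentially))"
  using normed unfolding banach_space_on_def M.mcomplete_def norm_topology_def by blast

lemma summable_N_imp_convergent:
  assumes "banach_space_on V N" "\<And>n. x n \<in> V" "summable (\<lambda>n. N (x n))"
  shows "\<exists>l. limitin (norm_topology V N) (\<lambda>n. \<Sum>k<n. x k) l sequentially"
proof -
  have "M.MCauchy (\<lambda>n. \<Sum>k<n. x k)"
    unfolding MCauchy_iff
  proof (intro conjI allI impI)
    show partial_sum_mem: "(\<Sum>k<n. x k) \<in> V" for n by (intro sum_mem assms)
    fix e :: real assume "e > 0"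
    then obtain K where tail_less: "\<And>m n. m \<ge> K \<Longrightarrow> norm (\<Sum>k=m..<n. N (x k)) < e"
      using assms(3) unfolding summable_Cauchy by blast
    have tail: "N ((\<Sum>k<n. x k) - (\<Sum>k<m. x k)) < e" if "K \<le> m" "m \<le> n" for m n
    proof -
      have "(\<Sum>k<n. x k) - (\<Sum>k<m. x k) = (\<Sum>k=m..<n. x k)"
        using sum_diff_nat_ivl[of 0 m n x] that by (simp add: atLeast0LessThan)
      then have "N ((\<Sum>k<n. x k) - (\<Sum>k<m. x k)) \<le> (\<Sum>k=m..<n. N (x k))"
        using N_sum_le[of "{m..<n}" x] assms(2) by simp
      then show ?thesis using tail_less[OF that(1), of n] by simp
    qed
    have "N ((\<Sum>k<m. x k) - (\<Sum>k<n. x k)) < e" if "K \<le> m" "K \<le> n" for m n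
      using tail[of m n] tail[of n m] N_diff_commute[OF partial_sum_mem partial_sum_mem, of m n]
        that by (cases "m \<le> n") simp_all
    then show "\<exists>K. \<forall>m\<ge>K. \<forall>n\<ge>K. N ((\<Sum>k<m. x k) - (\<Sum>k<n. x k)) < e" by blast
  qed
  then show ?thesis using assms(1) unfolding banach_space_on_iff by blast
qed

lemma banach_closed_subspace:
  assumes "banach_space_on V N" "closedin (norm_topology V N) S" "csubspace S"
  shows "banach_space_on S N"
proof -
  have S_subset: "S \<subseteq> V" using closedin_subset[OF assms(2)] by simp
  interpret S: cnormed S N
    using normed assms(3) S_subset by unfold_locales (simp add: normed_space_on_def subset_iff)
  have "\<exists>l. limitin (norm_topology S N) x l sequentially" if "S.M.MCauchy x" for x
  proof -
    have x_mem: "x n \<in> S" for n using that unfolding S.MCauchy_iff by blast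
    have "M.MCauchy x" using that S_subset by (auto simp: MCauchy_iff S.MCauchy_iff)
    then obtain l where l_limit: "limitin (norm_topology V N) x l sequentially"
      using assms(1) unfolding banach_space_on_iff by blast
    moreover have "l \<in> S" by (rule closedin_limit[OF assms(2) l_limit x_mem]) simp
    ultimately show ?thesis
      using x_mem by (auto simp: limitin_norm_iff S.limitin_norm_iff)
  qed
  then show ?thesis by (simp add: S.banach_space_on_iff)
qed

lemma not_compactin_separated:
  assumes "S \<subseteq> V" "\<And>n::nat. x n \<in> S" "d > 0" "\<And>m n. m < n \<Longrightarrow> d \<le> N (x m - x n)"
  shows "\<not> compactin (norm_topology V N) (norm_topology V N closure_of S)"
proof
  assume "compactin (norm_topology V N) (norm_topology V N closure_of S)"
  then have "M.mtotally_bounded (norm_topology V N closure_of S)"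
    unfolding norm_topology_def by (rule M.compactin_imp_mtotally_bounded)
  moreover have "range x \<subseteq> norm_topology V N closure_of S"
    using subset_closure_of[OF assms(1)] assms(2) by blast
  ultimately obtain r where subseq: "strict_mono r" "M.MCauchy (x \<circ> r)"
    unfolding M.mtotally_bounded_sequentially by blast
  then obtain k where "\<And>m n. m \<ge> k \<Longrightarrow> n \<ge> k \<Longrightarrow> N (x (r m) - x (r n)) < d"
    using \<open>d > 0\<close> unfolding MCauchy_iff o_def by blast
  from this[of k "Suc k"] have "N (x (r k) - x (r (Suc k))) < d" by simp
  moreover have "d \<le> N (x (r k) - x (r (Suc k)))"
    using assms(4) subseq(1) by (simp add: strict_mono_def)
  ultimately show False by simp
qed

end

section \<open>Bounded operators\<close>

locale cnormed_pair = A: cnormed V N + B: cnormed W M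
  for V :: "'a::complex_vector set" and N and W :: "'b::complex_vector set" and M
begin

lemma continuous_mapI_Lipschitz:
  assumes "\<And>x. x \<in> V \<Longrightarrow> f x \<in> W" "\<And>x y. x \<in> V \<Longrightarrow> y \<in> V \<Longrightarrow> M (f x - f y) \<le> C * N (x - y)"
  shows "continuous_map (norm_topology V N) (norm_topology W M) f"
  unfolding norm_topology_def A.M.metric_continuous_map[OF B.M.Metric_space_axioms]
proof (intro conjI ballI allI impI)
  show "f ` V \<subseteq> W" using assms(1) by blast
  fix x and e :: real assume x_mem: "x \<in> V" and e_pos: "e > 0"
  have abs_C: "C \<le> \<bar>C\<bar> + 1" by arith
  have "M (f x - f y) < e" if y_near: "y \<in> V" "N (x - y) < e / (\<bar>C\<bar> + 1)" for y
  proof -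
    have "M (f x - f y) \<le> (\<bar>C\<bar> + 1) * N (x - y)"
      using assms(2)[OF x_mem y_near(1)]
        mult_right_mono[OF abs_C A.N_nonneg[OF A.diff_mem[OF x_mem y_near(1)]]] by linarith
    also have "\<dots> < e" using y_near(2) by (simp add: field_simps)
    finally show ?thesis .
  qed
  moreover have "0 < e / (\<bar>C\<bar> + 1)" using e_pos by simp
  ultimately show "\<exists>d>0. \<forall>y. y \<in> V \<and> norm_dist V N x y < d \<longrightarrow> norm_dist W M (f x) (f y) < e"
    using x_mem assms(1) by (intro exI[of _ "e / (\<bar>C\<bar> + 1)"]) (simp add: norm_dist_def)
qed

lemma MCauchy_Lipschitz:
  assumes "A.M.MCauchy x" "\<And>n. y n \<in> W" "\<And>m n. M (y m - y n) \<le> C * N (x m - x n)"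
  shows "B.M.MCauchy y"
  unfolding B.MCauchy_iff
proof (intro conjI allI impI)
  show "y n \<in> W" for n by (rule assms(2))
  have abs_C: "C \<le> \<bar>C\<bar> + 1" by arith
  fix e :: real assume "e > 0"
  then have "e / (\<bar>C\<bar> + 1) > 0" by simp
  then obtain k where N_diff_less: "\<And>m n. m \<ge> k \<Longrightarrow> n \<ge> k \<Longrightarrow> N (x m - x n) < e / (\<bar>C\<bar> + 1)"
    and x_mem: "\<And>n. x n \<in> V"
    using assms(1) unfolding A.MCauchy_iff by blast
  have "M (y m - y n) < e" if "m \<ge> k" "n \<ge> k" for m n
  proof -
    have "M (y m - y n) \<le> (\<bar>C\<bar> + 1) * N (x m - x n)"
      using assms(3)[of m n]
        mult_right_mono[OF abs_C A.N_nonneg[OF A.diff_mem[OF x_mem x_mem]], of m n] by linarith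
    also have "\<dots> < e" using N_diff_less[OF that] by (simp add: field_simps)
    finally show ?thesis .
  qed
  then show "\<exists>k. \<forall>m\<ge>k. \<forall>n\<ge>k. M (y m - y n) < e" by blast
qed

abbreviation Ops :: "('a \<Rightarrow> 'b) set" where "Ops \<equiv> bounded_ops V N W M"
abbreviation opnorm :: "('a \<Rightarrow> 'b) \<Rightarrow> real" where "opnorm \<equiv> op_norm V N M"

lemma bounded_opsI:
  assumes "\<And>x. x \<in> V \<Longrightarrow> T x \<in> W" "\<And>x y. x \<in> V \<Longrightarrow> y \<in> V \<Longrightarrow> T (x + y) = T x + T y"
    "\<And>c x. x \<in> V \<Longrightarrow> T (c *\<^sub>C x) = c *\<^sub>C T x" "\<And>x. x \<in> V \<Longrightarrow> M (T x) \<le> C * N x"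
    "\<And>x. x \<notin> V \<Longrightarrow> T x = 0"
  shows "T \<in> Ops"
  using assms unfolding bounded_ops_def clinear_on_def mem_Collect_eq
  by (intro conjI ballI allI impI exI[of _ C]) simp_all

lemma op_mem: "T \<in> Ops \<Longrightarrow> x \<in> V \<Longrightarrow> T x \<in> W"
  by (simp add: bounded_ops_def)

lemma op_add: "T \<in> Ops \<Longrightarrow> x \<in> V \<Longrightarrow> y \<in> V \<Longrightarrow> T (x + y) = T x + T y"
  by (simp add: bounded_ops_def clinear_on_def)

lemma op_scale: "T \<in> Ops \<Longrightarrow> x \<in> V \<Longrightarrow> T (c *\<^sub>C x) = c *\<^sub>C T x"
  by (simp add: bounded_ops_def clinear_on_def)

lemma op_outside: "T \<in> Ops \<Longrightarrow> x \<notin> V \<Longrightarrow> T x = 0"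
  by (simp add: bounded_ops_def)

lemma op_zero: "T \<in> Ops \<Longrightarrow> T 0 = 0"
  using op_scale[of T 0 0] by simp

lemma op_diff: "T \<in> Ops \<Longrightarrow> x \<in> V \<Longrightarrow> y \<in> V \<Longrightarrow> T (x - y) = T x - T y"
  using op_add[of T "x - y" y] by simp

lemma op_eqI:
  assumes "S \<in> Ops" "T \<in> Ops" "\<And>x. x \<in> V \<Longrightarrow> S x = T x"
  shows "S = T"
proof
  fix x show "S x = T x" using assms by (cases "x \<in> V") (simp_all add: op_outside)
qed

lemma bdd_above_unit_ball_image:
  assumes "T \<in> Ops"
  shows "bdd_above ((\<lambda>x. M (T x)) ` {x\<in>V. N x \<le> 1})"
proof -
  obtain C where T_bound: "\<And>x. x \<in> V \<Longrightarrow> M (T x) \<le> C * N x"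
    using assms unfolding bounded_ops_def by blast
  have "M (T x) \<le> \<bar>C\<bar>" if "x \<in> V" "N x \<le> 1" for x
  proof -
    have "C * N x \<le> \<bar>C\<bar> * 1" using that by (intro mult_mono) auto
    then show ?thesis using T_bound[OF that(1)] by linarith
  qed
  then show ?thesis by (intro bdd_aboveI[of _ "\<bar>C\<bar>"]) auto
qed

lemma op_norm_bound:
  assumes "T \<in> Ops" "x \<in> V"
  shows "M (T x) \<le> opnorm T * N x"
proof (cases "x = 0")
  case True then show ?thesis by (simp add: op_zero[OF assms(1)])
next
  case False
  then have pos: "N x > 0" using assms(2) A.N_nonneg[of x] A.N_eq_0_iff[of x] by linarith
  define y where "y = complex_of_real (1 / N x) *\<^sub>C x"
  have y_unit: "y \<in> V" "N y \<le> 1" using assms(2) pos by (auto simp: y_def norm_divide)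
  have "M (T y) \<le> opnorm T"
    unfolding op_norm_def using y_unit by (intro cSUP_upper bdd_above_unit_ball_image[OF assms(1)]) simp
  moreover have "M (T y) = M (T x) / N x"
    unfolding y_def using op_scale[OF assms] op_mem[OF assms] pos by (simp add: norm_divide)
  ultimately show ?thesis using pos by (simp add: field_simps)
qed

lemma op_norm_le:
  assumes "C \<ge> 0" "\<And>x. x \<in> V \<Longrightarrow> M (T x) \<le> C * N x"
  shows "opnorm T \<le> C"
  unfolding op_norm_def
proof (rule cSUP_least)
  have "0 \<in> {x \<in> V. N x \<le> 1}" by simp
  then show "{x \<in> V. N x \<le> 1} \<noteq> {}" by blast
  show "M (T x) \<le> C" if "x \<in> {x \<in> V. N x \<le> 1}" for x
    using assms(2)[of x] mult_left_mono[of "N x" 1 C] assms(1) that by simp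
qed

lemma op_norm_nonneg: "T \<in> Ops \<Longrightarrow> 0 \<le> opnorm T"
  unfolding op_norm_def
  by (rule cSUP_upper2[OF bdd_above_unit_ball_image, of _ 0]) (simp_all add: op_zero)

lemma op_sum_bound:
  assumes "S \<in> Ops" "T \<in> Ops" "x \<in> V"
  shows "M ((S + T) x) \<le> (opnorm S + opnorm T) * N x"
proof -
  have "M ((S + T) x) \<le> M (S x) + M (T x)"
    using B.N_add_le op_mem assms by simp
  also have "\<dots> \<le> (opnorm S + opnorm T) * N x"
    using op_norm_bound[OF assms(1,3)] op_norm_bound[OF assms(2,3)] by (simp add: distrib_right)
  finally show ?thesis .
qed

lemma op_multiple_bound: "T \<in> Ops \<Longrightarrow> x \<in> V \<Longrightarrow> M ((c *\<^sub>C T) x) \<le> (cmod c * opnorm T) * N x"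
  using op_norm_bound[of T x] op_mem[of T x] by (simp add: scaleC_fun_def mult.assoc mult_left_mono)

lemma csubspace_ops: "csubspace Ops"
proof (rule complex_vector.subspaceI)
  show "0 \<in> Ops"
    by (rule bounded_opsI[of _ 0]) simp_all
  show "S + T \<in> Ops" if "S \<in> Ops" "T \<in> Ops" for S T
    by (rule bounded_opsI[OF _ _ _ op_sum_bound[OF that]])
      (use that in \<open>simp_all add: op_mem op_add op_scale op_outside complex_vector.scale_right_distrib\<close>)
  show "c *\<^sub>C T \<in> Ops" if "T \<in> Ops" for c T
    by (rule bounded_opsI[OF _ _ _ op_multiple_bound[OF that]])
      (use that in \<open>simp_all add: scaleC_fun_def op_mem op_add op_scale op_outside
        complex_vector.scale_right_distrib mult.commute\<close>)
qed

lemma op_norm_eq_0_iff: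
  assumes "T \<in> Ops"
  shows "opnorm T = 0 \<longleftrightarrow> T = 0"
proof
  assume zero_norm: "opnorm T = 0"
  show "T = 0"
  proof (rule op_eqI[OF assms complex_vector.subspace_0[OF csubspace_ops]])
    fix x assume "x \<in> V"
    then show "T x = 0 x"
      using op_norm_bound[OF assms, of x] zero_norm B.N_nonneg[OF op_mem[OF assms, of x]]
        B.N_eq_0_iff[OF op_mem[OF assms, of x]] by simp
  qed
next
  assume "T = 0"
  then show "opnorm T = 0"
    using op_norm_nonneg[OF assms] op_norm_le[of 0 T] by simp
qed

lemma op_norm_scale:
  assumes "T \<in> Ops"
  shows "opnorm (c *\<^sub>C T) = cmod c * opnorm T"
proof (rule antisym)
  have opnorm_scale_le: "opnorm (c *\<^sub>C T) \<le> cmod c * opnorm T" if "T \<in> Ops" for c T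
    by (rule op_norm_le[OF _ op_multiple_bound[OF that]]) (simp add: op_norm_nonneg[OF that])
  show "opnorm (c *\<^sub>C T) \<le> cmod c * opnorm T" using opnorm_scale_le[OF assms] .
  have scaled_mem: "c *\<^sub>C T \<in> Ops" by (rule complex_vector.subspace_scale[OF csubspace_ops assms])
  show "cmod c * opnorm T \<le> opnorm (c *\<^sub>C T)"
  proof (cases "c = 0")
    case False
    then show ?thesis using opnorm_scale_le[OF scaled_mem, of "inverse c"]
      by (simp add: norm_divide field_simps)
  qed (use op_norm_nonneg[OF scaled_mem] in simp)
qed

lemma normed_space_ops: "normed_space_on Ops opnorm"
  unfolding normed_space_on_def
proof (intro conjI ballI allI)
  show "opnorm (S + T) \<le> opnorm S + opnorm T" if "S \<in> Ops" "T \<in> Ops" for S T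
    using that by (intro op_norm_le[OF _ op_sum_bound]) (simp_all add: op_norm_nonneg)
qed (simp_all add: csubspace_ops op_norm_nonneg op_norm_eq_0_iff op_norm_scale)

sublocale ops: cnormed Ops opnorm
  by unfold_locales (rule normed_space_ops)

lemma op_diff_bound:
  "S \<in> Ops \<Longrightarrow> T \<in> Ops \<Longrightarrow> x \<in> V \<Longrightarrow> M (S x - T x) \<le> opnorm (S - T) * N x"
  using op_norm_bound[of "S - T" x] ops.diff_mem by simp

lemma continuous_map_op:
  assumes "T \<in> Ops"
  shows "continuous_map (norm_topology V N) (norm_topology W M) T"
proof (rule continuous_mapI_Lipschitz)
  show "M (T x - T y) \<le> opnorm T * N (x - y)" if "x \<in> V" "y \<in> V" for x y
    using op_norm_bound[OF assms A.diff_mem[OF that]] by (simp add: op_diff[OF assms that])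
qed (rule op_mem[OF assms])

lemma limitin_op:
  "T \<in> Ops \<Longrightarrow> limitin (norm_topology V N) x l F \<Longrightarrow> limitin (norm_topology W M) (\<lambda>i. T (x i)) (T l) F"
  using continuous_map_limit[OF continuous_map_op] by (simp add: o_def)

lemma continuous_map_eval:
  assumes "x \<in> V"
  shows "continuous_map (norm_topology Ops opnorm) (norm_topology W M) (\<lambda>T. T x)"
proof -
  interpret ev: cnormed_pair Ops opnorm W M ..
  show ?thesis
    by (rule ev.continuous_mapI_Lipschitz[of _ "N x"])
      (use assms op_diff_bound in \<open>simp_all add: op_mem mult.commute\<close>)
qed

lemma pointwise_limit_op:
  assumes X_mem: "\<And>i. X i \<in> Ops" and bound: "\<forall>\<^sub>F i in F. opnorm (X i) \<le> C" and nontrivial: "F \<noteq> bot"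
    and lim: "\<And>x. x \<in> V \<Longrightarrow> limitin (norm_topology W M) (\<lambda>i. X i x) (T x) F"
    and outside: "\<And>x. x \<notin> V \<Longrightarrow> T x = 0"
  shows "T \<in> Ops"
proof (rule bounded_opsI)
  show "T x \<in> W" if "x \<in> V" for x
    using lim[OF that] by (rule B.limitin_norm_mem)
  show "T (x + y) = T x + T y" if "x \<in> V" "y \<in> V" for x y
    using B.limitin_norm_unique[OF lim[OF A.add_mem[OF that]] _ nontrivial]
      B.limitin_add[OF lim lim] that
    by (simp add: op_add[OF X_mem])
  show "T (c *\<^sub>C x) = c *\<^sub>C T x" if "x \<in> V" for c x
    using B.limitin_norm_unique[OF lim[OF A.scale_mem[OF that]] _ nontrivial]
      B.limitin_scale[OF lim[OF that]] that
    by (simp add: op_scale[OF X_mem])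
  show "M (T x) \<le> C * N x" if "x \<in> V" for x
  proof (rule tendsto_upperbound[OF B.tendsto_N[OF lim[OF that]] _ nontrivial])
    show "\<forall>\<^sub>F i in F. M (X i x) \<le> C * N x"
      using bound
    proof eventually_elim
      case (elim i)
      then show ?case
        using op_norm_bound[OF X_mem that, of i] mult_right_mono[OF elim A.N_nonneg[OF that]]
        by linarith
    qed
  qed
qed (rule outside)

lemma op_norm_diff_pointwise_limit_le:
  assumes X_mem: "\<And>i. X i \<in> Ops" and S_mem: "S \<in> Ops"
    and bound: "\<forall>\<^sub>F i in F. opnorm (S - X i) \<le> C" "0 \<le> C"
    and nontrivial: "F \<noteq> bot" and lim: "\<And>x. x \<in> V \<Longrightarrow> limitin (norm_topology W M) (\<lambda>i. X i x) (T x) F"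
  shows "opnorm (S - T) \<le> C"
proof (rule op_norm_le[OF bound(2)])
  fix x assume x_mem: "x \<in> V"
  have "limitin (norm_topology W M) (\<lambda>i. S x - X i x) (S x - T x) F"
    by (rule B.limitin_diff[OF _ lim[OF x_mem]]) (simp add: op_mem[OF S_mem x_mem])
  moreover have "\<forall>\<^sub>F i in F. M (S x - X i x) \<le> C * N x"
    using bound(1)
  proof eventually_elim
    case (elim i)
    show ?case
      using op_diff_bound[OF S_mem X_mem x_mem, of i] mult_right_mono[OF elim A.N_nonneg[OF x_mem]]
      by linarith
  qed
  ultimately show "M ((S - T) x) \<le> C * N x"
    using tendsto_upperbound[OF B.tendsto_N _ nontrivial] by force
qed

lemma Cauchy_pointwise_limit_imp_limitin:
  assumes Cauchy: "ops.M.MCauchy X"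
    and lim: "\<And>x. x \<in> V \<Longrightarrow> limitin (norm_topology W M) (\<lambda>n. X n x) (T x) sequentially"
    and outside: "\<And>x. x \<notin> V \<Longrightarrow> T x = 0"
  shows "limitin (norm_topology Ops opnorm) X T sequentially"
proof -
  have X_mem: "X n \<in> Ops" for n using Cauchy by (simp add: ops.MCauchy_iff)
  have small: "\<exists>k. \<forall>m\<ge>k. \<forall>n\<ge>k. opnorm (X m - X n) < e" if "e > 0" for e
    using Cauchy that by (simp add: ops.MCauchy_iff)
  obtain k where tail_less: "\<And>n. n \<ge> k \<Longrightarrow> opnorm (X n - X k) < 1"
    using small[OF zero_less_one] by blast
  have "opnorm (X n) \<le> 1 + opnorm (X k)" if "n \<ge> k" for n
    using ops.N_le_diff_add[OF X_mem X_mem, of n k] tail_less[OF that] by simp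
  then have "\<forall>\<^sub>F n in sequentially. opnorm (X n) \<le> 1 + opnorm (X k)"
    by (rule eventually_sequentiallyI)
  then have T_mem: "T \<in> Ops"
    by (rule pointwise_limit_op[OF X_mem _ _ lim outside]) simp_all
  have "(\<lambda>n. opnorm (X n - T)) \<longlonglongrightarrow> 0"
  proof (rule LIMSEQ_I)
    fix e :: real assume e_pos: "e > 0"
    obtain k where opnorm_diff_less: "\<And>m n. m \<ge> k \<Longrightarrow> n \<ge> k \<Longrightarrow> opnorm (X m - X n) < e / 2"
      using small[of "e / 2"] e_pos by auto
    have "opnorm (X m - T) \<le> e / 2" if "m \<ge> k" for m
      using e_pos opnorm_diff_less[OF that]
      by (intro op_norm_diff_pointwise_limit_le[OF X_mem X_mem _ _ _ lim])
        (auto intro!: eventually_sequentiallyI[of k] less_imp_le)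
    then have "norm (opnorm (X m - T) - 0) < e" if "m \<ge> k" for m
      using that e_pos ops.N_nonneg[OF ops.diff_mem[OF X_mem T_mem], of m] by fastforce
    then show "\<exists>k. \<forall>n\<ge>k. norm (opnorm (X n - T) - 0) < e" by blast
  qed
  then show ?thesis using X_mem T_mem by (auto simp: ops.limitin_norm_iff)
qed

lemma banach_space_ops:
  assumes "banach_space_on W M"
  shows "banach_space_on Ops opnorm"
  unfolding ops.banach_space_on_iff
proof (intro allI impI)
  fix X assume Cauchy: "ops.M.MCauchy X"
  then have X_mem: "X n \<in> Ops" for n by (simp add: ops.MCauchy_iff)
  interpret ev: cnormed_pair Ops opnorm W M ..
  have "\<exists>l. limitin (norm_topology W M) (\<lambda>n. X n x) l sequentially" if "x \<in> V" for x
  proof -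
    have "B.M.MCauchy (\<lambda>n. X n x)"
      by (rule ev.MCauchy_Lipschitz[OF Cauchy, of _ "N x"])
        (use that op_diff_bound[OF X_mem X_mem] in \<open>simp_all add: op_mem[OF X_mem] mult.commute\<close>)
    then show ?thesis using assms unfolding B.banach_space_on_iff by blast
  qed
  then obtain L where "\<And>x. x \<in> V \<Longrightarrow> limitin (norm_topology W M) (\<lambda>n. X n x) (L x) sequentially"
    by metis
  then have "limitin (norm_topology Ops opnorm) X (\<lambda>x. if x \<in> V then L x else 0) sequentially"
    by (intro Cauchy_pointwise_limit_imp_limitin[OF Cauchy]) simp_all
  then show "\<exists>T. limitin (norm_topology Ops opnorm) X T sequentially" by blast
qed

end

lemma (in cnormed)
  assumes "S \<in> bounded_ops V N V N" "T \<in> bounded_ops V N V N"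
  shows bounded_ops_comp: "S \<circ> T \<in> bounded_ops V N V N"
    and op_norm_comp_le: "op_norm V N N (S \<circ> T) \<le> op_norm V N N S * op_norm V N N T"
proof -
  interpret cnormed_pair V N V N ..
  have bound: "N ((S \<circ> T) x) \<le> (opnorm S * opnorm T) * N x" if "x \<in> V" for x
    using op_norm_bound[OF assms(1) op_mem[OF assms(2) that]]
      mult_left_mono[OF op_norm_bound[OF assms(2) that] op_norm_nonneg[OF assms(1)]]
    by (simp add: mult.assoc)
  show "S \<circ> T \<in> Ops"
    by (rule bounded_opsI[OF _ _ _ bound])
      (use assms in \<open>simp_all add: op_mem op_add op_scale op_outside op_zero\<close>)
  show "opnorm (S \<circ> T) \<le> opnorm S * opnorm T"
    by (rule op_norm_le[OF _ bound]) (use assms op_norm_nonneg in auto)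
qed

lemma cnormed_complex: "cnormed (UNIV :: complex set) cmod"
proof
  have "csubspace (UNIV :: complex set)" by (rule complex_vector.subspace_UNIV)
  then show "normed_space_on (UNIV :: complex set) cmod"
    unfolding normed_space_on_def scaleC_complex_def
    by (intro conjI ballI allI) (simp_all add: norm_triangle_ineq norm_mult)
qed

section \<open>Hilbert spaces\<close>

locale inner_product_space =
  fixes H :: "'a::complex_vector set" and N :: "'a \<Rightarrow> real" and ip :: "'a \<Rightarrow> 'a \<Rightarrow> complex"
  assumes csubspace_H: "csubspace H" and inner: "inner_product_on H ip"
    and N_eq_sqrt: "x \<in> H \<Longrightarrow> N x = sqrt (Re (ip x x))"
begin

lemma ip_add_left: "x \<in> H \<Longrightarrow> y \<in> H \<Longrightarrow> z \<in> H \<Longrightarrow> ip (x + y) z = ip x z + ip y z"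
  using conjunct1[OF inner[unfolded inner_product_on_def]] by simp

lemma ip_scale_left: "x \<in> H \<Longrightarrow> y \<in> H \<Longrightarrow> ip (c *\<^sub>C x) y = c * ip x y"
  using conjunct1[OF conjunct2[OF inner[unfolded inner_product_on_def]]] by simp

lemma ip_commute:
  assumes "x \<in> H" "y \<in> H"
  shows "ip y x = cnj (ip x y)"
proof -
  have "\<forall>x\<in>H. \<forall>y\<in>H. ip y x = cnj (ip x y)"
    using inner unfolding inner_product_on_def by (elim conjE)
  then show ?thesis using assms by metis
qed

lemma
  assumes "x \<in> H"
  shows ip_self_nonneg: "0 \<le> Re (ip x x)" and ip_self_eq_0_iff: "ip x x = 0 \<longleftrightarrow> x = 0"
proof -
  have "\<forall>x\<in>H. 0 \<le> Re (ip x x) \<and> (ip x x = 0 \<longleftrightarrow> x = 0)"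
    using inner unfolding inner_product_on_def by (elim conjE)
  then show "0 \<le> Re (ip x x)" "ip x x = 0 \<longleftrightarrow> x = 0" using assms by blast+
qed

lemma ip_add_right: "x \<in> H \<Longrightarrow> y \<in> H \<Longrightarrow> z \<in> H \<Longrightarrow> ip x (y + z) = ip x y + ip x z"
  using ip_commute[of "y + z" x] ip_commute[of y x] ip_commute[of z x]
    complex_vector.subspace_add[OF csubspace_H, of y z] by (simp add: ip_add_left)

lemma ip_scale_right: "x \<in> H \<Longrightarrow> y \<in> H \<Longrightarrow> ip x (c *\<^sub>C y) = cnj c * ip x y"
  using ip_commute[of "c *\<^sub>C y" x] ip_commute[of y x]
    complex_vector.subspace_scale[OF csubspace_H, of y c] by (simp add: ip_scale_left)

lemma power2_N: "x \<in> H \<Longrightarrow> (N x)\<^sup>2 = Re (ip x x)"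
  by (simp add: N_eq_sqrt ip_self_nonneg)

lemma ip_self: "x \<in> H \<Longrightarrow> ip x x = complex_of_real ((N x)\<^sup>2)"
  using ip_commute[of x x] by (simp add: power2_N complex_eq_iff)

lemma power2_N_add: "x \<in> H \<Longrightarrow> y \<in> H \<Longrightarrow> (N (x + y))\<^sup>2 = (N x)\<^sup>2 + (N y)\<^sup>2 + 2 * Re (ip x y)"
  using ip_commute[of x y] complex_vector.subspace_add[OF csubspace_H, of x y]
  by (simp add: power2_N ip_add_left ip_add_right)

lemma power2_N_scale:
  assumes "x \<in> H"
  shows "(N (c *\<^sub>C x))\<^sup>2 = (cmod c * N x)\<^sup>2"
proof -
  have scaled_mem: "c *\<^sub>C x \<in> H" by (rule complex_vector.subspace_scale[OF csubspace_H assms])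
  have "ip (c *\<^sub>C x) (c *\<^sub>C x) = (c * cnj c) * ip x x"
    using assms scaled_mem by (simp add: ip_scale_left ip_scale_right)
  also have "\<dots> = complex_of_real ((cmod c * N x)\<^sup>2)"
    unfolding complex_norm_square[symmetric] ip_self[OF assms] by (simp add: power_mult_distrib)
  finally show ?thesis using power2_N[OF scaled_mem] by (metis Re_complex_of_real)
qed

lemma power2_N_diff:
  "x \<in> H \<Longrightarrow> y \<in> H \<Longrightarrow> (N (x - y))\<^sup>2 = (N x)\<^sup>2 + (N y)\<^sup>2 - 2 * Re (ip x y)"
  using power2_N_add[of x "- 1 *\<^sub>C y"] power2_N_scale[of y "- 1"] ip_scale_right[of x y "- 1"]
    complex_vector.subspace_scale[OF csubspace_H, of y "- 1"] by simp

lemma Re_ip_le: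
  assumes "x \<in> H" "y \<in> H"
  shows "Re (ip x y) \<le> N x * N y"
proof (cases "x = 0 \<or> y = 0")
  case True
  then have "ip x y = 0"
    using ip_scale_left[OF assms, of 0] ip_scale_right[OF assms, of 0] by auto
  then show ?thesis using assms by (simp add: N_eq_sqrt ip_self_nonneg)
next
  case False
  let ?a = "N x" and ?b = "N y"
  have pos: "?a * ?b > 0"
    using False assms ip_self[of x] ip_self[of y] ip_self_nonneg ip_self_eq_0_iff
    by (auto simp: zero_less_mult_iff N_eq_sqrt order_less_le)
  have mem: "complex_of_real ?b *\<^sub>C x \<in> H" "complex_of_real ?a *\<^sub>C y \<in> H"
    using assms complex_vector.subspace_scale[OF csubspace_H] by blast+
  have "Re (ip (complex_of_real ?b *\<^sub>C x) (complex_of_real ?a *\<^sub>C y)) = ?b * ?a * Re (ip x y)"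
    using assms mem by (simp add: ip_scale_left ip_scale_right)
  then have "(N (complex_of_real ?b *\<^sub>C x - complex_of_real ?a *\<^sub>C y))\<^sup>2 =
      2 * (?a * ?b) * (?a * ?b - Re (ip x y))"
    unfolding power2_N_diff[OF mem] power2_N_scale[OF assms(1)] power2_N_scale[OF assms(2)]
    by (simp add: power2_eq_square algebra_simps)
  moreover have "0 \<le> (N (complex_of_real ?b *\<^sub>C x - complex_of_real ?a *\<^sub>C y))\<^sup>2" by simp
  ultimately have "0 \<le> 2 * (?a * ?b) * (?a * ?b - Re (ip x y))" by simp
  then show ?thesis using pos by (simp add: zero_le_mult_iff)
qed

lemma normed_space_H: "normed_space_on H N"
  unfolding normed_space_on_def
proof (intro conjI ballI allI)
  show "csubspace H" by (rule csubspace_H)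
  have nonneg: "0 \<le> N x" if "x \<in> H" for x using that by (simp add: N_eq_sqrt ip_self_nonneg)
  show "0 \<le> N x" if "x \<in> H" for x by (rule nonneg[OF that])
  show "N x = 0 \<longleftrightarrow> x = 0" if "x \<in> H" for x
    using ip_self[OF that] ip_self_eq_0_iff[OF that] by auto
  show "N (c *\<^sub>C x) = cmod c * N x" if "x \<in> H" for c x
    using power2_N_scale[OF that, of c] nonneg[OF that]
      nonneg[OF complex_vector.subspace_scale[OF csubspace_H that, of c]]
    by (simp add: power2_eq_iff_nonneg)
  show "N (x + y) \<le> N x + N y" if "x \<in> H" "y \<in> H" for x y
  proof (rule power2_le_imp_le)
    show "(N (x + y))\<^sup>2 \<le> (N x + N y)\<^sup>2"
      using power2_N_add[OF that] Re_ip_le[OF that] by (simp add: power2_sum)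
    show "0 \<le> N x + N y" using nonneg that by simp
  qed
qed

sublocale cnormed H N
  by unfold_locales (rule normed_space_H)

lemma Cauchy_Schwarz:
  assumes "x \<in> H" "y \<in> H"
  shows "cmod (ip x y) \<le> N x * N y"
proof (cases "ip x y = 0")
  case False
  define c where "c = cnj (ip x y) / complex_of_real (cmod (ip x y))"
  have cmod_c: "cmod c = 1" using False by (simp add: c_def norm_divide)
  have "c * ip x y = cmod (ip x y)"
    using False complex_norm_square[of "ip x y"]
    by (simp add: c_def field_simps power2_eq_square)
  then have "Re (ip (c *\<^sub>C x) y) = cmod (ip x y)" using assms by (simp add: ip_scale_left)
  then show ?thesis using Re_ip_le[of "c *\<^sub>C x" y] assms cmod_c by simp
qed (use assms in simp)

context
  fixes \<psi> :: "'a \<Rightarrow> complex" and C :: real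
  assumes functional_add: "\<And>x y. x \<in> H \<Longrightarrow> y \<in> H \<Longrightarrow> \<psi> (x + y) = \<psi> x + \<psi> y"
    and functional_scale: "\<And>c x. x \<in> H \<Longrightarrow> \<psi> (c *\<^sub>C x) = c * \<psi> x"
    and functional_bound: "\<And>x. x \<in> H \<Longrightarrow> cmod (\<psi> x) \<le> C * N x"
begin

text \<open>
  If \<open>\<psi> = ip _ h\<close>, then \<open>energy x = N (x - h)\<^sup>2 - (N h)\<^sup>2\<close>, so the representing vector is the minimiser.
\<close>

definition energy :: "'a \<Rightarrow> real" where "energy x = (N x)\<^sup>2 - 2 * Re (\<psi> x)"

lemma energy_ge:
  assumes "x \<in> H"
  shows "- C\<^sup>2 \<le> energy x"
proof -
  have "Re (\<psi> x) \<le> C * N x"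
    using functional_bound[OF assms] complex_Re_le_cmod[of "\<psi> x"] by linarith
  moreover have "0 \<le> (N x - C)\<^sup>2" by simp
  ultimately show ?thesis unfolding energy_def by (simp add: power2_diff algebra_simps)
qed

lemma energy_midpoint:
  assumes "x \<in> H" "y \<in> H"
  shows "(N (x - y))\<^sup>2 = 2 * energy x + 2 * energy y - 4 * energy ((1/2) *\<^sub>C (x + y))"
proof -
  have "(N ((1/2) *\<^sub>C (x + y)))\<^sup>2 = (N (x + y))\<^sup>2 / 4"
    using assms by (simp add: norm_divide power_mult_distrib power_divide)
  moreover have "Re (\<psi> ((1/2) *\<^sub>C (x + y))) = (Re (\<psi> x) + Re (\<psi> y)) / 2"
    using assms by (simp add: functional_scale functional_add)
  ultimately show ?thesis
    using power2_N_add[OF assms] power2_N_diff[OF assms] by (simp add: energy_def)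
qed

lemma energy_minimizing_sequence_Cauchy:
  assumes x_mem: "\<And>n. x n \<in> H" and energy_lower_bound: "\<And>y. y \<in> H \<Longrightarrow> m \<le> energy y"
    and small: "\<And>n. energy (x n) < m + inverse (real (Suc n))"
  shows "M.MCauchy x"
  unfolding MCauchy_iff
proof (intro conjI allI impI x_mem)
  fix e :: real assume e_pos: "e > 0"
  then obtain k where inverse_less: "inverse (real (Suc k)) < e\<^sup>2 / 4"
    using reals_Archimedean[of "e\<^sup>2 / 4"] by auto
  have "N (x i - x j) < e" if "i \<ge> k" "j \<ge> k" for i j
  proof (rule power2_less_imp_less)
    have tail: "energy (x i) < m + e\<^sup>2 / 4" if "i \<ge> k" for i
    proof -
      have "inverse (real (Suc i)) \<le> inverse (real (Suc k))"
        using that by (intro le_imp_inverse_le) auto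
      then show ?thesis using small[of i] inverse_less by linarith
    qed
    have "(N (x i - x j))\<^sup>2 \<le> 2 * energy (x i) + 2 * energy (x j) - 4 * m"
      using energy_midpoint[OF x_mem x_mem, of i j] energy_lower_bound[of "(1/2) *\<^sub>C (x i + x j)"]
        x_mem by simp
    then show "(N (x i - x j))\<^sup>2 < e\<^sup>2" using tail[OF that(1)] tail[OF that(2)] by simp
  qed (use e_pos in simp)
  then show "\<exists>k. \<forall>i\<ge>k. \<forall>j\<ge>k. N (x i - x j) < e" by blast
qed

lemma tendsto_energy:
  assumes x_mem: "\<And>n. x n \<in> H" and lim: "limitin (norm_topology H N) x h sequentially"
  shows "(\<lambda>n. energy (x n)) \<longlonglongrightarrow> energy h"
proof -
  have h_mem: "h \<in> H" using lim by (rule limitin_norm_mem)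
  have "(\<lambda>n. \<psi> (x n)) \<longlonglongrightarrow> \<psi> h"
  proof (rule LIM_zero_cancel, rule Lim_null_comparison)
    show "(\<lambda>n. C * N (x n - h)) \<longlonglongrightarrow> 0"
      using lim by (intro tendsto_mult_right_zero) (simp add: limitin_norm_iff)
    have "\<psi> (x n) - \<psi> h = \<psi> (x n - h)" for n
      using functional_add[of "x n - h" h] x_mem h_mem by simp
    then show "\<forall>\<^sub>F n in sequentially. norm (\<psi> (x n) - \<psi> h) \<le> C * N (x n - h)"
      using functional_bound[of "x _ - h"] x_mem h_mem by simp
  qed
  then show ?thesis unfolding energy_def by (intro tendsto_intros tendsto_N lim)
qed

lemma energy_minimizer_exists:
  assumes "banach_space_on H N"
  shows "\<exists>h\<in>H. \<forall>y\<in>H. energy h \<le> energy y"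
proof -
  define m where "m = Inf (energy ` H)"
  have bdd: "bdd_below (energy ` H)" using energy_ge by (intro bdd_belowI[of _ "- C\<^sup>2"]) auto
  have m_le: "m \<le> energy y" if "y \<in> H" for y
    unfolding m_def using that bdd by (intro cInf_lower) auto
  have "\<exists>x\<in>H. energy x < m + inverse (real (Suc n))" for n
  proof -
    have "Inf (energy ` H) < m + inverse (real (Suc n))" unfolding m_def by simp
    moreover have "energy ` H \<noteq> {}" using zero_mem by blast
    ultimately show ?thesis using bdd by (simp add: cInf_less_iff)
  qed
  then obtain x where minimising: "\<And>n. x n \<in> H" "\<And>n. energy (x n) < m + inverse (real (Suc n))" by metis
  then obtain h where h_limit: "limitin (norm_topology H N) x h sequentially"
    using assms energy_minimizing_sequence_Cauchy[OF minimising(1) m_le minimising(2)]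
      banach_space_on_iff by blast
  have "(\<lambda>n. m + inverse (real (Suc n))) \<longlonglongrightarrow> m"
    using tendsto_add[OF tendsto_const LIMSEQ_inverse_real_of_nat, of m] by simp
  then have "energy h \<le> m"
    by (rule LIMSEQ_le[OF tendsto_energy[OF minimising(1) h_limit]])
      (use minimising(2) in \<open>auto intro: less_imp_le\<close>)
  then show ?thesis using limitin_norm_mem[OF h_limit] m_le by (meson order_trans)
qed

lemma energy_minimizer_represents_Re:
  assumes h_mem: "h \<in> H" and min: "\<And>x. x \<in> H \<Longrightarrow> energy h \<le> energy x" and y_mem: "y \<in> H"
  shows "Re (\<psi> y) = Re (ip y h)"
proof -
  define b where "b = Re (ip y h) - Re (\<psi> y)"
  define a where "a = (N y)\<^sup>2"
  have variation: "0 \<le> t\<^sup>2 * a + 2 * t * b" for t :: real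
  proof -
    define z where "z = complex_of_real t *\<^sub>C y"
    have z_mem: "z \<in> H" using y_mem by (simp add: z_def)
    have "energy (z + h) = energy h + (N z)\<^sup>2 + 2 * Re (ip z h) - 2 * Re (\<psi> z)"
      using power2_N_add[OF z_mem h_mem] functional_add[OF z_mem h_mem] by (simp add: energy_def)
    moreover have "(N z)\<^sup>2 = t\<^sup>2 * a" "Re (ip z h) = t * Re (ip y h)" "Re (\<psi> z) = t * Re (\<psi> y)"
      using y_mem h_mem by (simp_all add: z_def a_def power_mult_distrib ip_scale_left functional_scale)
    ultimately show ?thesis using min[of "z + h"] z_mem h_mem by (simp add: b_def algebra_simps)
  qed
  define t where "t = - b / (a + 1)"
  have "a \<ge> 0" by (simp add: a_def)
  then have b_eq: "b = - t * (a + 1)" by (simp add: t_def)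
  have "t\<^sup>2 * a + 2 * t * b = - (t\<^sup>2 * (a + 2))"
    unfolding b_eq by (simp add: algebra_simps power2_eq_square)
  then have "t\<^sup>2 * (a + 2) \<le> 0" using variation[of t] by simp
  then have "t = 0" using \<open>a \<ge> 0\<close> by (simp add: mult_le_0_iff)
  then show ?thesis using b_eq by (simp add: b_def)
qed

lemma riesz_representation:
  assumes "banach_space_on H N"
  shows "\<exists>h\<in>H. \<forall>y\<in>H. \<psi> y = ip y h"
proof -
  obtain h where minimiser: "h \<in> H" "\<And>x. x \<in> H \<Longrightarrow> energy h \<le> energy x"
    using energy_minimizer_exists[OF assms] by blast
  have "\<psi> y = ip y h" if "y \<in> H" for y
    using energy_minimizer_represents_Re[OF minimiser, of y]
      energy_minimizer_represents_Re[OF minimiser, of "\<i> *\<^sub>C y"]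
      that minimiser(1) by (simp add: ip_scale_left functional_scale complex_eq_iff)
  then show ?thesis using minimiser(1) by blast
qed

end

end

locale hilbert_space = inner_product_space +
  assumes banach: "banach_space_on H N"
begin

lemma hilbert_space_on: "hilbert_space_on H N"
  unfolding hilbert_space_on_def using banach inner N_eq_sqrt by blast

end

section \<open>Duals and biduals\<close>

lemma limitin_complex_iff:
  "limitin (norm_topology (UNIV :: complex set) cmod) f l F \<longleftrightarrow> (f \<longlongrightarrow> l) F"
proof -
  interpret cnormed "UNIV :: complex set" cmod by (rule cnormed_complex)
  show ?thesis by (simp add: limitin_norm_iff tendsto_norm_zero_iff LIM_zero_iff)
qed

theorem (in cnormed) Banach_Alaoglu:
  "compact {\<mu> \<in> dual V N. \<forall>x\<in>V. cmod (\<mu> x) \<le> N x}"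
proof -
  interpret C: cnormed "UNIV :: complex set" cmod by (rule cnormed_complex)
  interpret P: cnormed_pair V N "UNIV :: complex set" cmod ..
  define K :: "'a \<Rightarrow> complex set" where "K x = (if x \<in> V then cball 0 (N x) else {0})" for x
  define S where "S = (\<Inter>x\<in>V. \<Inter>y\<in>V. {\<mu> :: 'a \<Rightarrow> complex. \<mu> (x + y) = \<mu> x + \<mu> y}) \<inter>
    (\<Inter>c. \<Inter>x\<in>V. {\<mu>. \<mu> (c *\<^sub>C x) = c * \<mu> x})"
  have "compactin (product_topology (\<lambda>i. euclidean) UNIV) (PiE UNIV K)"
    unfolding compactin_PiE by (simp add: K_def compact_cball)
  then have "compact (PiE UNIV K)" by (simp add: euclidean_product_topology)
  moreover have "closed S" unfolding S_def
    by (intro closed_Int closed_INT ballI closed_Collect_eq continuous_intros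
        continuous_on_product_coordinates)
  ultimately have "compact (PiE UNIV K \<inter> S)" by (rule compact_Int_closed)
  moreover have "PiE UNIV K \<inter> S = {\<mu> \<in> dual V N. \<forall>x\<in>V. cmod (\<mu> x) \<le> N x}"
  proof (intro set_eqI iffI)
    fix \<mu> assume mu_mem: "\<mu> \<in> PiE UNIV K \<inter> S"
    then have value_mem: "\<mu> x \<in> K x" for x by (auto simp: PiE_iff)
    have bound: "cmod (\<mu> x) \<le> N x" if "x \<in> V" for x using value_mem[of x] that by (simp add: K_def)
    have "\<mu> \<in> dual V N" unfolding dual_def
    proof (rule P.bounded_opsI)
      show "cmod (\<mu> x) \<le> 1 * N x" if "x \<in> V" for x using bound[OF that] by simp
      show "\<mu> x = 0" if "x \<notin> V" for x using value_mem[of x] that by (simp add: K_def)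
    qed (use mu_mem in \<open>auto simp: S_def scaleC_complex_def\<close>)
    then show "\<mu> \<in> {\<mu> \<in> dual V N. \<forall>x\<in>V. cmod (\<mu> x) \<le> N x}" using bound by simp
  next
    fix \<mu> assume "\<mu> \<in> {\<mu> \<in> dual V N. \<forall>x\<in>V. cmod (\<mu> x) \<le> N x}"
    then show "\<mu> \<in> PiE UNIV K \<inter> S"
      by (auto simp: dual_def S_def K_def P.op_add P.op_scale P.op_outside scaleC_complex_def)
  qed
  ultimately show ?thesis by simp
qed

text \<open>
  The assumption \<open>norming\<close> holds in every normed space by the Hahn--Banach theorem; for algebras
  of operators on a Hilbert space it is witnessed by the functionals \<open>T \<mapsto> \<langle>T x, y\<rangle>\<close>.
\<close>

locale cnormed_dual = cnormed +
  assumes norming: "x \<in> V \<Longrightarrow> 0 \<le> K \<Longrightarrow>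
    (\<And>\<phi>. \<phi> \<in> dual V N \<Longrightarrow> cmod (\<phi> x) \<le> K * dual_norm V N \<phi>) \<Longrightarrow> N x \<le> K"
begin

sublocale Cx: cnormed "UNIV :: complex set" cmod
  by (rule cnormed_complex)

sublocale D: cnormed_pair V N "UNIV :: complex set" cmod
  rewrites "bounded_ops V N UNIV cmod = dual V N" and "op_norm V N cmod = dual_norm V N"
  by unfold_locales (simp_all add: dual_def dual_norm_def)

sublocale E: cnormed_pair "dual V N" "dual_norm V N" "UNIV :: complex set" cmod
  rewrites "bounded_ops (dual V N) (dual_norm V N) UNIV cmod = bidual V N"
    and "op_norm (dual V N) (dual_norm V N) cmod = dual_norm (dual V N) (dual_norm V N)"
  by unfold_locales (simp_all add: bidual_def dual_def dual_norm_def)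

abbreviation bidual_norm :: "(('a \<Rightarrow> complex) \<Rightarrow> complex) \<Rightarrow> real"
  where "bidual_norm \<equiv> dual_norm (dual V N) (dual_norm V N)"

lemma dual_scale: "\<phi> \<in> dual V N \<Longrightarrow> x \<in> V \<Longrightarrow> \<phi> (c *\<^sub>C x) = c * \<phi> x"
  using D.op_scale[of \<phi> x c] by (simp add: scaleC_complex_def)

lemma tendsto_dual:
  "\<phi> \<in> dual V N \<Longrightarrow> limitin (norm_topology V N) x l F \<Longrightarrow> ((\<lambda>i. \<phi> (x i)) \<longlongrightarrow> \<phi> l) F"
  using D.limitin_op[of \<phi> x l F] by (simp add: limitin_complex_iff)

lemma dual_separates:
  assumes "x \<in> V" "y \<in> V" "\<And>\<phi>. \<phi> \<in> dual V N \<Longrightarrow> \<phi> x = \<phi> y"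
  shows "x = y"
proof -
  have "N (x - y) \<le> 0"
    by (rule norming) (use assms in \<open>simp_all add: D.op_diff\<close>)
  then show ?thesis
    using N_nonneg[OF diff_mem[OF assms(1,2)]] N_eq_0_iff[OF diff_mem[OF assms(1,2)]] by simp
qed

lemma bidual_embedding_apply: "\<phi> \<in> dual V N \<Longrightarrow> bidual_embedding V N x \<phi> = \<phi> x"
  by (simp add: bidual_embedding_def)

lemma bidual_embedding_mem:
  assumes "x \<in> V"
  shows "bidual_embedding V N x \<in> bidual V N"
proof (rule E.bounded_opsI)
  show "cmod (bidual_embedding V N x \<phi>) \<le> N x * dual_norm V N \<phi>" if "\<phi> \<in> dual V N" for \<phi>
    using D.op_norm_bound[OF that assms] that by (simp add: bidual_embedding_def mult.commute)
qed (simp_all add: bidual_embedding_def scaleC_fun_def complex_vector.subspace_add[OF D.csubspace_ops]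
    complex_vector.subspace_scale[OF D.csubspace_ops, unfolded scaleC_fun_def])

lemma csubspace_bidual_embedding: "csubspace (bidual_embedding V N ` V)"
proof (rule complex_vector.subspaceI)
  have "bidual_embedding V N 0 = 0"
    by (rule ext) (simp add: bidual_embedding_def D.op_zero)
  then show "0 \<in> bidual_embedding V N ` V" by (metis imageI zero_mem)
next
  have "bidual_embedding V N x + bidual_embedding V N y = bidual_embedding V N (x + y)"
    if "x \<in> V" "y \<in> V" for x y
    using that by (intro ext) (simp add: bidual_embedding_def D.op_add)
  then show "\<mu> + \<nu> \<in> bidual_embedding V N ` V"
    if "\<mu> \<in> bidual_embedding V N ` V" "\<nu> \<in> bidual_embedding V N ` V" for \<mu> \<nu>
    using that by auto
next
  have "c *\<^sub>C bidual_embedding V N x = bidual_embedding V N (c *\<^sub>C x)" if "x \<in> V" for c x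
    using that
    by (intro ext) (simp add: bidual_embedding_def dual_scale scaleC_fun_def scaleC_complex_def)
  then show "c *\<^sub>C \<mu> \<in> bidual_embedding V N ` V" if "\<mu> \<in> bidual_embedding V N ` V" for c \<mu>
    using that by auto
qed

definition bidual_ball :: "(('a \<Rightarrow> complex) \<Rightarrow> complex) set"
  where "bidual_ball = {\<mu> \<in> bidual V N. \<forall>\<phi>\<in>dual V N. cmod (\<mu> \<phi>) \<le> dual_norm V N \<phi>}"

lemma bidual_ball_subset: "bidual_ball \<subseteq> bidual V N"
  by (auto simp: bidual_ball_def)

lemma compact_bidual_ball: "compact bidual_ball"
  using D.ops.Banach_Alaoglu unfolding bidual_ball_def bidual_def .

lemma bidual_embedding_mem_ball:
  assumes "x \<in> V" "N x \<le> 1"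
  shows "bidual_embedding V N x \<in> bidual_ball"
proof -
  have "cmod (\<phi> x) \<le> dual_norm V N \<phi>" if "\<phi> \<in> dual V N" for \<phi>
    using D.op_norm_bound[OF that assms(1)] mult_left_mono[OF assms(2) D.op_norm_nonneg[OF that]]
    by simp
  then show ?thesis
    using bidual_embedding_mem[OF assms(1)] by (simp add: bidual_ball_def bidual_embedding_apply)
qed

lemma topspace_weak_topology: "topspace (weak_topology V N) = V"
proof -
  have "V \<in> {{x \<in> V. \<phi> x \<in> U} |\<phi> U. \<phi> \<in> dual V N \<and> open U}"
    using D.ops.zero_mem by (intro CollectI exI[of _ 0] exI[of _ UNIV]) simp
  then have "\<Union> {{x \<in> V. \<phi> x \<in> U} |\<phi> U. \<phi> \<in> dual V N \<and> open U} = V" by blast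
  then show ?thesis unfolding weak_topology_def topology_generated_by_topspace .
qed

lemma openin_weak_topology:
  "\<phi> \<in> dual V N \<Longrightarrow> open U \<Longrightarrow> openin (weak_topology V N) {x \<in> V. \<phi> x \<in> U}"
  unfolding weak_topology_def by (rule topology_generated_by_Basis) blast

lemma Hausdorff_weak_topology: "Hausdorff_space (weak_topology V N)"
  unfolding Hausdorff_space_def topspace_weak_topology
proof (intro allI impI, elim conjE)
  fix x y assume distinct: "x \<in> V" "y \<in> V" "x \<noteq> y"
  then obtain \<phi> where phi: "\<phi> \<in> dual V N" "\<phi> x \<noteq> \<phi> y" using dual_separates by blast
  then obtain U U' where "open U" "open U'" "\<phi> x \<in> U" "\<phi> y \<in> U'" "U \<inter> U' = {}"
    using hausdorff[OF phi(2)] by blast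
  then show "\<exists>U U'. openin (weak_topology V N) U \<and> openin (weak_topology V N) U' \<and>
      x \<in> U \<and> y \<in> U' \<and> disjnt U U'"
    using distinct phi openin_weak_topology
    by (intro exI[of _ "{x \<in> V. \<phi> x \<in> U}"] exI[of _ "{x \<in> V. \<phi> x \<in> U'}"]) (auto simp: disjnt_def)
qed

lemma continuous_map_bidual_ball_weak:
  assumes T_mem: "\<And>\<mu>. \<mu> \<in> bidual V N \<Longrightarrow> T \<mu> \<in> V"
    and adjoint: "\<And>\<phi>. \<phi> \<in> dual V N \<Longrightarrow> \<exists>\<psi>. \<forall>\<mu>\<in>bidual V N. \<phi> (T \<mu>) = \<mu> \<psi>"
  shows "continuous_map (top_of_set bidual_ball) (weak_topology V N) T"
  unfolding weak_topology_def
proof (rule continuous_on_generated_topo)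
  fix U assume "U \<in> {{x \<in> V. \<phi> x \<in> U} |\<phi> U. \<phi> \<in> dual V N \<and> open U}"
  then obtain \<phi> W where U_subbasic: "U = {x \<in> V. \<phi> x \<in> W}" "\<phi> \<in> dual V N" "open W" by blast
  obtain \<psi> where "\<And>\<mu>. \<mu> \<in> bidual V N \<Longrightarrow> \<phi> (T \<mu>) = \<mu> \<psi>" using adjoint[OF U_subbasic(2)] by blast
  then have "T -` U \<inter> topspace (top_of_set bidual_ball) = bidual_ball \<inter> (\<lambda>\<mu>. \<mu> \<psi>) -` W"
    using T_mem bidual_ball_subset by (auto simp: U_subbasic(1))
  moreover have "open ((\<lambda>\<mu> :: ('a \<Rightarrow> complex) \<Rightarrow> complex. \<mu> \<psi>) -` W)"
    by (rule open_vimage[OF U_subbasic(3) continuous_on_product_coordinates])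
  ultimately show "openin (top_of_set bidual_ball) (T -` U \<inter> topspace (top_of_set bidual_ball))"
    by (simp add: openin_open_Int)
next
  have "\<Union> {{x \<in> V. \<phi> x \<in> U} |\<phi> U. \<phi> \<in> dual V N \<and> open U} = V"
    using topspace_weak_topology unfolding weak_topology_def topology_generated_by_topspace .
  then show "T ` topspace (top_of_set bidual_ball) \<subseteq>
      \<Union> {{x \<in> V. \<phi> x \<in> U} |\<phi> U. \<phi> \<in> dual V N \<and> open U}"
    using T_mem bidual_ball_subset by auto
qed

lemma weakly_compact_map_onI:
  assumes T_mem: "\<And>\<mu>. \<mu> \<in> bidual V N \<Longrightarrow> T \<mu> \<in> V"
    and adjoint: "\<And>\<phi>. \<phi> \<in> dual V N \<Longrightarrow> \<exists>\<psi>. \<forall>\<mu>\<in>bidual V N. \<phi> (T \<mu>) = \<mu> \<psi>"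
    and extends: "\<And>x. x \<in> V \<Longrightarrow> T (bidual_embedding V N x) = S x"
  shows "weakly_compact_map_on V N S"
proof -
  have "compactin (top_of_set bidual_ball) bidual_ball"
    using compact_bidual_ball by (simp add: compactin_subtopology)
  then have compact: "compactin (weak_topology V N) (T ` bidual_ball)"
    by (rule image_compactin[OF _ continuous_map_bidual_ball_weak[where T = T, OF T_mem adjoint]])
  have "S x \<in> T ` bidual_ball" if "x \<in> V" "N x \<le> 1" for x
    using imageI[OF bidual_embedding_mem_ball[OF that], of T] extends[OF that(1)] by simp
  then have "S ` {x \<in> V. N x \<le> 1} \<subseteq> T ` bidual_ball" by blast
  then have "weak_topology V N closure_of (S ` {x \<in> V. N x \<le> 1}) \<subseteq> T ` bidual_ball"
    by (rule closure_of_minimal[OF _ compactin_imp_closedin[OF Hausdorff_weak_topology compact]])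
  then show ?thesis
    unfolding weakly_compact_map_on_def using closed_compactin[OF compact] closedin_closure_of by blast
qed

lemma tendsto_coordinate_nhds:
  fixes \<mu> :: "'b \<Rightarrow> complex"
  shows "((\<lambda>\<nu>. \<nu> \<phi>) \<longlongrightarrow> \<mu> \<phi>) (nhds \<mu>)"
proof -
  have "continuous_on UNIV (\<lambda>\<nu> :: 'b \<Rightarrow> complex. \<nu> \<phi>)"
    by (rule continuous_on_product_coordinates)
  then have "((\<lambda>\<nu>. \<nu> \<phi>) \<longlongrightarrow> \<mu> \<phi>) (at \<mu>)"
    by (simp add: continuous_on_def)
  then show ?thesis using tendsto_at_iff_tendsto_nhds[of "\<lambda>\<nu>. \<nu> \<phi>" \<mu>] by blast
qed

lemma reflexive_weak_cluster_point:
  assumes refl: "reflexive_space V N" and nontrivial: "F \<noteq> bot"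
    and bounded: "\<forall>\<^sub>F i in F. x i \<in> V \<and> N (x i) \<le> 1"
  obtains u where "u \<in> V" "\<And>\<phi> l. \<phi> \<in> dual V N \<Longrightarrow> ((\<lambda>i. \<phi> (x i)) \<longlongrightarrow> l) F \<Longrightarrow> \<phi> u = l"
proof -
  let ?F = "filtermap (\<lambda>i. bidual_embedding V N (x i)) F"
  have "\<forall>\<^sub>F \<mu> in ?F. \<mu> \<in> bidual_ball"
    using bounded bidual_embedding_mem_ball unfolding eventually_filtermap
    by (auto elim: eventually_mono)
  then obtain \<mu> where mu_cluster: "\<mu> \<in> bidual_ball" "inf (nhds \<mu>) ?F \<noteq> bot"
    using nontrivial compact_bidual_ball unfolding compact_filter by (metis filtermap_bot_iff)
  then obtain u where u_representing: "u \<in> V" "\<mu> = bidual_embedding V N u"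
    using refl bidual_ball_subset unfolding reflexive_space_def by blast
  have "\<phi> u = l" if phi: "\<phi> \<in> dual V N" and phi_limit: "((\<lambda>i. \<phi> (x i)) \<longlongrightarrow> l) F" for \<phi> l
  proof -
    have "((\<lambda>\<nu>. \<nu> \<phi>) \<longlongrightarrow> \<mu> \<phi>) (inf (nhds \<mu>) ?F)"
      by (rule tendsto_mono[OF _ tendsto_coordinate_nhds]) simp
    moreover have "((\<lambda>\<nu>. \<nu> \<phi>) \<longlongrightarrow> l) ?F"
      using phi_limit by (simp add: filterlim_filtermap bidual_embedding_apply[OF phi])
    then have "((\<lambda>\<nu>. \<nu> \<phi>) \<longlongrightarrow> l) (inf (nhds \<mu>) ?F)"
      by (rule tendsto_mono[rotated]) simp
    ultimately have "\<mu> \<phi> = l" using tendsto_unique mu_cluster(2) by blast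
    then show ?thesis by (simp add: u_representing(2) bidual_embedding_apply[OF phi])
  qed
  with u_representing(1) show ?thesis by (rule that)
qed

end

section \<open>Commutative normed algebras\<close>

locale comm_normed_algebra = cnormed A N for A :: "'a::complex_vector set" and N +
  fixes mult :: "'a \<Rightarrow> 'a \<Rightarrow> 'a"  (infixl \<open>\<odot>\<close> 70)
  assumes mult_mem [simp]: "x \<in> A \<Longrightarrow> y \<in> A \<Longrightarrow> x \<odot> y \<in> A"
    and mult_add_left: "x \<in> A \<Longrightarrow> y \<in> A \<Longrightarrow> z \<in> A \<Longrightarrow> (x + y) \<odot> z = x \<odot> z + y \<odot> z"
    and mult_scale_left: "x \<in> A \<Longrightarrow> y \<in> A \<Longrightarrow> (c *\<^sub>C x) \<odot> y = c *\<^sub>C (x \<odot> y)"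
    and mult_assoc: "x \<in> A \<Longrightarrow> y \<in> A \<Longrightarrow> z \<in> A \<Longrightarrow> (x \<odot> y) \<odot> z = x \<odot> (y \<odot> z)"
    and mult_commute: "x \<in> A \<Longrightarrow> y \<in> A \<Longrightarrow> x \<odot> y = y \<odot> x"
    and N_mult_le: "x \<in> A \<Longrightarrow> y \<in> A \<Longrightarrow> N (x \<odot> y) \<le> N x * N y"
begin

lemma mult_add_right: "x \<in> A \<Longrightarrow> y \<in> A \<Longrightarrow> z \<in> A \<Longrightarrow> x \<odot> (y + z) = x \<odot> y + x \<odot> z"
  using mult_add_left[of y z x] mult_commute[of x] by simp

lemma mult_scale_right: "x \<in> A \<Longrightarrow> y \<in> A \<Longrightarrow> x \<odot> (c *\<^sub>C y) = c *\<^sub>C (x \<odot> y)"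
  using mult_scale_left[of y x c] mult_commute[of x] by simp

lemma mult_diff_left: "x \<in> A \<Longrightarrow> y \<in> A \<Longrightarrow> z \<in> A \<Longrightarrow> (x - y) \<odot> z = x \<odot> z - y \<odot> z"
  using mult_add_left[of "x - y" y z] by simp

lemma mult_diff_right: "x \<in> A \<Longrightarrow> y \<in> A \<Longrightarrow> z \<in> A \<Longrightarrow> x \<odot> (y - z) = x \<odot> y - x \<odot> z"
  using mult_add_right[of x "y - z" z] by simp

lemma mult_zero_right: "x \<in> A \<Longrightarrow> x \<odot> 0 = 0"
  using mult_scale_right[of x 0 0] by simp

lemma mult_left_commute: "x \<in> A \<Longrightarrow> y \<in> A \<Longrightarrow> z \<in> A \<Longrightarrow> x \<odot> (y \<odot> z) = y \<odot> (x \<odot> z)"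
  using mult_assoc[of x y z] mult_assoc[of y x z] mult_commute[of x y] by simp

lemma commutative_algebra: "commutative_algebra A (\<odot>)"
  unfolding commutative_algebra_def using mult_commute by blast

lemma limitin_mult_right:
  assumes "limitin (norm_topology A N) x l F" "y \<in> A"
  shows "limitin (norm_topology A N) (\<lambda>i. x i \<odot> y) (l \<odot> y) F"
proof (rule limitin_norm_squeeze)
  have l_mem: "l \<in> A" and eventually_mem: "\<forall>\<^sub>F i in F. x i \<in> A"
    using assms(1) by (simp_all add: limitin_norm_iff)
  show "l \<odot> y \<in> A" using l_mem assms(2) by simp
  show "\<forall>\<^sub>F i in F. x i \<odot> y \<in> A \<and> N (x i \<odot> y - l \<odot> y) \<le> N (x i - l) * N y"
    using eventually_mem
  proof eventually_elim
    case (elim i)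
    then show ?case using N_mult_le[of "x i - l" y] l_mem assms(2) by (simp add: mult_diff_left)
  qed
  show "((\<lambda>i. N (x i - l) * N y) \<longlongrightarrow> 0) F"
    using assms(1) by (intro tendsto_mult_left_zero) (simp add: limitin_norm_iff)
qed

lemma limitin_mult_left:
  "limitin (norm_topology A N) x l F \<Longrightarrow> y \<in> A \<Longrightarrow> (\<And>i. x i \<in> A) \<Longrightarrow>
    limitin (norm_topology A N) (\<lambda>i. y \<odot> x i) (y \<odot> l) F"
  using limitin_mult_right[of x l F y] by (simp add: mult_commute[of y] limitin_norm_mem)

subsection \<open>Approximate identities\<close>

definition approximated :: "('i \<Rightarrow> 'a) \<Rightarrow> 'i filter \<Rightarrow> 'a set"
  where "approximated e F = {x \<in> A. limitin (norm_topology A N) (\<lambda>i. e i \<odot> x) x F}"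

lemma approximated_subset: "approximated e F \<subseteq> A"
  by (auto simp: approximated_def)

context
  fixes e :: "'i \<Rightarrow> 'a" and F :: "'i filter"
  assumes e_mem: "\<And>i. e i \<in> A" and N_e_le: "\<And>i. N (e i) \<le> 1"
begin

lemma csubspace_approximated: "csubspace (approximated e F)"
proof (rule complex_vector.subspaceI)
  show "0 \<in> approximated e F" by (simp add: approximated_def mult_zero_right e_mem)
  show "x + y \<in> approximated e F" if "x \<in> approximated e F" "y \<in> approximated e F" for x y
    using that limitin_add[of "\<lambda>i. e i \<odot> x" x F "\<lambda>i. e i \<odot> y" y]
    by (simp add: approximated_def mult_add_right e_mem)
  show "c *\<^sub>C x \<in> approximated e F" if "x \<in> approximated e F" for c x
    using that limitin_scale[of "\<lambda>i. e i \<odot> x" x F c]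
    by (simp add: approximated_def mult_scale_right e_mem)
qed

lemma approximated_mult: "x \<in> approximated e F \<Longrightarrow> y \<in> A \<Longrightarrow> x \<odot> y \<in> approximated e F"
  using limitin_mult_right[of "\<lambda>i. e i \<odot> x" x F y] by (simp add: approximated_def mult_assoc e_mem)

lemma closedin_approximated: "closedin (norm_topology A N) (approximated e F)"
  unfolding closedin_sequentially
proof (intro conjI allI impI)
  show "approximated e F \<subseteq> A" by (rule approximated_subset)
  fix x l assume "range x \<subseteq> approximated e F \<and> limitin (norm_topology A N) x l sequentially"
  then have x_approximated: "x n \<in> A" "limitin (norm_topology A N) (\<lambda>i. e i \<odot> x n) (x n) F"
    and l_mem: "l \<in> A" and lim: "(\<lambda>n. N (x n - l)) \<longlonglongrightarrow> 0" for n
    by (auto simp: approximated_def limitin_norm_iff)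
  have bound: "N (e i \<odot> l - l) \<le> 2 * N (x n - l) + N (e i \<odot> x n - x n)" for i n
  proof -
    have "N (e i \<odot> (l - x n)) \<le> 1 * N (l - x n)"
      using N_mult_le[OF e_mem diff_mem[OF l_mem x_approximated(1)], of i n]
        mult_right_mono[OF N_e_le N_nonneg[OF diff_mem[OF l_mem x_approximated(1)]], of i n]
      by linarith
    then have "N (e i \<odot> l - e i \<odot> x n) \<le> N (x n - l)"
      by (simp add: mult_diff_right e_mem l_mem x_approximated(1) N_diff_commute[of l])
    moreover have "N (e i \<odot> l - l) \<le> N (e i \<odot> l - e i \<odot> x n) + N (e i \<odot> x n - l)"
      "N (e i \<odot> x n - l) \<le> N (e i \<odot> x n - x n) + N (x n - l)"
      by (rule N_diff_triangle; simp add: e_mem l_mem x_approximated(1))+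
    ultimately show ?thesis by linarith
  qed
  have "((\<lambda>i. N (e i \<odot> l - l)) \<longlongrightarrow> 0) F"
  proof (rule tendstoI)
    fix d :: real assume "d > 0"
    then obtain n where x_near: "N (x n - l) < d / 3"
      using order_tendstoD(2)[OF lim, of "d / 3"] by (auto simp: eventually_sequentially)
    have "((\<lambda>i. N (e i \<odot> x n - x n)) \<longlongrightarrow> 0) F"
      using x_approximated(2) by (simp add: limitin_norm_iff)
    then have "\<forall>\<^sub>F i in F. N (e i \<odot> x n - x n) < d / 3"
      by (rule order_tendstoD(2)) (use \<open>d > 0\<close> in simp)
    then show "\<forall>\<^sub>F i in F. dist (N (e i \<odot> l - l)) 0 < d"
    proof eventually_elim
      case (elim i)
      then show ?case using bound[of i n] x_near by (simp add: e_mem l_mem)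
    qed
  qed
  then show "l \<in> approximated e F" using l_mem by (simp add: approximated_def limitin_norm_iff e_mem)
qed

lemma approximately_unitalI:
  assumes "approximated e F = A" "F \<noteq> bot"
  shows "approximately_unital A N (\<odot>)"
  unfolding approximately_unital_def
proof (intro exI conjI ballI)
  let ?F = "filtermap e F"
  show "?F \<noteq> bot" using assms(2) by (simp add: filtermap_bot_iff)
  show "\<forall>\<^sub>F x in ?F. x \<in> A \<and> N x \<le> 1"
    by (simp add: eventually_filtermap e_mem N_e_le)
  fix x assume x_mem: "x \<in> A"
  then have lim: "((\<lambda>i. N (e i \<odot> x - x)) \<longlongrightarrow> 0) F"
    using assms(1) by (auto simp: approximated_def limitin_norm_iff)
  then show "((\<lambda>y. N (y \<odot> x - x)) \<longlongrightarrow> 0) ?F" by (simp add: filterlim_filtermap)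
  show "((\<lambda>y. N (x \<odot> y - x)) \<longlongrightarrow> 0) ?F"
    using lim x_mem by (simp add: filterlim_filtermap mult_commute[of x] e_mem)
qed

end

subsection \<open>Quasinilpotent elements\<close>

text \<open>
  In the absence of a unit, powers of \<open>x\<close> are powers of the operator of multiplication by \<open>x\<close>.
\<close>

definition power_decay :: "real \<Rightarrow> 'a \<Rightarrow> bool"
  where "power_decay d x \<longleftrightarrow> (\<exists>K\<ge>0. \<forall>n. \<forall>z\<in>A. N (((\<odot>) x ^^ n) z) \<le> K * d ^ n * N z)"

lemma power_decayE:
  assumes "power_decay d x"
  obtains K where "K \<ge> 0" "\<And>n z. z \<in> A \<Longrightarrow> N (((\<odot>) x ^^ n) z) \<le> K * d ^ n * N z"
  using assms unfolding power_decay_def by blast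

lemma power_decayI:
  "0 \<le> K \<Longrightarrow> (\<And>n z. z \<in> A \<Longrightarrow> N (((\<odot>) x ^^ n) z) \<le> K * d ^ n * N z) \<Longrightarrow> power_decay d x"
  unfolding power_decay_def by blast

lemma mult_power_mem [simp]: "x \<in> A \<Longrightarrow> z \<in> A \<Longrightarrow> ((\<odot>) x ^^ n) z \<in> A"
  by (induction n) simp_all

lemma mult_power_add:
  assumes "x \<in> A" "u \<in> A" "v \<in> A"
  shows "((\<odot>) x ^^ n) (u + v) = ((\<odot>) x ^^ n) u + ((\<odot>) x ^^ n) v"
  by (induction n) (simp_all add: assms mult_add_right)

lemma mult_power_commute:
  assumes "x \<in> A" "y \<in> A" "z \<in> A"
  shows "y \<odot> ((\<odot>) x ^^ n) z = ((\<odot>) x ^^ n) (y \<odot> z)"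
proof (induction n)
  case (Suc n)
  then show ?case using mult_left_commute[of y x "((\<odot>) x ^^ n) z"] assms by simp
qed simp

lemma power_decay_norm:
  assumes "x \<in> A"
  shows "power_decay (N x) x"
proof (rule power_decayI)
  show "N (((\<odot>) x ^^ n) z) \<le> 1 * N x ^ n * N z" if z_mem: "z \<in> A" for n z
  proof (induction n)
    case (Suc n)
    have "N (((\<odot>) x ^^ Suc n) z) \<le> N x * N (((\<odot>) x ^^ n) z)"
      using N_mult_le assms z_mem by simp
    also have "\<dots> \<le> N x * (1 * N x ^ n * N z)"
      using Suc assms by (intro mult_left_mono) auto
    finally show ?case by (simp add: mult_ac)
  qed simp
qed simp

lemma power_decay_mono:
  assumes "power_decay c x" "0 \<le> c" "c \<le> d"
  shows "power_decay d x"
proof -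
  obtain K where x_decay: "K \<ge> 0" "\<And>n z. z \<in> A \<Longrightarrow> N (((\<odot>) x ^^ n) z) \<le> K * c ^ n * N z"
    using power_decayE[OF assms(1)] by blast
  show ?thesis
  proof (rule power_decayI[OF x_decay(1)])
    fix n z assume z_mem: "z \<in> A"
    have "K * c ^ n * N z \<le> K * d ^ n * N z"
      using assms x_decay(1) z_mem by (intro mult_right_mono mult_left_mono power_mono) auto
    then show "N (((\<odot>) x ^^ n) z) \<le> K * d ^ n * N z" using x_decay(2)[OF z_mem, of n] by linarith
  qed
qed

text \<open>
  The factors \<open>x\<^sup>i y\<^sup>j\<close> let the induction follow Pascal's rule without expanding \<open>(x + y)\<^sup>n\<close>.
\<close>

lemma N_power_add_le:
  assumes x_mem: "x \<in> A" and y_mem: "y \<in> A" and constants_nonneg: "0 \<le> K" "0 \<le> L"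
    and rates_nonneg: "0 \<le> c" "0 \<le> d"
    and decay_x: "\<And>n z. z \<in> A \<Longrightarrow> N (((\<odot>) x ^^ n) z) \<le> K * c ^ n * N z"
    and decay_y: "\<And>n z. z \<in> A \<Longrightarrow> N (((\<odot>) y ^^ n) z) \<le> L * d ^ n * N z"
    and z_mem: "z \<in> A"
  shows "N (((\<odot>) (x + y) ^^ n) (((\<odot>) x ^^ i) (((\<odot>) y ^^ j) z))) \<le>
    K * L * (c ^ i * d ^ j) * (c + d) ^ n * N z"
proof (induction n arbitrary: i j)
  case 0
  have "N (((\<odot>) x ^^ i) (((\<odot>) y ^^ j) z)) \<le> K * c ^ i * N (((\<odot>) y ^^ j) z)"
    using decay_x y_mem z_mem by simp
  also have "\<dots> \<le> K * c ^ i * (L * d ^ j * N z)"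
    using decay_y[OF z_mem] constants_nonneg rates_nonneg by (intro mult_left_mono) auto
  finally show ?case by (simp add: mult_ac)
next
  case (Suc n)
  define w where "w i j = ((\<odot>) x ^^ i) (((\<odot>) y ^^ j) z)" for i j
  have w_mem: "w i j \<in> A" for i j using x_mem y_mem z_mem by (simp add: w_def)
  have "(x + y) \<odot> w i j = w (Suc i) j + w i (Suc j)"
    using mult_add_left[OF x_mem y_mem w_mem]
      mult_power_commute[OF x_mem y_mem, of "((\<odot>) y ^^ j) z" i] y_mem z_mem
    by (simp add: w_def)
  then have "((\<odot>) (x + y) ^^ Suc n) (w i j) =
      ((\<odot>) (x + y) ^^ n) (w (Suc i) j) + ((\<odot>) (x + y) ^^ n) (w i (Suc j))"
    unfolding funpow_Suc_right o_apply using x_mem y_mem w_mem by (simp only: mult_power_add add_mem)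
  then have "N (((\<odot>) (x + y) ^^ Suc n) (w i j)) \<le>
      N (((\<odot>) (x + y) ^^ n) (w (Suc i) j)) + N (((\<odot>) (x + y) ^^ n) (w i (Suc j)))"
    using N_add_le x_mem y_mem w_mem by simp
  also have "\<dots> \<le> K * L * (c ^ Suc i * d ^ j) * (c + d) ^ n * N z +
      K * L * (c ^ i * d ^ Suc j) * (c + d) ^ n * N z"
    unfolding w_def by (intro add_mono Suc)
  also have "\<dots> = K * L * (c ^ i * d ^ j) * (c + d) ^ Suc n * N z" by (simp add: algebra_simps)
  finally show ?case unfolding w_def .
qed

lemma power_decay_add:
  assumes "x \<in> A" "y \<in> A" "0 \<le> c" "0 \<le> d" "power_decay c x" "power_decay d y"
  shows "power_decay (c + d) (x + y)"
proof -
  obtain K where x_decay: "K \<ge> 0" "\<And>n z. z \<in> A \<Longrightarrow> N (((\<odot>) x ^^ n) z) \<le> K * c ^ n * N z"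
    using power_decayE[OF assms(5)] by blast
  obtain L where y_decay: "L \<ge> 0" "\<And>n z. z \<in> A \<Longrightarrow> N (((\<odot>) y ^^ n) z) \<le> L * d ^ n * N z"
    using power_decayE[OF assms(6)] by blast
  show ?thesis
    using N_power_add_le[OF assms(1,2) x_decay(1) y_decay(1) assms(3,4) x_decay(2) y_decay(2), of _ _ 0 0]
      x_decay(1) y_decay(1)
    by (intro power_decayI[of "K * L"]) simp_all
qed

lemma power_decay_scale:
  assumes "x \<in> A" "power_decay d x"
  shows "power_decay (cmod c * d) (c *\<^sub>C x)"
proof -
  obtain K where x_decay: "K \<ge> 0" "\<And>n z. z \<in> A \<Longrightarrow> N (((\<odot>) x ^^ n) z) \<le> K * d ^ n * N z"
    using power_decayE[OF assms(2)] by blast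
  have power: "((\<odot>) (c *\<^sub>C x) ^^ n) z = c ^ n *\<^sub>C ((\<odot>) x ^^ n) z" if "z \<in> A" for n z
    by (induction n) (simp_all add: that assms(1) mult_scale_left mult_scale_right)
  show ?thesis
  proof (rule power_decayI[OF x_decay(1)])
    fix n z assume z_mem: "z \<in> A"
    have "N (((\<odot>) (c *\<^sub>C x) ^^ n) z) = cmod c ^ n * N (((\<odot>) x ^^ n) z)"
      using z_mem assms(1) by (simp add: power norm_power)
    also have "\<dots> \<le> cmod c ^ n * (K * d ^ n * N z)"
      by (intro mult_left_mono x_decay(2) z_mem) simp
    finally show "N (((\<odot>) (c *\<^sub>C x) ^^ n) z) \<le> K * (cmod c * d) ^ n * N z"
      by (simp add: power_mult_distrib mult_ac)
  qed
qed

lemma power_decay_mult: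
  assumes "x \<in> A" "y \<in> A" "0 \<le> c" "power_decay c x" "power_decay d y"
  shows "power_decay (c * d) (x \<odot> y)"
proof -
  obtain K where x_decay: "K \<ge> 0" "\<And>n z. z \<in> A \<Longrightarrow> N (((\<odot>) x ^^ n) z) \<le> K * c ^ n * N z"
    using power_decayE[OF assms(4)] by blast
  obtain L where y_decay: "L \<ge> 0" "\<And>n z. z \<in> A \<Longrightarrow> N (((\<odot>) y ^^ n) z) \<le> L * d ^ n * N z"
    using power_decayE[OF assms(5)] by blast
  have power: "((\<odot>) (x \<odot> y) ^^ n) z = ((\<odot>) x ^^ n) (((\<odot>) y ^^ n) z)" if "z \<in> A" for n z
  proof (induction n)
    case (Suc n)
    then show ?case
      using mult_power_commute[OF assms(1,2), of "((\<odot>) y ^^ n) z" n] assms(1,2) that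
      by (simp add: mult_assoc)
  qed simp
  show ?thesis
  proof (rule power_decayI)
    show "0 \<le> K * L" using x_decay(1) y_decay(1) by simp
    fix n z assume z_mem: "z \<in> A"
    have "N (((\<odot>) (x \<odot> y) ^^ n) z) \<le> K * c ^ n * N (((\<odot>) y ^^ n) z)"
      using x_decay(2) z_mem assms(2) by (simp add: power)
    also have "\<dots> \<le> K * c ^ n * (L * d ^ n * N z)"
      using x_decay(1) assms(3) by (intro mult_left_mono y_decay(2) z_mem) simp
    finally show "N (((\<odot>) (x \<odot> y) ^^ n) z) \<le> K * L * (c * d) ^ n * N z"
      by (simp add: power_mult_distrib mult_ac)
  qed
qed

definition quasinilpotents :: "'a set"
  where "quasinilpotents = {x \<in> A. \<forall>d>0. power_decay d x}"

lemma quasinilpotents_subset: "quasinilpotents \<subseteq> A"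
  by (auto simp: quasinilpotents_def)

lemma csubspace_quasinilpotents: "csubspace quasinilpotents"
proof (rule complex_vector.subspaceI)
  show "0 \<in> quasinilpotents"
    using power_decay_mono[OF power_decay_norm[OF zero_mem]] by (simp add: quasinilpotents_def)
  show "x + y \<in> quasinilpotents" if "x \<in> quasinilpotents" "y \<in> quasinilpotents" for x y
  proof -
    have "power_decay (d / 2 + d / 2) (x + y)" if "d > 0" for d
      using \<open>x \<in> quasinilpotents\<close> \<open>y \<in> quasinilpotents\<close> that unfolding quasinilpotents_def
      by (intro power_decay_add) simp_all
    then show ?thesis using that by (simp add: quasinilpotents_def)
  qed
  show "c *\<^sub>C x \<in> quasinilpotents" if x_mem: "x \<in> quasinilpotents" for c x
  proof -
    have "power_decay d (c *\<^sub>C x)" if "d > 0" for d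
    proof (rule power_decay_mono)
      define q where "q = cmod c + 1"
      have q_bounds: "q > 0" "cmod c \<le> q" by (simp_all add: q_def add_nonneg_pos)
      show "power_decay (cmod c * (d / q)) (c *\<^sub>C x)"
        using x_mem that q_bounds(1) by (intro power_decay_scale) (simp_all add: quasinilpotents_def)
      show "0 \<le> cmod c * (d / q)" using that q_bounds(1) by simp
      show "cmod c * (d / q) \<le> d" using mult_right_mono[OF q_bounds(2), of "d / q"] that q_bounds(1)
        by simp
    qed
    then show ?thesis using x_mem by (simp add: quasinilpotents_def)
  qed
qed

lemma quasinilpotents_mult:
  assumes x_mem: "x \<in> quasinilpotents" and y_mem: "y \<in> A"
  shows "x \<odot> y \<in> quasinilpotents"
proof -
  have "power_decay d (x \<odot> y)" if "d > 0" for d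
  proof -
    have pos: "N y + 1 > 0" using y_mem by (simp add: add_nonneg_pos)
    have "power_decay (N y + 1) y"
      using y_mem by (intro power_decay_mono[OF power_decay_norm]) simp_all
    then have "power_decay (d / (N y + 1) * (N y + 1)) (x \<odot> y)"
      using x_mem y_mem pos that by (intro power_decay_mult) (simp_all add: quasinilpotents_def)
    then show ?thesis using pos by simp
  qed
  then show ?thesis using x_mem y_mem by (simp add: quasinilpotents_def)
qed

lemma closedin_quasinilpotents: "closedin (norm_topology A N) quasinilpotents"
  unfolding closedin_sequentially
proof (intro conjI allI impI)
  show "quasinilpotents \<subseteq> A" by (rule quasinilpotents_subset)
  fix x l assume "range x \<subseteq> quasinilpotents \<and> limitin (norm_topology A N) x l sequentially"
  then have x_mem: "x n \<in> quasinilpotents" and l_mem: "l \<in> A" and lim: "(\<lambda>n. N (x n - l)) \<longlonglongrightarrow> 0" for n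
    by (auto simp: limitin_norm_iff)
  have x_carrier: "x n \<in> A" for n using x_mem quasinilpotents_subset by blast
  have "power_decay d l" if "d > 0" for d
  proof -
    obtain n where x_near: "N (x n - l) < d / 2"
      using order_tendstoD(2)[OF lim, of "d / 2"] \<open>d > 0\<close> by (auto simp: eventually_sequentially)
    have "power_decay (d / 2) (l - x n)"
      using x_near N_diff_commute[OF x_carrier l_mem, of n] x_carrier l_mem
      by (intro power_decay_mono[OF power_decay_norm]) auto
    moreover have "power_decay (d / 2) (x n)"
      using x_mem[of n] that by (simp add: quasinilpotents_def)
    ultimately have "power_decay (d / 2 + d / 2) (l - x n + x n)"
      using that by (intro power_decay_add) (simp_all add: x_carrier l_mem)
    then show ?thesis by simp
  qed
  then show "l \<in> quasinilpotents" using l_mem by (simp add: quasinilpotents_def)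
qed

lemma quasinilpotent_fixes_only_zero:
  assumes "e \<in> quasinilpotents" "x \<in> A" "e \<odot> x = x"
  shows "x = 0"
proof -
  have "power_decay (1 / 2) e" using assms(1) by (simp add: quasinilpotents_def)
  then obtain K where e_decay: "\<And>n z. z \<in> A \<Longrightarrow> N (((\<odot>) e ^^ n) z) \<le> K * (1 / 2) ^ n * N z"
    using power_decayE by blast
  have "((\<odot>) e ^^ n) x = x" for n by (induction n) (simp_all add: assms(3))
  then have bound: "N x \<le> K * (1 / 2) ^ n * N x" for n
    using e_decay[OF assms(2), of n] by simp
  have "(\<lambda>n. K * (1 / 2) ^ n * N x) \<longlonglongrightarrow> 0"
    by (intro tendsto_mult_left_zero tendsto_mult_right_zero LIMSEQ_power_zero) simp
  then have "N x \<le> 0" by (rule LIMSEQ_le_const) (use bound in blast)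
  then show ?thesis using N_nonneg[OF assms(2)] N_eq_0_iff[OF assms(2)] by simp
qed

text \<open>The quasi-inverse is given by the Neumann series.\<close>

lemma quasi_inverse_exists:
  assumes "banach_space_on A N" and u_mem: "u \<in> quasinilpotents"
  shows "\<exists>v\<in>A. v = u + v \<odot> u"
proof -
  have u_carrier: "u \<in> A" using u_mem by (simp add: quasinilpotents_def)
  have "power_decay (1 / 2) u" using u_mem by (simp add: quasinilpotents_def)
  then obtain K where u_decay: "\<And>n z. z \<in> A \<Longrightarrow> N (((\<odot>) u ^^ n) z) \<le> K * (1 / 2) ^ n * N z"
    using power_decayE by blast
  define S where "S n = (\<Sum>k<n. ((\<odot>) u ^^ k) u)" for n
  have S_mem: "S n \<in> A" for n unfolding S_def by (intro sum_mem) (simp add: u_carrier)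
  have "summable (\<lambda>n. K * (1 / 2) ^ n * N u)"
    by (intro summable_mult summable_mult2 summable_geometric) simp
  then have "summable (\<lambda>n. N (((\<odot>) u ^^ n) u))"
    by (rule summable_comparison_test_ev[rotated]) (simp add: u_decay u_carrier)
  then obtain v where v_limit: "limitin (norm_topology A N) S v sequentially"
    unfolding S_def using summable_N_imp_convergent[OF assms(1)] u_carrier by fastforce
  have "S (Suc n) = u + u \<odot> S n" for n
  proof (induction n)
    case (Suc n)
    have "S (Suc (Suc n)) = S (Suc n) + u \<odot> ((\<odot>) u ^^ n) u" by (simp add: S_def)
    also have "\<dots> = u + (u \<odot> S n + u \<odot> ((\<odot>) u ^^ n) u)" by (simp only: Suc add.assoc)
    also have "\<dots> = u + u \<odot> S (Suc n)" using u_carrier by (simp add: S_def mult_add_right sum_mem)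
    finally show ?case .
  qed (simp add: S_def mult_zero_right u_carrier)
  then have "limitin (norm_topology A N) (\<lambda>n. S (Suc n)) (u + u \<odot> v) sequentially"
    using limitin_add[OF _ limitin_mult_left[OF v_limit u_carrier S_mem], of "\<lambda>_. u" u] u_carrier
    by simp
  moreover have "limitin (norm_topology A N) (\<lambda>n. S (Suc n)) v sequentially"
    using limitin_sequentially_offset[OF v_limit, of 1] by simp
  ultimately have "v = u + u \<odot> v"
    using limitin_norm_unique sequentially_bot by blast
  then show ?thesis using limitin_norm_mem[OF v_limit] mult_commute[OF u_carrier] by metis
qed

lemma radical_algebraI:
  assumes "banach_space_on A N" "A \<subseteq> quasinilpotents"
  shows "radical_algebra A (\<odot>)"
proof -
  have False if "maximal_modular_left_ideal L A (\<odot>)" for L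
  proof -
    have left_ideal: "left_ideal_of L A (\<odot>)" "L \<noteq> A" and "\<exists>u\<in>A. \<forall>a\<in>A. a - a \<odot> u \<in> L"
      using that unfolding maximal_modular_left_ideal_def modular_left_ideal_def by blast+
    then obtain u where modular_unit: "u \<in> A" "\<And>a. a \<in> A \<Longrightarrow> a - a \<odot> u \<in> L" by blast
    have sub: "L \<subseteq> A" "csubspace L" and absorb: "\<And>a x. a \<in> A \<Longrightarrow> x \<in> L \<Longrightarrow> a \<odot> x \<in> L"
      using left_ideal unfolding left_ideal_of_def by auto
    obtain v where quasi_inverse: "v \<in> A" "v = u + v \<odot> u"
      using quasi_inverse_exists assms modular_unit(1) by blast
    then have "v - v \<odot> u = u" by (metis add_diff_cancel_right')
    then have "u \<in> L" using modular_unit(2)[OF quasi_inverse(1)] by simp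
    have "a \<in> L" if "a \<in> A" for a
      using complex_vector.subspace_add[OF sub(2) modular_unit(2)[OF that] absorb[OF that \<open>u \<in> L\<close>]]
      by simp
    then show False using left_ideal(2) sub(1) by blast
  qed
  then show ?thesis unfolding radical_algebra_def jacobson_radical_def by blast
qed

end

section \<open>The bidual of a commutative normed algebra\<close>

locale comm_normed_algebra_dual =
  comm_normed_algebra A N mult + cnormed_dual A N
  for A :: "'a::complex_vector set" and N and mult (infixl \<open>\<odot>\<close> 70)
begin

text \<open>The actions \<open>\<phi> \<cdot> b\<close> and \<open>\<mu> \<cdot> \<phi>\<close> in the definition of the Arens product.\<close>

definition dual_act :: "('a \<Rightarrow> complex) \<Rightarrow> 'a \<Rightarrow> 'a \<Rightarrow> complex"
  where "dual_act \<phi> b = (\<lambda>x. if x \<in> A then \<phi> (b \<odot> x) else 0)"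

definition bidual_act :: "(('a \<Rightarrow> complex) \<Rightarrow> complex) \<Rightarrow> ('a \<Rightarrow> complex) \<Rightarrow> 'a \<Rightarrow> complex"
  where "bidual_act \<mu> \<phi> = (\<lambda>b. if b \<in> A then \<mu> (dual_act \<phi> b) else 0)"

lemma
  assumes "\<phi> \<in> dual A N" "b \<in> A"
  shows dual_act_mem: "dual_act \<phi> b \<in> dual A N"
    and dual_norm_dual_act_le: "dual_norm A N (dual_act \<phi> b) \<le> dual_norm A N \<phi> * N b"
proof -
  have bound: "cmod (dual_act \<phi> b x) \<le> (dual_norm A N \<phi> * N b) * N x" if "x \<in> A" for x
  proof -
    have "cmod (dual_act \<phi> b x) \<le> dual_norm A N \<phi> * N (b \<odot> x)"
      using D.op_norm_bound[OF assms(1), of "b \<odot> x"] assms(2) that by (simp add: dual_act_def)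
    also have "\<dots> \<le> dual_norm A N \<phi> * (N b * N x)"
      using N_mult_le assms that D.op_norm_nonneg by (intro mult_left_mono) auto
    finally show ?thesis by (simp add: mult_ac)
  qed
  show "dual_act \<phi> b \<in> dual A N"
    by (rule D.bounded_opsI[OF _ _ _ bound])
      (use assms in \<open>auto simp: dual_act_def mult_add_right mult_scale_right D.op_add D.op_scale\<close>)
  show "dual_norm A N (dual_act \<phi> b) \<le> dual_norm A N \<phi> * N b"
    by (rule D.op_norm_le[OF _ bound]) (use assms D.op_norm_nonneg in auto)
qed

lemma dual_act_add:
  "\<phi> \<in> dual A N \<Longrightarrow> b \<in> A \<Longrightarrow> c \<in> A \<Longrightarrow> dual_act \<phi> (b + c) = dual_act \<phi> b + dual_act \<phi> c"
  by (rule ext) (simp add: dual_act_def mult_add_left D.op_add)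

lemma dual_act_scale:
  "\<phi> \<in> dual A N \<Longrightarrow> b \<in> A \<Longrightarrow> dual_act \<phi> (k *\<^sub>C b) = k *\<^sub>C dual_act \<phi> b"
  by (rule ext) (simp add: dual_act_def mult_scale_left D.op_scale scaleC_fun_def)

lemma
  assumes "\<mu> \<in> bidual A N" "\<phi> \<in> dual A N"
  shows bidual_act_mem: "bidual_act \<mu> \<phi> \<in> dual A N"
    and dual_norm_bidual_act_le: "dual_norm A N (bidual_act \<mu> \<phi>) \<le> bidual_norm \<mu> * dual_norm A N \<phi>"
proof -
  have bound: "cmod (bidual_act \<mu> \<phi> b) \<le> (bidual_norm \<mu> * dual_norm A N \<phi>) * N b" if "b \<in> A" for b
  proof -
    have "cmod (bidual_act \<mu> \<phi> b) \<le> bidual_norm \<mu> * dual_norm A N (dual_act \<phi> b)"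
      using E.op_norm_bound[OF assms(1) dual_act_mem[OF assms(2) that]] that
      by (simp add: bidual_act_def)
    also have "\<dots> \<le> bidual_norm \<mu> * (dual_norm A N \<phi> * N b)"
      by (intro mult_left_mono dual_norm_dual_act_le assms that E.op_norm_nonneg)
    finally show ?thesis by (simp add: mult_ac)
  qed
  show "bidual_act \<mu> \<phi> \<in> dual A N"
    by (rule D.bounded_opsI[OF _ _ _ bound])
      (use assms in \<open>simp_all add: bidual_act_def dual_act_add dual_act_scale dual_act_mem
        E.op_add E.op_scale\<close>)
  show "dual_norm A N (bidual_act \<mu> \<phi>) \<le> bidual_norm \<mu> * dual_norm A N \<phi>"
    by (rule D.op_norm_le[OF _ bound]) (use assms E.op_norm_nonneg D.op_norm_nonneg in auto)
qed

lemma arens_product_eq: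
  "arens_product A N (\<odot>) \<mu> \<eta> = (\<lambda>\<phi>. if \<phi> \<in> dual A N then \<mu> (bidual_act \<eta> \<phi>) else 0)"
  unfolding arens_product_def bidual_act_def dual_act_def ..

lemma bidual_act_embedding:
  assumes "b \<in> A" "\<phi> \<in> dual A N"
  shows "bidual_act (bidual_embedding A N b) \<phi> = dual_act \<phi> b"
proof
  fix x show "bidual_act (bidual_embedding A N b) \<phi> x = dual_act \<phi> b x"
    using assms mult_commute[of x b]
    by (simp add: bidual_act_def bidual_embedding_apply dual_act_mem) (simp add: dual_act_def)
qed

text \<open>
  By Gantmacher's theorem these are the elements acting on \<open>A\<close> as weakly compact operators: the
  second adjoint of multiplication by \<open>b\<close> takes values in \<open>A\<close>.
\<close>

definition weakly_compact_elements :: "'a set"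
  where "weakly_compact_elements =
    {b \<in> A. \<forall>\<mu>\<in>bidual A N. \<exists>c\<in>A. \<forall>\<phi>\<in>dual A N. bidual_act \<mu> \<phi> b = \<phi> c}"

lemma N_diff_le_if_represents:
  assumes mu_mem: "\<mu> \<in> bidual A N" and b_mem: "b \<in> A" "b' \<in> A" and c_mem: "c \<in> A" "c' \<in> A"
    and represents: "\<And>\<phi>. \<phi> \<in> dual A N \<Longrightarrow> bidual_act \<mu> \<phi> b = \<phi> c"
      "\<And>\<phi>. \<phi> \<in> dual A N \<Longrightarrow> bidual_act \<mu> \<phi> b' = \<phi> c'"
  shows "N (c - c') \<le> bidual_norm \<mu> * N (b - b')"
proof (rule norming)
  fix \<phi> assume phi: "\<phi> \<in> dual A N"
  have "\<phi> (c - c') = bidual_act \<mu> \<phi> (b - b')"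
    using D.op_diff[OF phi c_mem] D.op_diff[OF bidual_act_mem[OF mu_mem phi] b_mem]
    by (simp add: represents[OF phi])
  then have "cmod (\<phi> (c - c')) \<le> dual_norm A N (bidual_act \<mu> \<phi>) * N (b - b')"
    using D.op_norm_bound[OF bidual_act_mem[OF mu_mem phi] diff_mem[OF b_mem]] by simp
  also have "\<dots> \<le> bidual_norm \<mu> * dual_norm A N \<phi> * N (b - b')"
    by (intro mult_right_mono dual_norm_bidual_act_le mu_mem phi) (simp add: b_mem)
  finally show "cmod (\<phi> (c - c')) \<le> bidual_norm \<mu> * N (b - b') * dual_norm A N \<phi>"
    by (simp add: mult_ac)
qed (simp_all add: b_mem c_mem E.op_norm_nonneg[OF mu_mem])

lemma closedin_weakly_compact_elements:
  assumes "banach_space_on A N"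
  shows "closedin (norm_topology A N) weakly_compact_elements"
  unfolding closedin_sequentially
proof (intro conjI allI impI)
  show "weakly_compact_elements \<subseteq> A" by (auto simp: weakly_compact_elements_def)
  fix b l assume "range b \<subseteq> weakly_compact_elements \<and> limitin (norm_topology A N) b l sequentially"
  then have b_mem: "b n \<in> weakly_compact_elements" "b n \<in> A"
    and lim: "limitin (norm_topology A N) b l sequentially" for n
    by (auto simp: weakly_compact_elements_def)
  interpret self: cnormed_pair A N A N ..
  have "\<exists>c\<in>A. \<forall>\<phi>\<in>dual A N. bidual_act \<mu> \<phi> l = \<phi> c" if mu_mem: "\<mu> \<in> bidual A N" for \<mu>
  proof -
    have "\<forall>n. \<exists>c\<in>A. \<forall>\<phi>\<in>dual A N. bidual_act \<mu> \<phi> (b n) = \<phi> c"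
      using b_mem(1) mu_mem by (simp add: weakly_compact_elements_def)
    then obtain c where c_represents: "\<And>n. c n \<in> A"
      "\<And>n \<phi>. \<phi> \<in> dual A N \<Longrightarrow> bidual_act \<mu> \<phi> (b n) = \<phi> (c n)"
      by metis
    have "N (c m - c n) \<le> bidual_norm \<mu> * N (b m - b n)" for m n
      by (intro N_diff_le_if_represents mu_mem b_mem(2) c_represents)
    then have "M.MCauchy c"
      by (rule self.MCauchy_Lipschitz[OF limitin_imp_MCauchy[OF b_mem(2) lim] c_represents(1)])
    then obtain k where k_limit: "limitin (norm_topology A N) c k sequentially"
      using assms unfolding banach_space_on_iff by blast
    have "bidual_act \<mu> \<phi> l = \<phi> k" if phi: "\<phi> \<in> dual A N" for \<phi>
      using LIMSEQ_unique[OF tendsto_dual[OF bidual_act_mem[OF mu_mem phi] lim]]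
        tendsto_dual[OF phi k_limit]
      by (simp add: c_represents(2)[OF phi])
    then show ?thesis using limitin_norm_mem[OF k_limit] by blast
  qed
  then show "l \<in> weakly_compact_elements"
    using limitin_norm_mem[OF lim] by (simp add: weakly_compact_elements_def)
qed

lemma weakly_compact_elementD:
  "b \<in> weakly_compact_elements \<Longrightarrow> \<mu> \<in> bidual A N \<Longrightarrow>
    \<exists>c\<in>A. \<forall>\<phi>\<in>dual A N. \<mu> (dual_act \<phi> b) = \<phi> c"
  by (auto simp: weakly_compact_elements_def bidual_act_def)

lemma ideal_in_bidualI:
  assumes "A \<subseteq> weakly_compact_elements"
  shows "ideal_in_bidual A N (\<odot>)"
proof -
  have products: "arens_product A N (\<odot>) \<mu> (bidual_embedding A N b) \<in> bidual_embedding A N ` A"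
    "arens_product A N (\<odot>) (bidual_embedding A N b) \<mu> \<in> bidual_embedding A N ` A"
    if mu_mem: "\<mu> \<in> bidual A N" and b_mem: "b \<in> A" for \<mu> b
  proof -
    obtain c where c_represents: "c \<in> A" "\<And>\<phi>. \<phi> \<in> dual A N \<Longrightarrow> \<mu> (dual_act \<phi> b) = \<phi> c"
      using weakly_compact_elementD[OF subsetD[OF assms b_mem] mu_mem] by blast
    have act: "bidual_act \<mu> \<phi> b = \<phi> c" if "\<phi> \<in> dual A N" for \<phi>
      using c_represents(2)[OF that] b_mem by (simp add: bidual_act_def)
    have "arens_product A N (\<odot>) \<mu> (bidual_embedding A N b) = bidual_embedding A N c"
      by (simp add: fun_eq_iff arens_product_eq bidual_act_embedding b_mem c_represents(2)
          bidual_embedding_def[of _ _ c])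
    moreover have "arens_product A N (\<odot>) (bidual_embedding A N b) \<mu> = bidual_embedding A N c"
      by (simp add: fun_eq_iff arens_product_eq bidual_embedding_apply bidual_act_mem[OF mu_mem] act
          bidual_embedding_def[of _ _ c])
    ultimately show "arens_product A N (\<odot>) \<mu> (bidual_embedding A N b) \<in> bidual_embedding A N ` A"
      "arens_product A N (\<odot>) (bidual_embedding A N b) \<mu> \<in> bidual_embedding A N ` A"
      using c_represents(1) by simp_all
  qed
  then show ?thesis
    unfolding ideal_in_bidual_def ideal_of_def left_ideal_of_def
    using bidual_embedding_mem csubspace_bidual_embedding by auto
qed

lemma weakly_compact_algebraI:
  assumes "A \<subseteq> weakly_compact_elements"
  shows "weakly_compact_algebra A N (\<odot>)"
  unfolding weakly_compact_algebra_def
proof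
  fix a assume a_mem: "a \<in> A"
  define b where "b = a \<odot> a"
  have b_mem: "b \<in> A" using a_mem by (simp add: b_def)
  have "\<exists>c\<in>A. \<forall>\<phi>\<in>dual A N. \<mu> (dual_act \<phi> b) = \<phi> c" if "\<mu> \<in> bidual A N" for \<mu>
    by (rule weakly_compact_elementD[OF subsetD[OF assms b_mem] that])
  then obtain T where T_represents: "\<And>\<mu>. \<mu> \<in> bidual A N \<Longrightarrow> T \<mu> \<in> A"
    "\<And>\<mu> \<phi>. \<mu> \<in> bidual A N \<Longrightarrow> \<phi> \<in> dual A N \<Longrightarrow> \<mu> (dual_act \<phi> b) = \<phi> (T \<mu>)"
    by metis
  show "weakly_compact_map_on A N (\<lambda>x. a \<odot> x \<odot> a)"
  proof (rule weakly_compact_map_onI[of T])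
    show "T \<mu> \<in> A" if "\<mu> \<in> bidual A N" for \<mu> by (rule T_represents(1)[OF that])
    show "\<exists>\<psi>. \<forall>\<mu>\<in>bidual A N. \<phi> (T \<mu>) = \<mu> \<psi>" if "\<phi> \<in> dual A N" for \<phi>
      using T_represents(2)[OF _ that] by metis
    fix x assume x_mem: "x \<in> A"
    note ex = bidual_embedding_mem[OF x_mem]
    have "T (bidual_embedding A N x) = b \<odot> x"
    proof (rule dual_separates[OF T_represents(1)[OF ex]])
      fix \<phi> assume phi: "\<phi> \<in> dual A N"
      have "\<phi> (T (bidual_embedding A N x)) = dual_act \<phi> b x"
        using T_represents(2)[OF ex phi] dual_act_mem[OF phi b_mem]
        by (simp add: bidual_embedding_apply)
      then show "\<phi> (T (bidual_embedding A N x)) = \<phi> (b \<odot> x)" using x_mem by (simp add: dual_act_def)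
    qed (simp add: b_mem x_mem)
    also have "b \<odot> x = a \<odot> x \<odot> a" using a_mem x_mem mult_commute[OF x_mem a_mem]
      by (simp add: b_def mult_assoc)
    finally show "T (bidual_embedding A N x) = a \<odot> x \<odot> a" .
  qed
qed

lemma reflexive_imp_unit:
  assumes "reflexive_space A N" "F \<noteq> bot" and e_unit_ball: "\<And>i. e i \<in> A" "\<And>i. N (e i) \<le> 1"
    and approx: "\<And>x. x \<in> A \<Longrightarrow> limitin (norm_topology A N) (\<lambda>i. e i \<odot> x) x F"
  shows "\<exists>u\<in>A. \<forall>x\<in>A. u \<odot> x = x"
proof -
  obtain u where u_mem: "u \<in> A"
    and cluster: "\<And>\<phi> l. \<phi> \<in> dual A N \<Longrightarrow> ((\<lambda>i. \<phi> (e i)) \<longlongrightarrow> l) F \<Longrightarrow> \<phi> u = l"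
    using reflexive_weak_cluster_point[OF assms(1,2), of e] e_unit_ball by auto
  have "u \<odot> x = x" if x_mem: "x \<in> A" for x
  proof (rule dual_separates)
    fix \<phi> assume phi: "\<phi> \<in> dual A N"
    have "((\<lambda>i. \<phi> (e i \<odot> x)) \<longlongrightarrow> \<phi> x) F" by (rule tendsto_dual[OF phi approx[OF x_mem]])
    then have "((\<lambda>i. dual_act \<phi> x (e i)) \<longlongrightarrow> \<phi> x) F"
      by (simp add: dual_act_def e_unit_ball(1) mult_commute[of x] x_mem)
    then have "dual_act \<phi> x u = \<phi> x" by (rule cluster[OF dual_act_mem[OF phi x_mem]])
    then show "\<phi> (u \<odot> x) = \<phi> x" using u_mem x_mem by (simp add: dual_act_def mult_commute)
  qed (simp_all add: u_mem x_mem)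
  then show ?thesis using u_mem by blast
qed

end

section \<open>The operator algebra of a commutative product on a Hilbert space\<close>

text \<open>
  \<open>L h\<close> is multiplication by \<open>h\<close> and \<open>p n\<close> is the power of \<open>p 0\<close> with exponent \<open>n + 1\<close>.
  Associativity is not assumed: it passes from the powers \<open>p n\<close> to their closed span.
\<close>

locale hilbert_algebra = hilbert_space H N ip for H :: "'a::complex_vector set" and N ip +
  fixes L :: "'a \<Rightarrow> 'a \<Rightarrow> 'a" and C :: real and p :: "nat \<Rightarrow> 'a"
  assumes L_mem: "h \<in> H \<Longrightarrow> L h \<in> bounded_ops H N H N"
    and L_add: "h \<in> H \<Longrightarrow> k \<in> H \<Longrightarrow> L (h + k) = L h + L k"
    and L_scale: "h \<in> H \<Longrightarrow> L (c *\<^sub>C h) = c *\<^sub>C L h"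
    and L_commute: "h \<in> H \<Longrightarrow> k \<in> H \<Longrightarrow> L h k = L k h"
    and op_norm_L_le: "h \<in> H \<Longrightarrow> op_norm H N N (L h) \<le> C * N h"
    and p_mem: "p n \<in> H"
    and L_p_p: "L (p n) (p m) = p (n + m + 1)"
    and p_dense: "csubspace Z \<Longrightarrow> closedin (norm_topology H N) Z \<Longrightarrow> range p \<subseteq> Z \<Longrightarrow> Z = H"
    and p_small: "d > 0 \<Longrightarrow> \<exists>K. \<forall>n. N (p n) \<le> K * d ^ n"
begin

sublocale P: cnormed_pair H N H N ..

abbreviation Ops :: "('a \<Rightarrow> 'a) set" where "Ops \<equiv> bounded_ops H N H N"
abbreviation opnorm :: "('a \<Rightarrow> 'a) \<Rightarrow> real" where "opnorm \<equiv> op_norm H N N"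

lemma L_app_mem: "h \<in> H \<Longrightarrow> z \<in> H \<Longrightarrow> L h z \<in> H"
  using P.op_mem[OF L_mem] .

lemma L_diff: "h \<in> H \<Longrightarrow> k \<in> H \<Longrightarrow> L (h - k) = L h - L k"
  using L_add[of "h - k" k] by simp

lemma op_eq_if_eq_on_p:
  assumes "S \<in> Ops" "T \<in> Ops" "\<And>n. S (p n) = T (p n)"
  shows "S = T"
proof (rule P.op_eqI[OF assms(1,2)])
  have "{z \<in> H. S z = T z} = H"
  proof (rule p_dense)
    show "csubspace {z \<in> H. S z = T z}"
      using assms by (intro complex_vector.subspaceI) (auto simp: P.op_zero P.op_add P.op_scale)
    show "closedin (norm_topology H N) {z \<in> H. S z = T z}"
      using assms
        closedin_continuous_maps_eq[OF Hausdorff_norm_topology P.continuous_map_op P.continuous_map_op]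
      by fastforce
    show "range p \<subseteq> {z \<in> H. S z = T z}" using assms p_mem by auto
  qed
  then show "S z = T z" if "z \<in> H" for z using that by auto
qed

lemma L_p_comp_L_p: "L (p l) \<circ> L (p m) = L (p (l + m + 1))"
  by (rule op_eq_if_eq_on_p) (simp_all add: bounded_ops_comp L_mem p_mem L_p_p add.assoc)

lemma L_assoc:
  assumes "h \<in> H" "k \<in> H"
  shows "L (L h k) = L h \<circ> L k"
proof -
  have L_L_p: "L k \<circ> L (p l) = L (p l) \<circ> L k" if "k \<in> H" for k l
  proof (rule op_eq_if_eq_on_p)
    show "(L k \<circ> L (p l)) (p n) = (L (p l) \<circ> L k) (p n)" for n
      using fun_cong[OF L_p_comp_L_p[of l n], of k] that by (simp add: L_commute[of k] p_mem L_p_p)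
  qed (simp_all add: that bounded_ops_comp L_mem p_mem)
  show ?thesis
  proof (rule op_eq_if_eq_on_p)
    show "L (L h k) (p n) = (L h \<circ> L k) (p n)" for n
      using fun_cong[OF L_L_p[OF assms(1), of n], of k] assms
      by (simp add: L_commute[of _ "p n"] p_mem L_app_mem)
  qed (simp_all add: assms L_mem bounded_ops_comp L_app_mem)
qed

lemma limitin_L:
  assumes "limitin (norm_topology H N) x l F"
  shows "limitin (norm_topology Ops opnorm) (\<lambda>i. L (x i)) (L l) F"
proof -
  interpret LP: cnormed_pair H N Ops opnorm ..
  have "continuous_map (norm_topology H N) (norm_topology Ops opnorm) L"
    by (rule LP.continuous_mapI_Lipschitz[of _ C]) (simp_all add: L_mem op_norm_L_le flip: L_diff)
  from continuous_map_limit[OF this assms] show ?thesis by (simp add: o_def)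
qed

definition A :: "('a \<Rightarrow> 'a) set"
  where "A = norm_topology Ops opnorm closure_of (L ` H)"

lemma L_image_subset: "L ` H \<subseteq> Ops"
  using L_mem by auto

lemma csubspace_L_image: "csubspace (L ` H)"
proof (rule complex_vector.subspaceI)
  show "0 \<in> L ` H" using L_scale[of 0 0] by (auto intro!: image_eqI[of _ _ 0])
  show "x + y \<in> L ` H" if "x \<in> L ` H" "y \<in> L ` H" for x y
    using that L_add by (metis (no_types, lifting) add_mem image_iff)
  show "c *\<^sub>C x \<in> L ` H" if "x \<in> L ` H" for c x
    using that L_scale by (metis (no_types, lifting) scale_mem image_iff)
qed

lemma closedin_A: "closedin (norm_topology Ops opnorm) A"
  by (simp add: A_def)

lemma A_subset_Ops: "A \<subseteq> Ops"
  using closedin_subset[OF closedin_A] by simp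

lemma A_mem_Ops: "x \<in> A \<Longrightarrow> x \<in> Ops"
  using A_subset_Ops by blast

lemma A_app_mem: "x \<in> A \<Longrightarrow> z \<in> H \<Longrightarrow> x z \<in> H"
  using A_mem_Ops P.op_mem by blast

lemma csubspace_A: "csubspace A"
  unfolding A_def by (rule P.ops.csubspace_closure_of[OF csubspace_L_image L_image_subset])

lemma L_mem_A: "h \<in> H \<Longrightarrow> L h \<in> A"
  unfolding A_def using P.ops.subset_closure_of[OF L_image_subset] by blast

lemma eq_on_A_if_eq_on_L:
  assumes "continuous_map (norm_topology Ops opnorm) (norm_topology H N) f"
    "continuous_map (norm_topology Ops opnorm) (norm_topology H N) g"
    "\<And>h. h \<in> H \<Longrightarrow> f (L h) = g (L h)" "x \<in> A"
  shows "f x = g x"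
  by (rule forall_in_closure_of_eq[OF _ Hausdorff_norm_topology assms(1,2), of _ "L ` H"])
    (use assms(3,4) in \<open>auto simp: A_def\<close>)

lemma A_comp_L:
  assumes "x \<in> A" "h \<in> H"
  shows "x \<circ> L h = L (x h)"
proof (rule P.op_eqI)
  fix g assume g_mem: "g \<in> H"
  have "x (L h g) = (L g \<circ> (\<lambda>x. x h)) x"
  proof (rule eq_on_A_if_eq_on_L[OF P.continuous_map_eval
        continuous_map_compose[OF P.continuous_map_eval P.continuous_map_op]])
    show "L k (L h g) = (L g \<circ> (\<lambda>x. x h)) (L k)" if "k \<in> H" for k
      using that assms g_mem by (simp add: L_commute[OF g_mem] L_app_mem L_assoc)
  qed (use assms g_mem in \<open>simp_all add: L_app_mem L_mem\<close>)
  then show "(x \<circ> L h) g = L (x h) g" using assms g_mem by (simp add: L_commute[OF g_mem] A_app_mem)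
qed (use assms in \<open>simp_all add: L_mem bounded_ops_comp A_app_mem A_mem_Ops\<close>)

lemma L_comp_A:
  assumes "x \<in> A" "h \<in> H"
  shows "L h \<circ> x = L (x h)"
proof (rule P.op_eqI)
  fix z assume z_mem: "z \<in> H"
  have "L h (x z) = L (x z) h" using assms z_mem by (simp add: L_commute A_app_mem)
  also have "\<dots> = x (L z h)" using fun_cong[OF A_comp_L[OF assms(1) z_mem], of h] by simp
  also have "\<dots> = x (L h z)" by (simp add: L_commute[OF z_mem assms(2)])
  also have "\<dots> = L (x h) z" using fun_cong[OF A_comp_L[OF assms], of z] by simp
  finally show "(L h \<circ> x) z = L (x h) z" by simp
qed (use assms in \<open>simp_all add: L_mem bounded_ops_comp A_app_mem A_mem_Ops\<close>)

lemma A_comp_commute: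
  assumes "x \<in> A" "y \<in> A"
  shows "x \<circ> y = y \<circ> x"
proof (rule P.op_eqI)
  fix z assume z_mem: "z \<in> H"
  have "(x \<circ> (\<lambda>y. y z)) y = y (x z)"
  proof (rule eq_on_A_if_eq_on_L[OF
        continuous_map_compose[OF P.continuous_map_eval P.continuous_map_op] P.continuous_map_eval])
    show "(x \<circ> (\<lambda>y. y z)) (L h) = L h (x z)" if "h \<in> H" for h
      using L_comp_A[OF assms(1) that] A_comp_L[OF assms(1) that] by (simp add: fun_eq_iff)
  qed (use assms z_mem in \<open>simp_all add: A_mem_Ops A_app_mem\<close>)
  then show "(x \<circ> y) z = (y \<circ> x) z" by simp
qed (use assms in \<open>simp_all add: bounded_ops_comp A_mem_Ops\<close>)

lemma comp_diff_right: "S \<in> Ops \<Longrightarrow> T \<in> Ops \<Longrightarrow> T' \<in> Ops \<Longrightarrow> S \<circ> (T - T') = (S \<circ> T) - (S \<circ> T')"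
proof
  fix z assume "S \<in> Ops" "T \<in> Ops" "T' \<in> Ops"
  then show "(S \<circ> (T - T')) z = ((S \<circ> T) - (S \<circ> T')) z"
    by (cases "z \<in> H") (simp_all add: P.op_diff P.op_mem P.op_outside P.op_zero)
qed

lemma continuous_map_comp_left:
  assumes "S \<in> Ops"
  shows "continuous_map (norm_topology Ops opnorm) (norm_topology Ops opnorm) (\<lambda>T. S \<circ> T)"
proof -
  interpret OP: cnormed_pair Ops opnorm Ops opnorm ..
  show ?thesis
    by (rule OP.continuous_mapI_Lipschitz[of _ "opnorm S"])
      (use assms in \<open>simp_all add: bounded_ops_comp op_norm_comp_le flip: comp_diff_right\<close>)
qed

lemma A_comp_mem:
  assumes "x \<in> A" "y \<in> A"
  shows "x \<circ> y \<in> A"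
proof (rule forall_in_closure_of[of y "norm_topology Ops opnorm" "L ` H"])
  show "y \<in> norm_topology Ops opnorm closure_of (L ` H)" using assms(2) by (simp add: A_def)
  show "x \<circ> y \<in> A" if "y \<in> L ` H" for y
    using that assms(1) by (auto simp: A_comp_L L_mem_A A_app_mem)
  show "closedin (norm_topology Ops opnorm) {y \<in> topspace (norm_topology Ops opnorm). x \<circ> y \<in> A}"
    by (rule closedin_continuous_map_preimage[OF continuous_map_comp_left closedin_A])
      (rule A_mem_Ops[OF assms(1)])
qed

lemma operator_algebra_on_A: "operator_algebra_on H N A"
  unfolding operator_algebra_on_def subalgebra_of_def
  by (simp add: hilbert_space_on A_subset_Ops csubspace_A closedin_A A_comp_mem)

lemma banach_space_A: "banach_space_on A opnorm"
  by (rule P.ops.banach_closed_subspace[OF P.banach_space_ops[OF banach] closedin_A csubspace_A])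

sublocale A: comm_normed_algebra A opnorm "(\<circ>)"
proof
  show "normed_space_on A opnorm" using banach_space_A by (simp add: banach_space_on_def)
  show "(c *\<^sub>C x) \<circ> y = c *\<^sub>C (x \<circ> y)" for c x y by (simp add: scaleC_fun_def fun_eq_iff)
qed (use A_comp_mem A_comp_commute in \<open>auto simp: fun_eq_iff A_mem_Ops op_norm_comp_le\<close>)

definition vector_functional :: "'a \<Rightarrow> 'a \<Rightarrow> ('a \<Rightarrow> 'a) \<Rightarrow> complex"
  where "vector_functional z y = (\<lambda>x. if x \<in> A then ip (x z) y else 0)"

lemma
  assumes "z \<in> H" "y \<in> H"
  shows vector_functional_mem: "vector_functional z y \<in> dual A opnorm"
    and dual_norm_vector_functional_le: "dual_norm A opnorm (vector_functional z y) \<le> N z * N y"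
proof -
  interpret Cx: cnormed "UNIV :: complex set" cmod by (rule cnormed_complex)
  interpret D: cnormed_pair A opnorm "UNIV :: complex set" cmod ..
  have bound: "cmod (vector_functional z y x) \<le> (N z * N y) * opnorm x" if "x \<in> A" for x
  proof -
    have "cmod (vector_functional z y x) \<le> N (x z) * N y"
      using Cauchy_Schwarz[OF A_app_mem[OF that assms(1)] assms(2)] that
      by (simp add: vector_functional_def)
    also have "\<dots> \<le> opnorm x * N z * N y"
      using P.op_norm_bound[OF A_mem_Ops[OF that] assms(1)] assms by (intro mult_right_mono) auto
    finally show ?thesis by (simp add: mult_ac)
  qed
  show "vector_functional z y \<in> dual A opnorm"
    unfolding dual_def
    by (rule D.bounded_opsI[OF _ _ _ bound])
      (use assms in \<open>simp_all add: vector_functional_def ip_add_left ip_scale_left A_app_mem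
        scaleC_fun_def scaleC_complex_def A.scale_mem[unfolded scaleC_fun_def]\<close>)
  show "dual_norm A opnorm (vector_functional z y) \<le> N z * N y"
    unfolding dual_norm_def by (rule D.op_norm_le[OF _ bound]) (use assms in auto)
qed

sublocale A: comm_normed_algebra_dual A opnorm "(\<circ>)"
proof
  fix x K assume x_mem: "x \<in> A" and K_nonneg: "0 \<le> K"
    and bound: "\<And>\<phi>. \<phi> \<in> dual A opnorm \<Longrightarrow> cmod (\<phi> x) \<le> K * dual_norm A opnorm \<phi>"
  show "opnorm x \<le> K"
  proof (rule P.op_norm_le[OF K_nonneg])
    fix z assume z_mem: "z \<in> H"
    have app_mem: "x z \<in> H" using A_app_mem[OF x_mem z_mem] .
    have "N (x z) * N (x z) = cmod (vector_functional z (x z) x)"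
      using x_mem app_mem by (simp add: vector_functional_def ip_self power2_eq_square norm_mult)
    also have "\<dots> \<le> K * (N z * N (x z))"
      using bound[OF vector_functional_mem[OF z_mem app_mem]]
        mult_left_mono[OF dual_norm_vector_functional_le[OF z_mem app_mem] K_nonneg] by linarith
    finally have "N (x z) * N (x z) \<le> (K * N z) * N (x z)" by (simp add: mult.assoc)
    moreover have "N (x z) = 0 \<or> N (x z) > 0" using N_nonneg[OF app_mem] by linarith
    ultimately show "N (x z) \<le> K * N z"
      using z_mem K_nonneg by (auto dest: mult_right_le_imp_le)
  qed
qed

lemma A_subset_if_closedin:
  assumes S_closed: "closedin (norm_topology A opnorm) S" and L_S: "\<And>h. h \<in> H \<Longrightarrow> L h \<in> S"
  shows "A \<subseteq> S"
proof
  fix x assume x_mem: "x \<in> A"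
  then have "x \<in> norm_topology Ops opnorm closure_of (L ` H)" by (simp add: A_def)
  then obtain y where y_approx: "\<And>n. y n \<in> L ` H" "limitin (norm_topology Ops opnorm) y x sequentially"
    by (rule P.ops.closure_of_sequentially[OF L_image_subset]) blast
  have image: "y n \<in> A" "y n \<in> S" for n using y_approx(1)[of n] L_mem_A L_S by auto
  then have lim: "limitin (norm_topology A opnorm) y x sequentially"
    using y_approx(2) x_mem image(1) by (simp add: A.limitin_norm_iff P.ops.limitin_norm_iff)
  show "x \<in> S" by (rule A.closedin_limit[OF S_closed lim image(2)]) simp
qed

lemma closed_subalgebra_eq_A:
  assumes closed_subalgebra: "subalgebra_of B A (\<circ>)" "closedin (norm_topology A opnorm) B"
    and generator_mem: "L (p 0) \<in> B"
  shows "B = A"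
proof
  have B_subset: "B \<subseteq> A" and sub: "csubspace B" and comp: "\<And>x y. x \<in> B \<Longrightarrow> y \<in> B \<Longrightarrow> x \<circ> y \<in> B"
    using closed_subalgebra(1) by (auto simp: subalgebra_of_def)
  show "B \<subseteq> A" by (rule B_subset)
  have L_p: "L (p n) \<in> B" for n
  proof (induction n)
    case (Suc n)
    then show ?case using comp[OF generator_mem Suc] by (simp add: L_p_comp_L_p)
  qed (rule generator_mem)
  have "{h \<in> H. L h \<in> B} = H"
  proof (rule p_dense)
    show "csubspace {h \<in> H. L h \<in> B}"
      using L_scale[of 0 0] complex_vector.subspace_0[OF sub]
      by (intro complex_vector.subspaceI) (auto simp: L_add L_scale
          intro: complex_vector.subspace_add[OF sub] complex_vector.subspace_scale[OF sub])
    show "closedin (norm_topology H N) {h \<in> H. L h \<in> B}"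
      unfolding closedin_sequentially
    proof (intro conjI allI impI)
      fix x l assume "range x \<subseteq> {h \<in> H. L h \<in> B} \<and> limitin (norm_topology H N) x l sequentially"
      then have x_mem: "x n \<in> H" "L (x n) \<in> B"
        and lim: "limitin (norm_topology H N) x l sequentially" for n
        by auto
      have l_mem: "l \<in> H" using lim by (rule limitin_norm_mem)
      have "limitin (norm_topology A opnorm) (\<lambda>n. L (x n)) (L l) sequentially"
        using limitin_L[OF lim] x_mem(1) l_mem
        by (simp add: A.limitin_norm_iff P.ops.limitin_norm_iff L_mem_A)
      then have "L l \<in> B" by (rule A.closedin_limit[OF closed_subalgebra(2)]) (simp_all add: x_mem(2))
      then show "l \<in> {h \<in> H. L h \<in> B}" using l_mem by simp
    qed auto
    show "range p \<subseteq> {h \<in> H. L h \<in> B}" using p_mem L_p by auto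
  qed
  then show "A \<subseteq> B" by (intro A_subset_if_closedin[OF closed_subalgebra(2)]) auto
qed

lemma topologically_singly_generated_A: "topologically_singly_generated A opnorm (\<circ>)"
proof -
  have "subalgebra_of A A (\<circ>)"
    by (simp add: subalgebra_of_def csubspace_A A_comp_mem)
  moreover have "closedin (norm_topology A opnorm) A"
    using closedin_topspace[of "norm_topology A opnorm"] by simp
  ultimately have "closed_subalgebra_generated A opnorm (\<circ>) {L (p 0)} = A"
    unfolding closed_subalgebra_generated_def
    using closed_subalgebra_eq_A L_mem_A[OF p_mem] by blast
  then show ?thesis
    unfolding topologically_singly_generated_def using L_mem_A[OF p_mem] by blast
qed

subsection \<open>Quasinilpotence\<close>

lemma L_p_0_power: "(((\<circ>) (L (p 0))) ^^ Suc n) z = L (p n) \<circ> z"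
proof (induction n)
  case (Suc n)
  have "(((\<circ>) (L (p 0))) ^^ Suc (Suc n)) z = L (p 0) \<circ> (((\<circ>) (L (p 0))) ^^ Suc n) z"
    by (subst funpow.simps(2)) (rule o_apply)
  also have "\<dots> = (L (p 0) \<circ> L (p n)) \<circ> z" unfolding Suc by (rule o_assoc)
  also have "L (p 0) \<circ> L (p n) = L (p (Suc n))" using L_p_comp_L_p[of 0 n] by simp
  finally show ?case .
qed simp

lemma L_p_0_quasinilpotent: "L (p 0) \<in> A.quasinilpotents"
proof -
  have "A.power_decay d (L (p 0))" if d_pos: "d > 0" for d
  proof -
    obtain K where p_le: "\<And>n. N (p n) \<le> K * d ^ n" using p_small[OF d_pos] by blast
    define K' where "K' = max 1 (\<bar>C\<bar> * K / d)"
    show ?thesis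
    proof (rule A.power_decayI)
      show "0 \<le> K'" by (simp add: K'_def)
      fix n z assume z_mem: "z \<in> A"
      show "opnorm ((((\<circ>) (L (p 0))) ^^ n) z) \<le> K' * d ^ n * opnorm z"
      proof (cases n)
        case 0
        then show ?thesis using mult_right_mono[of 1 K' "opnorm z"] z_mem by (simp add: K'_def)
      next
        case (Suc m)
        have "opnorm ((((\<circ>) (L (p 0))) ^^ n) z) \<le> opnorm (L (p m)) * opnorm z"
          unfolding Suc L_p_0_power by (intro op_norm_comp_le L_mem p_mem A_mem_Ops z_mem)
        also have "\<dots> \<le> \<bar>C\<bar> * (K * d ^ m) * opnorm z"
        proof (intro mult_right_mono order_trans[OF op_norm_L_le])
          show "C * N (p m) \<le> \<bar>C\<bar> * (K * d ^ m)"
            using p_le p_mem by (intro mult_mono) auto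
        qed (use z_mem p_mem in auto)
        also have "\<dots> = \<bar>C\<bar> * K / d * d ^ n * opnorm z" using d_pos by (simp add: Suc)
        also have "\<dots> \<le> K' * d ^ n * opnorm z"
          using d_pos z_mem by (intro mult_right_mono) (auto simp: K'_def)
        finally show ?thesis .
      qed
    qed
  qed
  then show ?thesis by (simp add: A.quasinilpotents_def L_mem_A p_mem)
qed

lemma quasinilpotents_eq_A: "A.quasinilpotents = A"
proof (rule closed_subalgebra_eq_A[OF _ A.closedin_quasinilpotents L_p_0_quasinilpotent])
  show "subalgebra_of A.quasinilpotents A (\<circ>)"
    unfolding subalgebra_of_def
    using A.quasinilpotents_subset A.csubspace_quasinilpotents A.quasinilpotents_mult by blast
qed

lemma radical_algebra_A: "radical_algebra A (\<circ>)"
  by (rule A.radical_algebraI[OF banach_space_A]) (simp add: quasinilpotents_eq_A)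

subsection \<open>Weak compactness\<close>

text \<open>
  Multiplication by \<open>L h\<close> is weakly compact because it factors through the Hilbert space as
  \<open>x \<mapsto> x h \<mapsto> L (x h)\<close>.
\<close>

lemma dual_represented_on_H:
  assumes "\<phi> \<in> dual A opnorm"
  shows "\<exists>q\<in>H. \<forall>y\<in>H. \<phi> (L y) = ip y q"
proof (rule riesz_representation[OF _ _ _ banach])
  fix y assume y_mem: "y \<in> H"
  have "cmod (\<phi> (L y)) \<le> dual_norm A opnorm \<phi> * opnorm (L y)"
    by (rule A.D.op_norm_bound[OF assms L_mem_A[OF y_mem]])
  also have "\<dots> \<le> dual_norm A opnorm \<phi> * (C * N y)"
    by (intro mult_left_mono op_norm_L_le y_mem A.D.op_norm_nonneg[OF assms])
  finally show "cmod (\<phi> (L y)) \<le> (dual_norm A opnorm \<phi> * C) * N y" by (simp add: mult_ac)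
qed (simp_all add: L_add L_scale A.D.op_add[OF assms] A.dual_scale[OF assms] L_mem_A)

lemma bidual_represented_on_H:
  assumes mu_mem: "\<mu> \<in> bidual A opnorm" and h_mem: "h \<in> H"
  shows "\<exists>k\<in>H. \<forall>y\<in>H. cnj (\<mu> (vector_functional h y)) = ip y k"
proof (rule riesz_representation[OF _ _ _ banach])
  note mem = vector_functional_mem[OF h_mem]
  show "cnj (\<mu> (vector_functional h (y + z))) =
      cnj (\<mu> (vector_functional h y)) + cnj (\<mu> (vector_functional h z))" if "y \<in> H" "z \<in> H" for y z
  proof -
    have "vector_functional h (y + z) = vector_functional h y + vector_functional h z"
      using that h_mem by (auto simp: vector_functional_def fun_eq_iff ip_add_right A_app_mem)
    then show ?thesis using that by (simp add: A.E.op_add[OF mu_mem] mem)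
  qed
  show "cnj (\<mu> (vector_functional h (c *\<^sub>C y))) = c * cnj (\<mu> (vector_functional h y))"
    if "y \<in> H" for c y
  proof -
    have "vector_functional h (c *\<^sub>C y) = cnj c *\<^sub>C vector_functional h y"
      using that h_mem by (auto simp: vector_functional_def fun_eq_iff ip_scale_right A_app_mem
          scaleC_fun_def scaleC_complex_def)
    then show ?thesis using that by (simp add: A.E.op_scale[OF mu_mem] mem scaleC_complex_def)
  qed
  fix y assume y_mem: "y \<in> H"
  have "cmod (\<mu> (vector_functional h y)) \<le> A.bidual_norm \<mu> * dual_norm A opnorm (vector_functional h y)"
    by (rule A.E.op_norm_bound[OF mu_mem mem[OF y_mem]])
  also have "\<dots> \<le> A.bidual_norm \<mu> * (N h * N y)"
    by (intro mult_left_mono dual_norm_vector_functional_le h_mem y_mem A.E.op_norm_nonneg[OF mu_mem])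
  finally show "cmod (cnj (\<mu> (vector_functional h y))) \<le> (A.bidual_norm \<mu> * N h) * N y"
    by (simp add: mult_ac)
qed

lemma L_weakly_compact_element:
  assumes h_mem: "h \<in> H"
  shows "L h \<in> A.weakly_compact_elements"
proof -
  have "\<exists>c\<in>A. \<forall>\<phi>\<in>dual A opnorm. A.bidual_act \<mu> \<phi> (L h) = \<phi> c" if mu_mem: "\<mu> \<in> bidual A opnorm" for \<mu>
  proof -
    obtain k where k_represents: "k \<in> H" "\<And>y. y \<in> H \<Longrightarrow> cnj (\<mu> (vector_functional h y)) = ip y k"
      using bidual_represented_on_H[OF mu_mem h_mem] by blast
    have "A.bidual_act \<mu> \<phi> (L h) = \<phi> (L k)" if phi: "\<phi> \<in> dual A opnorm" for \<phi>
    proof -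
      obtain q where q_represents: "q \<in> H" "\<And>y. y \<in> H \<Longrightarrow> \<phi> (L y) = ip y q"
        using dual_represented_on_H[OF phi] by blast
      have "A.dual_act \<phi> (L h) = vector_functional h q"
        by (rule ext)
          (simp add: A.dual_act_def vector_functional_def L_comp_A h_mem q_represents(2) A_app_mem)
      then have "A.bidual_act \<mu> \<phi> (L h) = cnj (ip q k)"
        using k_represents(2)[OF q_represents(1)] L_mem_A[OF h_mem]
        by (metis A.bidual_act_def complex_cnj_cnj)
      then show ?thesis
        using ip_commute[OF q_represents(1) k_represents(1)] q_represents(2)[OF k_represents(1)] by simp
    qed
    then show ?thesis using L_mem_A[OF k_represents(1)] by blast
  qed
  then show ?thesis by (simp add: A.weakly_compact_elements_def L_mem_A h_mem)
qed

lemma A_weakly_compact_elements: "A \<subseteq> A.weakly_compact_elements"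
  by (rule A_subset_if_closedin[OF A.closedin_weakly_compact_elements[OF banach_space_A]
        L_weakly_compact_element])

lemma ideal_in_bidual_A: "ideal_in_bidual A opnorm (\<circ>)"
  by (rule A.ideal_in_bidualI[OF A_weakly_compact_elements])

lemma weakly_compact_algebra_A: "weakly_compact_algebra A opnorm (\<circ>)"
  by (rule A.weakly_compact_algebraI[OF A_weakly_compact_elements])

subsection \<open>Approximate identities and reflexivity\<close>

context
  fixes e :: "nat \<Rightarrow> 'a"
  assumes e_mem: "\<And>n. e n \<in> H" and op_norm_L_e_le: "\<And>n. opnorm (L (e n)) \<le> 1"
    and e_p_0: "limitin (norm_topology H N) (\<lambda>n. L (e n) (p 0)) (p 0) sequentially"
begin

lemma approximated_eq_A: "A.approximated (\<lambda>n. L (e n)) sequentially = A"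
proof (rule closed_subalgebra_eq_A)
  have L_e: "L (e n) \<in> A" for n by (rule L_mem_A[OF e_mem])
  note e = L_e op_norm_L_e_le
  show "subalgebra_of (A.approximated (\<lambda>n. L (e n)) sequentially) A (\<circ>)"
    unfolding subalgebra_of_def
    by (intro conjI ballI A.approximated_subset A.csubspace_approximated[OF e]
        A.approximated_mult[OF e])
      (use A.approximated_subset in blast)+
  show "closedin (norm_topology A opnorm) (A.approximated (\<lambda>n. L (e n)) sequentially)"
    by (rule A.closedin_approximated[OF e])
  have "limitin (norm_topology Ops opnorm) (\<lambda>n. L (e n) \<circ> L (p 0)) (L (p 0)) sequentially"
    using limitin_L[OF e_p_0] by (simp add: L_assoc e_mem p_mem)
  then show "L (p 0) \<in> A.approximated (\<lambda>n. L (e n)) sequentially"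
    by (simp add: A.approximated_def A.limitin_norm_iff P.ops.limitin_norm_iff
        L_mem_A p_mem e_mem A_comp_mem)
qed

lemma approximately_unital_A: "approximately_unital A opnorm (\<circ>)"
  by (rule A.approximately_unitalI[OF L_mem_A[OF e_mem] op_norm_L_e_le approximated_eq_A]) simp

lemma not_reflexive_A:
  assumes "p 0 \<noteq> 0"
  shows "\<not> reflexive_space A opnorm"
proof
  assume "reflexive_space A opnorm"
  then have "\<exists>u\<in>A. \<forall>x\<in>A. u \<circ> x = x"
  proof (rule A.reflexive_imp_unit[OF _ sequentially_bot L_mem_A[OF e_mem] op_norm_L_e_le])
    show "limitin (norm_topology A opnorm) (\<lambda>n. L (e n) \<circ> x) x sequentially" if "x \<in> A" for x
      using approximated_eq_A that
      by (auto simp: A.approximated_def)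
  qed
  then have "x = 0" if "x \<in> A" for x
    using A.quasinilpotent_fixes_only_zero quasinilpotents_eq_A that by blast
  then have "L (e n) = 0" for n using L_mem_A[OF e_mem] by blast
  then have "limitin (norm_topology H N) (\<lambda>n. 0) (p 0) sequentially" using e_p_0 by simp
  moreover have "limitin (norm_topology H N) (\<lambda>n. 0) 0 sequentially" by simp
  ultimately show False
    using limitin_norm_unique[OF _ _ sequentially_bot] assms by blast
qed

end

lemma not_compact_algebra_A:
  assumes g_bounds: "\<And>n. g n \<in> H" "\<And>n. opnorm (L (g n)) \<le> 1" "d > 0"
    and sep: "\<And>m n :: nat. m < n \<Longrightarrow> d \<le> N (L (p 2) (g m) - L (p 2) (g n))"
  shows "\<not> compact_algebra A opnorm (\<circ>)"
proof -
  define T where "T x = (L (p 0) \<circ> x) \<circ> L (p 0)" for x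
  have T_mem: "T x \<in> A" if "x \<in> A" for x
    unfolding T_def using that L_mem_A[OF p_mem] A_comp_mem by simp
  have T_app: "T (L (g n)) (p 0) = L (p 2) (g n)" for n
  proof -
    have "T (L (g n)) (p 0) = L (p 0) (L (g n) (p 1))" by (simp add: T_def L_p_p)
    also have "\<dots> = (L (p 0) \<circ> L (p 1)) (g n)" by (simp add: L_commute[OF g_bounds(1) p_mem])
    also have "\<dots> = L (p 2) (g n)" unfolding L_p_comp_L_p by (simp add: numeral_2_eq_2)
    finally show ?thesis .
  qed
  have T_sep: "d \<le> opnorm (T (L (g m)) - T (L (g n))) * N (p 0)" if "m < n" for m n
  proof -
    have "T (L (g m)) \<in> Ops" "T (L (g n)) \<in> Ops"
      by (intro A_mem_Ops T_mem L_mem_A g_bounds(1))+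
    from P.op_diff_bound[OF this p_mem[of 0]] sep[OF that] show ?thesis
      unfolding T_app by linarith
  qed
  have pos: "N (p 0) > 0"
    using T_sep[of 0 1] g_bounds(3) N_nonneg[OF p_mem[of 0]] by (cases "N (p 0) = 0") auto
  have "\<not> compactin (norm_topology A opnorm)
      (norm_topology A opnorm closure_of (T ` {x \<in> A. opnorm x \<le> 1}))"
  proof (rule A.not_compactin_separated[where d = "d / N (p 0)"])
    show "T ` {x \<in> A. opnorm x \<le> 1} \<subseteq> A" using T_mem by auto
    show "T (L (g n)) \<in> T ` {x \<in> A. opnorm x \<le> 1}" for n using g_bounds L_mem_A by blast
    show "0 < d / N (p 0)" using g_bounds pos by simp
    show "d / N (p 0) \<le> opnorm (T (L (g m)) - T (L (g n)))" if "m < n" for m n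
      using T_sep[OF that] pos by (simp add: divide_le_eq)
  qed
  then show ?thesis
    unfolding compact_algebra_def compact_map_on_def T_def using L_mem_A[OF p_mem] by blast
qed

end

section \<open>Square integrals\<close>

definition nn_L2 :: "'a measure \<Rightarrow> ('a \<Rightarrow> 'b::real_normed_vector) \<Rightarrow> ennreal"
  where "nn_L2 M F = (\<integral>\<^sup>+ x. (ennreal (norm (F x)))\<^sup>2 \<partial>M)"

lemma nn_L2_mono_AE: "(AE x in M. norm (F x) \<le> norm (G x)) \<Longrightarrow> nn_L2 M F \<le> nn_L2 M G"
  unfolding nn_L2_def
  by (rule nn_integral_mono_AE) (auto elim!: eventually_mono intro!: power_mono ennreal_leI)

lemma nn_L2_zero [simp]: "nn_L2 M (\<lambda>x. 0) = 0"
  by (simp add: nn_L2_def)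

lemma nn_L2_scale:
  fixes F :: "'a \<Rightarrow> 'b::{real_normed_field, second_countable_topology}"
  assumes [measurable]: "F \<in> borel_measurable M"
  shows "nn_L2 M (\<lambda>x. c * F x) = ennreal ((norm c)\<^sup>2) * nn_L2 M F"
  by (simp add: nn_L2_def norm_mult ennreal_mult power_mult_distrib nn_integral_cmult ennreal_power)

lemma ennreal_square_add_le: "(x + y)\<^sup>2 \<le> 2 * x\<^sup>2 + 2 * y\<^sup>2" for x y :: ennreal
proof (cases x; cases y)
  fix a b :: real assume "x = ennreal a" "y = ennreal b" and nonneg: "0 \<le> a" "0 \<le> b"
  moreover have "(a + b)\<^sup>2 \<le> 2 * a\<^sup>2 + 2 * b\<^sup>2"
    using sum_squares_ge_zero[of "a - b" 0] by (simp add: power2_eq_square algebra_simps)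
  moreover have "(ennreal a + ennreal b)\<^sup>2 = ennreal ((a + b)\<^sup>2)"
    using nonneg by (simp add: ennreal_power flip: ennreal_plus)
  moreover have "2 * (ennreal a)\<^sup>2 + 2 * (ennreal b)\<^sup>2 = ennreal (2 * a\<^sup>2 + 2 * b\<^sup>2)"
    using nonneg by (simp add: ennreal_power ennreal_mult)
  ultimately show ?thesis by (metis ennreal_leI)
qed (auto simp: ennreal_mult_eq_top_iff top_power_ennreal)

lemma nn_integral_power2_add_le:
  fixes f g :: "'a \<Rightarrow> ennreal"
  assumes [measurable]: "f \<in> borel_measurable M" "g \<in> borel_measurable M"
  shows "(\<integral>\<^sup>+ x. (f x + g x)\<^sup>2 \<partial>M) \<le> 2 * (\<integral>\<^sup>+ x. (f x)\<^sup>2 \<partial>M) + 2 * (\<integral>\<^sup>+ x. (g x)\<^sup>2 \<partial>M)"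
proof -
  have "(\<integral>\<^sup>+ x. (f x + g x)\<^sup>2 \<partial>M) \<le> (\<integral>\<^sup>+ x. 2 * (f x)\<^sup>2 + 2 * (g x)\<^sup>2 \<partial>M)"
    by (intro nn_integral_mono ennreal_square_add_le)
  then show ?thesis by (simp add: nn_integral_add nn_integral_cmult)
qed

lemma nn_L2_add_le:
  fixes F G :: "'a \<Rightarrow> 'b::{real_normed_vector, second_countable_topology}"
  assumes [measurable]: "F \<in> borel_measurable M" "G \<in> borel_measurable M"
  shows "nn_L2 M (\<lambda>x. F x + G x) \<le> 2 * nn_L2 M F + 2 * nn_L2 M G"
proof -
  have "ennreal (norm (F x + G x)) \<le> ennreal (norm (F x)) + ennreal (norm (G x))" for x
    by (simp add: norm_triangle_ineq ennreal_leI flip: ennreal_plus)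
  then have "nn_L2 M (\<lambda>x. F x + G x) \<le> (\<integral>\<^sup>+ x. (ennreal (norm (F x)) + ennreal (norm (G x)))\<^sup>2 \<partial>M)"
    unfolding nn_L2_def by (intro nn_integral_mono power_mono) auto
  also have "\<dots> \<le> 2 * nn_L2 M F + 2 * nn_L2 M G"
    unfolding nn_L2_def by (rule nn_integral_power2_add_le) measurable
  finally show ?thesis .
qed

lemma AE_norm_limit_le:
  fixes F :: "nat \<Rightarrow> 'a \<Rightarrow> 'b::real_normed_vector"
  assumes "\<And>n. AE x in M. norm (F n x) \<le> b x" "AE x in M. (\<lambda>n. F n x) \<longlonglongrightarrow> L x"
  shows "AE x in M. norm (L x) \<le> b x"
proof -
  have "AE x in M. \<forall>n. norm (F n x) \<le> b x"
    unfolding AE_all_countable using assms(1) by blast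
  then show ?thesis
    using assms(2)
  proof eventually_elim
    case (elim x)
    then show ?case by (intro LIMSEQ_le_const2[OF tendsto_norm]) auto
  qed
qed

lemma nn_L2_dominated_convergence:
  fixes F :: "nat \<Rightarrow> 'a \<Rightarrow> 'b::{real_normed_vector, second_countable_topology}"
  assumes [measurable]: "\<And>n. F n \<in> borel_measurable M" "L \<in> borel_measurable M"
      "(G :: 'a \<Rightarrow> 'c::{real_normed_vector, second_countable_topology}) \<in> borel_measurable M"
    and G_finite: "nn_L2 M G < \<infinity>" and bound: "\<And>n. AE x in M. norm (F n x) \<le> norm (G x)"
    and lim: "AE x in M. (\<lambda>n. F n x) \<longlonglongrightarrow> L x"
  shows "(\<lambda>n. nn_L2 M (\<lambda>x. F n x - L x)) \<longlonglongrightarrow> 0"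
proof -
  have "(\<lambda>n. nn_L2 M (\<lambda>x. F n x - L x)) \<longlonglongrightarrow> (\<integral>\<^sup>+ x. 0 \<partial>M)"
    unfolding nn_L2_def
  proof (rule nn_integral_dominated_convergence[where w = "\<lambda>x. 4 * (ennreal (norm (G x)))\<^sup>2"])
    show "(\<integral>\<^sup>+ x. 4 * (ennreal (norm (G x)))\<^sup>2 \<partial>M) < \<infinity>"
      using G_finite unfolding nn_L2_def by (simp add: nn_integral_cmult ennreal_mult_less_top)
    show "AE x in M. (ennreal (norm (F n x - L x)))\<^sup>2 \<le> 4 * (ennreal (norm (G x)))\<^sup>2" for n
      using bound[of n] AE_norm_limit_le[OF bound lim]
    proof eventually_elim
      case (elim x)
      then have "norm (F n x - L x) \<le> 2 * norm (G x)"
        using norm_triangle_ineq4[of "F n x" "L x"] by linarith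
      then have "(ennreal (norm (F n x - L x)))\<^sup>2 \<le> (ennreal (2 * norm (G x)))\<^sup>2"
        by (intro power_mono ennreal_leI) auto
      then show ?case by (simp add: ennreal_mult power_mult_distrib)
    qed
    show "AE x in M. (\<lambda>n. (ennreal (norm (F n x - L x)))\<^sup>2) \<longlonglongrightarrow> 0"
      using lim
    proof eventually_elim
      case (elim x)
      then have "(\<lambda>n. (norm (F n x - L x))\<^sup>2) \<longlonglongrightarrow> 0\<^sup>2"
        by (intro tendsto_power tendsto_norm_zero) (simp add: LIM_zero_iff)
      from tendsto_ennrealI[OF this] show ?case by (simp add: ennreal_power)
    qed
  qed measurable
  then show ?thesis by simp
qed

lemma nn_L2_AE_limit_le:
  fixes F :: "nat \<Rightarrow> 'a \<Rightarrow> 'b::{real_normed_vector, second_countable_topology}"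
  assumes [measurable]: "\<And>n. F n \<in> borel_measurable M"
    and lim: "AE x in M. (\<lambda>n. F n x) \<longlonglongrightarrow> G x"
    and bound: "\<forall>\<^sub>F n in sequentially. nn_L2 M (F n) \<le> c"
  shows "nn_L2 M G \<le> c"
proof -
  have "AE x in M. (ennreal (norm (G x)))\<^sup>2 = liminf (\<lambda>n. (ennreal (norm (F n x)))\<^sup>2)"
    using lim
  proof eventually_elim
    case (elim x)
    then have "(\<lambda>n. (norm (F n x))\<^sup>2) \<longlonglongrightarrow> (norm (G x))\<^sup>2" by (intro tendsto_intros)
    from tendsto_ennrealI[OF this]
    have "(\<lambda>n. (ennreal (norm (F n x)))\<^sup>2) \<longlonglongrightarrow> (ennreal (norm (G x)))\<^sup>2"
      by (simp add: ennreal_power)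
    then show ?case using lim_imp_Liminf[OF sequentially_bot] by metis
  qed
  then have "nn_L2 M G = (\<integral>\<^sup>+ x. liminf (\<lambda>n. (ennreal (norm (F n x)))\<^sup>2) \<partial>M)"
    unfolding nn_L2_def by (rule nn_integral_cong_AE)
  also have "\<dots> \<le> liminf (\<lambda>n. nn_L2 M (F n))"
    unfolding nn_L2_def by (rule nn_integral_liminf) measurable
  also have "\<dots> \<le> limsup (\<lambda>n. nn_L2 M (F n))" by (rule Liminf_le_Limsup) simp
  also have "\<dots> \<le> c" by (rule Limsup_bounded[OF bound])
  finally show ?thesis .
qed

lemma AE_summable_power2_if_L2_geometric:
  fixes D :: "nat \<Rightarrow> 'a \<Rightarrow> 'b::{banach, second_countable_topology}"
  assumes [measurable]: "\<And>k. D k \<in> borel_measurable M"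
    and small: "\<And>k. nn_L2 M (D k) \<le> ennreal ((1 / 4) ^ k)"
  shows "AE x in M. summable (\<lambda>k. 2 ^ k * (norm (D k x))\<^sup>2)"
proof -
  have "(\<integral>\<^sup>+ x. ennreal (2 ^ k * (norm (D k x))\<^sup>2) \<partial>M) \<le> ennreal ((1 / 2) ^ k)" for k
  proof -
    have "(\<integral>\<^sup>+ x. ennreal (2 ^ k * (norm (D k x))\<^sup>2) \<partial>M) = ennreal (2 ^ k) * nn_L2 M (D k)"
      by (simp add: nn_L2_def nn_integral_cmult ennreal_mult ennreal_power)
    also have "\<dots> \<le> ennreal (2 ^ k) * ennreal ((1 / 4) ^ k)" by (intro mult_left_mono small) simp
    also have "\<dots> = ennreal ((1 / 2) ^ k)" by (simp flip: ennreal_mult power_mult_distrib)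
    finally show ?thesis .
  qed
  then have "(\<Sum>k. \<integral>\<^sup>+ x. ennreal (2 ^ k * (norm (D k x))\<^sup>2) \<partial>M) \<le> (\<Sum>k. ennreal ((1 / 2) ^ k))"
    by (intro suminf_le) auto
  also have "\<dots> = ennreal (\<Sum>k. (1 / 2) ^ k)"
    by (rule suminf_ennreal2) (auto simp: summable_geometric)
  finally have "(\<integral>\<^sup>+ x. (\<Sum>k. ennreal (2 ^ k * (norm (D k x))\<^sup>2)) \<partial>M) \<noteq> \<infinity>"
    by (subst nn_integral_suminf) (auto simp: top_unique)
  then have "AE x in M. (\<Sum>k. ennreal (2 ^ k * (norm (D k x))\<^sup>2)) \<noteq> \<infinity>"
    by (intro nn_integral_noteq_infinite) measurable
  then show ?thesis
    by eventually_elim (rule summable_suminf_not_top; simp)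
qed

text \<open>
  By the inequality \<open>d \<le> 2\<^sup>-\<^sup>k + 2\<^sup>k d\<^sup>2\<close>, pointwise summability of the increments \<open>d\<close> follows from
  that of \<open>2\<^sup>k d\<^sup>2\<close>, whose integrals are controlled.
\<close>

lemma AE_convergent_if_L2_increments_geometric:
  fixes F :: "nat \<Rightarrow> 'a \<Rightarrow> 'b::{banach, second_countable_topology}"
  assumes [measurable]: "\<And>k. F k \<in> borel_measurable M"
    and small: "\<And>k. nn_L2 M (\<lambda>x. F (Suc k) x - F k x) \<le> ennreal ((1 / 4) ^ k)"
  shows "AE x in M. convergent (\<lambda>k. F k x)"
proof -
  have "AE x in M. summable (\<lambda>k. 2 ^ k * (norm (F (Suc k) x - F k x))\<^sup>2)"
    by (rule AE_summable_power2_if_L2_geometric[OF _ small]) measurable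
  then show ?thesis
  proof eventually_elim
    case (elim x)
    let ?d = "\<lambda>k. norm (F (Suc k) x - F k x)"
    have "summable (\<lambda>k. (1 / 2) ^ k + 2 ^ k * (?d k)\<^sup>2)"
      using elim by (intro summable_add summable_geometric) auto
    moreover have "?d k \<le> (1 / 2) ^ k + 2 ^ k * (?d k)\<^sup>2" for k
    proof (cases "?d k \<le> (1 / 2) ^ k")
      case False
      then have "1 \<le> 2 ^ k * ?d k" by (simp add: field_simps)
      then have "1 * ?d k \<le> (2 ^ k * ?d k) * ?d k" by (intro mult_right_mono) auto
      then show ?thesis by (simp add: power2_eq_square mult.assoc add_increasing)
    qed (simp add: add_increasing2)
    ultimately have "summable (\<lambda>k. F (Suc k) x - F k x)"
      by (rule summable_comparison_test'[of _ 0])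
    then have "convergent (\<lambda>n. F n x - F 0 x)"
      unfolding summable_iff_convergent sum_lessThan_telescope[of "\<lambda>k. F k x"] .
    from convergent_add[OF this convergent_const[of "F 0 x"]] show ?case by simp
  qed
qed

theorem Riesz_Fischer_L2:
  fixes F :: "nat \<Rightarrow> 'a \<Rightarrow> 'b::{banach, second_countable_topology}"
  assumes [measurable]: "\<And>n. F n \<in> borel_measurable M"
    and Cauchy: "\<And>e::real. e > 0 \<Longrightarrow> \<exists>k. \<forall>m\<ge>k. \<forall>n\<ge>k. nn_L2 M (\<lambda>x. F m x - F n x) \<le> ennreal e"
  obtains G where "G \<in> borel_measurable M"
    "\<And>e::real. e > 0 \<Longrightarrow> \<exists>k. \<forall>n\<ge>k. nn_L2 M (\<lambda>x. F n x - G x) \<le> ennreal e"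
proof -
  have "\<forall>k. \<exists>j. \<forall>m\<ge>j. \<forall>n\<ge>j. nn_L2 M (\<lambda>x. F m x - F n x) \<le> ennreal ((1 / 4) ^ k)"
    using Cauchy by simp
  then obtain j where increments_small:
    "\<And>k m n. m \<ge> j k \<Longrightarrow> n \<ge> j k \<Longrightarrow> nn_L2 M (\<lambda>x. F m x - F n x) \<le> ennreal ((1 / 4) ^ k)"
    by metis
  define r where "r k = (\<Sum>i\<le>k. j i) + k" for k
  have r_ge: "r k \<ge> j k" "r k \<ge> k" "r (Suc k) \<ge> j k" for k
    using member_le_sum[of k "{..k}" j] by (auto simp: r_def)
  define G where "G x = lim (\<lambda>k. F (r k) x)" for x
  have G_mem: "G \<in> borel_measurable M"
    unfolding G_def[abs_def] by (rule borel_measurable_lim_metric) measurable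
  have "AE x in M. convergent (\<lambda>k. F (r k) x)"
    by (rule AE_convergent_if_L2_increments_geometric)
      (use increments_small[OF r_ge(3) r_ge(1)] in auto)
  then have lim: "AE x in M. (\<lambda>k. F (r k) x) \<longlonglongrightarrow> G x"
    by eventually_elim (simp add: G_def convergent_LIMSEQ_iff)
  have "\<exists>k. \<forall>n\<ge>k. nn_L2 M (\<lambda>x. F n x - G x) \<le> ennreal e" if "e > 0" for e
  proof -
    obtain k where tail_le: "\<And>m n. m \<ge> k \<Longrightarrow> n \<ge> k \<Longrightarrow> nn_L2 M (\<lambda>x. F m x - F n x) \<le> ennreal e"
      using Cauchy[OF \<open>e > 0\<close>] by blast
    have "nn_L2 M (\<lambda>x. F n x - G x) \<le> ennreal e" if n_ge: "n \<ge> k" for n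
    proof (rule nn_L2_AE_limit_le[where F = "\<lambda>i x. F n x - F (r i) x"])
      show "AE x in M. (\<lambda>i. F n x - F (r i) x) \<longlonglongrightarrow> F n x - G x"
        using lim by eventually_elim (intro tendsto_intros)
      show "\<forall>\<^sub>F i in sequentially. nn_L2 M (\<lambda>x. F n x - F (r i) x) \<le> ennreal e"
        using tail_le[OF n_ge] r_ge(2) by (intro eventually_sequentiallyI[of k]) (meson order_trans)
    qed measurable
    then show ?thesis by blast
  qed
  with G_mem show ?thesis by (rule that)
qed

section \<open>Convolutions on the line\<close>

definition nn_conv :: "(real \<Rightarrow> ennreal) \<Rightarrow> (real \<Rightarrow> ennreal) \<Rightarrow> real \<Rightarrow> ennreal"
  where "nn_conv f g t = (\<integral>\<^sup>+ s. f (t - s) * g s \<partial>lborel)"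

lemma nn_conv_measurable [measurable]:
  assumes [measurable]: "f \<in> borel_measurable borel" "g \<in> borel_measurable borel"
  shows "nn_conv f g \<in> borel_measurable borel"
  unfolding nn_conv_def[abs_def] by measurable

lemma nn_integral_reflect:
  fixes f :: "real \<Rightarrow> ennreal"
  assumes [measurable]: "f \<in> borel_measurable borel"
  shows "(\<integral>\<^sup>+ s. f (t - s) \<partial>lborel) = (\<integral>\<^sup>+ s. f s \<partial>lborel)"
  using nn_integral_real_affine[OF assms, of "- 1" t] by simp

lemma nn_integral_shift:
  fixes f :: "real \<Rightarrow> ennreal"
  assumes [measurable]: "f \<in> borel_measurable borel"
  shows "(\<integral>\<^sup>+ t. f (t - s) \<partial>lborel) = (\<integral>\<^sup>+ s. f s \<partial>lborel)"
  using nn_integral_real_affine[OF assms, of 1 "- s"] by (simp add: add.commute)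

lemma nn_conv_commute:
  assumes [measurable]: "f \<in> borel_measurable borel" "g \<in> borel_measurable borel"
  shows "nn_conv f g t = nn_conv g f t"
  using nn_integral_reflect[of "\<lambda>s. f (t - s) * g s" t] by (simp add: nn_conv_def mult.commute)

text \<open>Cauchy--Schwarz with respect to the measure with density \<open>f (t - s)\<close>.\<close>

lemma nn_conv_power2_le:
  assumes [measurable]: "f \<in> borel_measurable borel" "g \<in> borel_measurable borel"
  shows "(nn_conv f g t)\<^sup>2 \<le> (\<integral>\<^sup>+ s. f s \<partial>lborel) * nn_conv f (\<lambda>s. (g s)\<^sup>2) t"
proof -
  have "(\<integral>\<^sup>+ s. 1 * g s \<partial>density lborel (\<lambda>s. f (t - s)))\<^sup>2 \<le>
      (\<integral>\<^sup>+ s. 1\<^sup>2 \<partial>density lborel (\<lambda>s. f (t - s))) * (\<integral>\<^sup>+ s. (g s)\<^sup>2 \<partial>density lborel (\<lambda>s. f (t - s)))"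
    by (rule Cauchy_Schwarz_nn_integral) measurable
  then show ?thesis
    by (simp add: nn_conv_def nn_integral_density emeasure_density nn_integral_reflect)
qed

lemma nn_integral_nn_conv:
  assumes [measurable]: "f \<in> borel_measurable borel" "g \<in> borel_measurable borel"
  shows "(\<integral>\<^sup>+ t. nn_conv f g t \<partial>lborel) = (\<integral>\<^sup>+ s. f s \<partial>lborel) * (\<integral>\<^sup>+ s. g s \<partial>lborel)"
proof -
  have "(\<integral>\<^sup>+ t. nn_conv f g t \<partial>lborel) = (\<integral>\<^sup>+ s. (\<integral>\<^sup>+ t. f (t - s) * g s \<partial>lborel) \<partial>lborel)"
    unfolding nn_conv_def by (rule lborel_pair.Fubini') measurable
  also have "\<dots> = (\<integral>\<^sup>+ s. (\<integral>\<^sup>+ t. f t \<partial>lborel) * g s \<partial>lborel)"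
    by (intro nn_integral_cong) (simp add: nn_integral_multc nn_integral_shift)
  also have "\<dots> = (\<integral>\<^sup>+ s. f s \<partial>lborel) * (\<integral>\<^sup>+ s. g s \<partial>lborel)"
    by (rule nn_integral_cmult) measurable
  finally show ?thesis .
qed

lemma Young_L1_L2:
  assumes [measurable]: "f \<in> borel_measurable borel" "g \<in> borel_measurable borel"
  shows "(\<integral>\<^sup>+ t. (nn_conv f g t)\<^sup>2 \<partial>lborel) \<le> (\<integral>\<^sup>+ s. f s \<partial>lborel)\<^sup>2 * (\<integral>\<^sup>+ s. (g s)\<^sup>2 \<partial>lborel)"
proof -
  have "(\<integral>\<^sup>+ t. (nn_conv f g t)\<^sup>2 \<partial>lborel) \<le>
      (\<integral>\<^sup>+ t. (\<integral>\<^sup>+ s. f s \<partial>lborel) * nn_conv f (\<lambda>s. (g s)\<^sup>2) t \<partial>lborel)"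
    by (intro nn_integral_mono nn_conv_power2_le) measurable
  also have "\<dots> = (\<integral>\<^sup>+ s. f s \<partial>lborel) * (\<integral>\<^sup>+ t. nn_conv f (\<lambda>s. (g s)\<^sup>2) t \<partial>lborel)"
    by (rule nn_integral_cmult) measurable
  also have "(\<integral>\<^sup>+ t. nn_conv f (\<lambda>s. (g s)\<^sup>2) t \<partial>lborel) =
      (\<integral>\<^sup>+ s. f s \<partial>lborel) * (\<integral>\<^sup>+ s. (g s)\<^sup>2 \<partial>lborel)"
    by (rule nn_integral_nn_conv) measurable
  finally show ?thesis by (simp add: power2_eq_square mult.assoc)
qed

lemma ennreal_norm_integral_le:
  fixes F :: "'b \<Rightarrow> 'a :: {banach, second_countable_topology}"
  shows "ennreal (norm (integral\<^sup>L M F)) \<le> (\<integral>\<^sup>+ x. ennreal (norm (F x)) \<partial>M)"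
proof (cases "integrable M F")
  case True then show ?thesis by (rule integral_norm_bound_ennreal)
qed (simp add: not_integrable_integral_eq)

definition conv :: "(real \<Rightarrow> complex) \<Rightarrow> (real \<Rightarrow> complex) \<Rightarrow> real \<Rightarrow> complex"
  where "conv F G t = (LINT s|lborel. F (t - s) * G s)"

lemma conv_measurable [measurable]:
  assumes [measurable]: "F \<in> borel_measurable borel" "G \<in> borel_measurable borel"
  shows "conv F G \<in> borel_measurable borel"
  unfolding conv_def[abs_def] by measurable

lemma conv_commute: "conv F G t = conv G F t"
  using lborel_integral_real_affine[of "- 1" "\<lambda>s. F (t - s) * G s" t]
  by (simp add: conv_def mult.commute)

lemma conv_integrable_commute:
  "integrable lborel (\<lambda>s. F (t - s) * G s) \<longleftrightarrow> integrable lborel (\<lambda>s. G (t - s) * F s)"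
  for F G :: "real \<Rightarrow> complex"
  using lborel_integrable_real_affine_iff[of "- 1" "\<lambda>s. F (t - s) * G s" t] by (simp add: mult.commute)

definition abs_conv :: "(real \<Rightarrow> complex) \<Rightarrow> (real \<Rightarrow> complex) \<Rightarrow> real \<Rightarrow> ennreal"
  where "abs_conv F G = nn_conv (\<lambda>s. ennreal (cmod (F s))) (\<lambda>s. ennreal (cmod (G s)))"

lemma abs_conv_measurable [measurable]:
  assumes [measurable]: "F \<in> borel_measurable borel" "G \<in> borel_measurable borel"
  shows "abs_conv F G \<in> borel_measurable borel"
  unfolding abs_conv_def by measurable

lemma norm_conv_le_abs_conv: "ennreal (cmod (conv F G t)) \<le> abs_conv F G t"
  unfolding conv_def abs_conv_def nn_conv_def
  using ennreal_norm_integral_le[of lborel "\<lambda>s. F (t - s) * G s"] by (simp add: norm_mult ennreal_mult)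

lemma conv_integrable_if_abs_conv_finite:
  assumes [measurable]: "F \<in> borel_measurable borel" "G \<in> borel_measurable borel"
    and "abs_conv F G t < \<infinity>"
  shows "integrable lborel (\<lambda>s. F (t - s) * G s)"
  using assms(3) unfolding abs_conv_def nn_conv_def
  by (intro integrableI_bounded) (simp_all add: norm_mult ennreal_mult)

section \<open>Classes of functions on the half-line\<close>

lemma ae_eq_refl: "F \<in> borel_measurable borel \<Longrightarrow> ae_eq F F"
  unfolding ae_eq_def half_line_def by (auto intro: measurable_restrict_space1)

lemma abs_mfun_eq_iff:
  assumes "F \<in> borel_measurable borel" "G \<in> borel_measurable borel"
  shows "abs_mfun F = abs_mfun G \<longleftrightarrow> (AE t in lborel. 0 \<le> t \<longrightarrow> F t = G t)"
proof -
  have "ae_eq F F" "ae_eq G G" using assms by (simp_all add: ae_eq_refl)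
  then have "abs_mfun F = abs_mfun G \<longleftrightarrow> ae_eq F G"
    using Quotient_rel_abs2[OF Quotient_mfun] Quotient_rel[OF Quotient_mfun, of F G] by blast
  then show ?thesis using \<open>ae_eq F F\<close> \<open>ae_eq G G\<close> by (simp add: ae_eq_def AE_half_line_iff)
qed

lemma abs_mfun_zero: "abs_mfun (\<lambda>_. 0) = 0"
  by (simp add: zero_mfun.abs_eq)

lemma abs_mfun_add:
  "F \<in> borel_measurable borel \<Longrightarrow> G \<in> borel_measurable borel \<Longrightarrow>
    abs_mfun F + abs_mfun G = abs_mfun (\<lambda>t. F t + G t)"
  by (rule plus_mfun.abs_eq) (auto intro: ae_eq_refl)

lemma abs_mfun_diff:
  "F \<in> borel_measurable borel \<Longrightarrow> G \<in> borel_measurable borel \<Longrightarrow>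
    abs_mfun F - abs_mfun G = abs_mfun (\<lambda>t. F t - G t)"
  by (rule minus_mfun.abs_eq) (auto intro: ae_eq_refl)

lemma abs_mfun_scale:
  "F \<in> borel_measurable borel \<Longrightarrow> c *\<^sub>C abs_mfun F = abs_mfun (\<lambda>t. c * F t)"
  by (rule scaleC_mfun.abs_eq) (auto intro: ae_eq_refl)

lemma abs_mfun_linear_combination:
  assumes "finite I" "\<And>i. i \<in> I \<Longrightarrow> F i \<in> borel_measurable borel"
  shows "abs_mfun (\<lambda>t. \<Sum>i\<in>I. c i * F i t) = (\<Sum>i\<in>I. c i *\<^sub>C abs_mfun (F i))"
  using assms by (induction I) (simp_all add: abs_mfun_zero abs_mfun_scale flip: abs_mfun_add)

definition repr :: "mfun \<Rightarrow> real \<Rightarrow> complex"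
  where "repr f t = indicator {0..} t *\<^sub>R rep_mfun f t"

lemma repr_measurable [measurable]: "repr f \<in> borel_measurable borel"
  using Quotient_rep_reflp[OF Quotient_mfun, of f]
  unfolding ae_eq_def measurable_half_line_iff by (simp add: repr_def[abs_def])

lemma repr_neg: "t < 0 \<Longrightarrow> repr f t = 0"
  by (simp add: repr_def)

lemma abs_mfun_repr [simp]: "abs_mfun (repr f) = f"
proof -
  have rep: "ae_eq (rep_mfun f) (rep_mfun f)"
    using Quotient_rep_reflp[OF Quotient_mfun] .
  have "ae_eq (repr f) (rep_mfun f)"
    using rep ae_eq_refl[OF repr_measurable] by (auto simp: ae_eq_def AE_half_line_iff repr_def)
  then have "abs_mfun (repr f) = abs_mfun (rep_mfun f)"
    using Quotient_rel_abs[OF Quotient_mfun] by blast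
  then show ?thesis using Quotient_abs_rep[OF Quotient_mfun] by simp
qed

lemma AE_repr_abs_mfun:
  "F \<in> borel_measurable borel \<Longrightarrow> AE t in lborel. 0 \<le> t \<longrightarrow> repr (abs_mfun F) t = F t"
  using abs_mfun_eq_iff[OF repr_measurable, of F "abs_mfun F"] by simp

lemma AE_repr_abs_mfun_if_neg:
  assumes "F \<in> borel_measurable borel" "\<And>t. t < 0 \<Longrightarrow> F t = 0"
  shows "AE t in lborel. repr (abs_mfun F) t = F t"
  using AE_repr_abs_mfun[OF assms(1)]
proof eventually_elim
  case (elim t)
  then show ?case using assms(2)[of t] repr_neg[of t] by (cases "t < 0") auto
qed

lemma repr_add: "AE t in lborel. repr (f + g) t = repr f t + repr g t"
  using AE_repr_abs_mfun_if_neg[of "\<lambda>t. repr f t + repr g t"] abs_mfun_add[of "repr f" "repr g"]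
  by (simp add: repr_neg)

lemma repr_diff: "AE t in lborel. repr (f - g) t = repr f t - repr g t"
  using AE_repr_abs_mfun_if_neg[of "\<lambda>t. repr f t - repr g t"] abs_mfun_diff[of "repr f" "repr g"]
  by (simp add: repr_neg)

lemma repr_scale: "AE t in lborel. repr (c *\<^sub>C f) t = c * repr f t"
  using AE_repr_abs_mfun_if_neg[of "\<lambda>t. c * repr f t"] abs_mfun_scale[of "repr f" c]
  by (simp add: repr_neg)

lemma conv_eq_set_integral:
  assumes "\<And>t. t < 0 \<Longrightarrow> F t = 0" "\<And>t. t < 0 \<Longrightarrow> G t = 0"
  shows "conv F G t = (LINT s:{0..t}|lborel. F (t - s) * G s)"
  unfolding conv_def set_lebesgue_integral_def
  by (intro Bochner_Integration.integral_cong) (auto simp: indicator_def assms)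

lemma convolution_abs_mfun:
  assumes "F \<in> borel_measurable borel" "G \<in> borel_measurable borel"
    "\<And>t. t < 0 \<Longrightarrow> F t = 0" "\<And>t. t < 0 \<Longrightarrow> G t = 0"
  shows "convolution (abs_mfun F) (abs_mfun G) = abs_mfun (conv F G)"
proof -
  have "conv F G = (\<lambda>t. LINT s:{0..t}|lborel. F (t - s) * G s)"
    by (rule ext) (rule conv_eq_set_integral[OF assms(3,4)])
  then show ?thesis using convolution.abs_eq[OF ae_eq_refl ae_eq_refl, OF assms(1,2)] by simp
qed

lemma convolution_eq_conv: "convolution f g = abs_mfun (conv (repr f) (repr g))"
  using convolution_abs_mfun[of "repr f" "repr g"] by (simp add: repr_neg)

lemma convolution_commute: "convolution f g = convolution g f"
proof -
  have "conv (repr f) (repr g) = conv (repr g) (repr f)" by (rule ext) (rule conv_commute)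
  then show ?thesis by (simp add: convolution_eq_conv)
qed

definition convolvable :: "mfun \<Rightarrow> mfun \<Rightarrow> bool"
  where "convolvable f g \<longleftrightarrow> (AE t in lborel. integrable lborel (\<lambda>s. repr f (t - s) * repr g s))"

lemma convolvable_commute: "convolvable f g \<longleftrightarrow> convolvable g f"
  unfolding convolvable_def by (simp add: conv_integrable_commute[of "repr f"])

lemma convolution_add_left:
  assumes "convolvable f h" "convolvable g h"
  shows "convolution (f + g) h = convolution f h + convolution g h"
proof -
  have "convolution (f + g) h = convolution (abs_mfun (\<lambda>t. repr f t + repr g t)) (abs_mfun (repr h))"
    using abs_mfun_add[of "repr f" "repr g"] by simp
  also have "\<dots> = abs_mfun (conv (\<lambda>t. repr f t + repr g t) (repr h))"
    by (rule convolution_abs_mfun) (simp_all add: repr_neg)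
  also have "\<dots> = abs_mfun (\<lambda>t. conv (repr f) (repr h) t + conv (repr g) (repr h) t)"
  proof (subst abs_mfun_eq_iff)
    show "AE t in lborel. 0 \<le> t \<longrightarrow>
        conv (\<lambda>t. repr f t + repr g t) (repr h) t = conv (repr f) (repr h) t + conv (repr g) (repr h) t"
      using assms[unfolded convolvable_def]
      by eventually_elim (simp add: conv_def distrib_right)
  qed measurable
  finally show ?thesis by (simp add: convolution_eq_conv abs_mfun_add)
qed

lemma convolution_scale_left: "convolution (c *\<^sub>C f) h = c *\<^sub>C convolution f h"
proof -
  have "convolution (c *\<^sub>C f) h = convolution (abs_mfun (\<lambda>t. c * repr f t)) (abs_mfun (repr h))"
    using abs_mfun_scale[of "repr f"] by simp
  also have "\<dots> = abs_mfun (conv (\<lambda>t. c * repr f t) (repr h))"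
    by (rule convolution_abs_mfun) (simp_all add: repr_neg)
  also have "conv (\<lambda>t. c * repr f t) (repr h) = (\<lambda>t. c * conv (repr f) (repr h) t)"
    by (simp add: conv_def mult.assoc fun_eq_iff)
  finally show ?thesis by (simp add: convolution_eq_conv abs_mfun_scale)
qed

lemma convolution_add_right:
  "convolvable h f \<Longrightarrow> convolvable h g \<Longrightarrow> convolution h (f + g) = convolution h f + convolution h g"
  using convolution_add_left[of f h g]
  by (simp add: convolution_commute[of h] convolvable_commute[of h])

lemma convolution_scale_right: "convolution h (c *\<^sub>C f) = c *\<^sub>C convolution h f"
  using convolution_scale_left[of c f h] by (simp add: convolution_commute[of h])

section \<open>Weighted spaces\<close>

locale half_line_weight =
  fixes \<omega> :: "real \<Rightarrow> real"
  assumes weight_measurable: "\<omega> \<in> borel_measurable half_line"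
    and weight_pos: "0 \<le> t \<Longrightarrow> 0 < \<omega> t"
begin

definition w :: "real \<Rightarrow> real" where "w t = (if t < 0 then 0 else \<omega> t)"

lemma w_measurable [measurable]: "w \<in> borel_measurable borel"
proof -
  have "(\<lambda>t. indicator {0..} t *\<^sub>R \<omega> t) \<in> borel_measurable lborel"
    using weight_measurable unfolding half_line_def
    by (subst (asm) borel_measurable_restrict_space_iff) auto
  moreover have "w = (\<lambda>t. indicator {0..} t *\<^sub>R \<omega> t)"
    by (auto simp: w_def indicator_def)
  ultimately show ?thesis by simp
qed

lemma w_eq: "0 \<le> t \<Longrightarrow> w t = \<omega> t"
  by (simp add: w_def)

lemma w_neg: "t < 0 \<Longrightarrow> w t = 0"
  by (simp add: w_def)

lemma w_pos: "0 \<le> t \<Longrightarrow> 0 < w t"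
  by (simp add: w_def weight_pos)

lemma w_nonneg [simp]: "0 \<le> w t"
  using w_pos[of t] w_neg[of t] by (cases "t < 0") auto

definition norm1 :: "(real \<Rightarrow> complex) \<Rightarrow> ennreal"
  where "norm1 F = (\<integral>\<^sup>+ t. ennreal (w t * cmod (F t)) \<partial>lborel)"

definition norm2_sq :: "(real \<Rightarrow> complex) \<Rightarrow> ennreal"
  where "norm2_sq F = nn_L2 lborel (\<lambda>t. w t *\<^sub>R F t)"

lemma
  assumes "F \<in> borel_measurable borel"
  shows mfun_Lp_integral_1: "mfun_Lp_integral \<omega> 1 (abs_mfun F) = norm1 F"
    and mfun_Lp_integral_2: "mfun_Lp_integral \<omega> 2 (abs_mfun F) = norm2_sq F"
proof -
  have integral: "mfun_Lp_integral \<omega> p (abs_mfun F) =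
      (\<integral>\<^sup>+ t. ennreal (cmod (F t) powr p * \<omega> t powr p) * indicator {0..} t \<partial>lborel)" for p
    using mfun_Lp_integral.abs_eq[OF ae_eq_refl[OF assms], of \<omega> p]
    unfolding half_line_def by (simp add: nn_integral_restrict_space)
  have nonneg: "0 \<le> \<omega> t" if "0 \<le> t" for t using weight_pos[OF that] by simp
  show "mfun_Lp_integral \<omega> 1 (abs_mfun F) = norm1 F"
    unfolding integral norm1_def
    by (intro nn_integral_cong) (auto simp: indicator_def w_def mult.commute nonneg)
  show "mfun_Lp_integral \<omega> 2 (abs_mfun F) = norm2_sq F"
    unfolding integral norm2_sq_def nn_L2_def
    by (intro nn_integral_cong)
      (auto simp: indicator_def w_def nonneg ennreal_power power_mult_distrib mult.commute)
qed

lemma norm2_sq_mono_AE: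
  assumes "AE t in lborel. 0 \<le> t \<longrightarrow> cmod (F t) \<le> cmod (G t)"
  shows "norm2_sq F \<le> norm2_sq G"
  unfolding norm2_sq_def
proof (rule nn_L2_mono_AE)
  show "AE t in lborel. norm (w t *\<^sub>R F t) \<le> norm (w t *\<^sub>R G t)"
    using assms
  proof eventually_elim
    case (elim t)
    then show ?case by (cases "t < 0") (auto simp: w_neg mult_left_mono)
  qed
qed

lemma norm2_sq_mono: "(\<And>t. 0 \<le> t \<Longrightarrow> cmod (F t) \<le> cmod (G t)) \<Longrightarrow> norm2_sq F \<le> norm2_sq G"
  by (rule norm2_sq_mono_AE) simp

lemma norm2_sq_cong_AE:
  assumes "AE t in lborel. 0 \<le> t \<longrightarrow> F t = G t"
  shows "norm2_sq F = norm2_sq G"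
proof (rule antisym)
  show "norm2_sq F \<le> norm2_sq G" "norm2_sq G \<le> norm2_sq F"
    by (rule norm2_sq_mono_AE, use assms in eventually_elim, simp)+
qed

lemma norm2_sq_ge:
  assumes [measurable]: "E \<in> sets borel" and "0 \<le> c" and bound: "\<And>t. t \<in> E \<Longrightarrow> c \<le> w t * cmod (F t)"
  shows "ennreal (c\<^sup>2) * emeasure lborel E \<le> norm2_sq F"
proof -
  have "ennreal (c\<^sup>2) * emeasure lborel E = (\<integral>\<^sup>+ t. ennreal (c\<^sup>2) * indicator E t \<partial>lborel)"
    by (simp add: nn_integral_cmult_indicator)
  also have "\<dots> \<le> norm2_sq F"
    unfolding norm2_sq_def nn_L2_def
  proof (rule nn_integral_mono)
    fix t
    have "(ennreal c)\<^sup>2 \<le> (ennreal (w t * cmod (F t)))\<^sup>2" if "t \<in> E"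
      using bound[OF that] by (intro power_mono ennreal_leI) auto
    then show "ennreal (c\<^sup>2) * indicator E t \<le> (ennreal (norm (w t *\<^sub>R F t)))\<^sup>2"
      using assms(2) by (auto simp: indicator_def ennreal_power)
  qed
  finally show ?thesis .
qed

lemma norm2_sq_repr_abs_mfun: "F \<in> borel_measurable borel \<Longrightarrow> norm2_sq (repr (abs_mfun F)) = norm2_sq F"
  by (rule norm2_sq_cong_AE[OF AE_repr_abs_mfun])

lemma norm1_repr_abs_mfun: "F \<in> borel_measurable borel \<Longrightarrow> norm1 (repr (abs_mfun F)) = norm1 F"
  using mfun_Lp_integral_1[of F] mfun_Lp_integral_1[OF repr_measurable, of "abs_mfun F"] by simp

lemma norm2_sq_add_le:
  assumes [measurable]: "F \<in> borel_measurable borel" "G \<in> borel_measurable borel"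
  shows "norm2_sq (\<lambda>t. F t + G t) \<le> 2 * norm2_sq F + 2 * norm2_sq G"
  using nn_L2_add_le[of "\<lambda>t. w t *\<^sub>R F t" lborel "\<lambda>t. w t *\<^sub>R G t"]
  by (simp add: norm2_sq_def scaleR_add_right)

lemma norm2_sq_scale:
  assumes [measurable]: "F \<in> borel_measurable borel"
  shows "norm2_sq (\<lambda>t. c * F t) = ennreal ((cmod c)\<^sup>2) * norm2_sq F"
  using nn_L2_scale[of "\<lambda>t. w t *\<^sub>R F t" lborel c] by (simp add: norm2_sq_def)

lemma norm2_sq_repr_diff: "norm2_sq (repr (f - g)) = norm2_sq (\<lambda>t. repr f t - repr g t)"
  by (rule norm2_sq_cong_AE) (use repr_diff[of f g] in \<open>auto elim: eventually_mono\<close>)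

abbreviation H :: "mfun set" where "H \<equiv> Lp_space \<omega> 2"
abbreviation N :: "mfun \<Rightarrow> real" where "N \<equiv> Lp_norm \<omega> 2"

lemma abs_mfun_mem_H_iff: "F \<in> borel_measurable borel \<Longrightarrow> abs_mfun F \<in> H \<longleftrightarrow> norm2_sq F < \<infinity>"
  by (simp add: Lp_space_def mfun_Lp_integral_2)

lemma abs_mfun_mem_L1_iff: "F \<in> borel_measurable borel \<Longrightarrow> abs_mfun F \<in> Lp_space \<omega> 1 \<longleftrightarrow> norm1 F < \<infinity>"
  by (simp add: Lp_space_def mfun_Lp_integral_1)

lemma N_abs_mfun: "F \<in> borel_measurable borel \<Longrightarrow> N (abs_mfun F) = sqrt (enn2real (norm2_sq F))"
  by (simp add: Lp_norm_def mfun_Lp_integral_2 powr_half_sqrt)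

lemma norm2_sq_finite: "f \<in> H \<Longrightarrow> norm2_sq (repr f) < \<infinity>"
  using abs_mfun_mem_H_iff[OF repr_measurable] by simp

lemma norm2_sq_repr: "f \<in> H \<Longrightarrow> norm2_sq (repr f) = ennreal ((N f)\<^sup>2)"
  using N_abs_mfun[OF repr_measurable, of f] norm2_sq_finite[of f] by simp

lemma norm2_sq_eq:
  "F \<in> borel_measurable borel \<Longrightarrow> abs_mfun F \<in> H \<Longrightarrow> norm2_sq F = ennreal ((N (abs_mfun F))\<^sup>2)"
  using norm2_sq_repr[of "abs_mfun F"] by (simp add: norm2_sq_repr_abs_mfun)

lemma
  assumes "F \<in> borel_measurable borel" "norm2_sq F \<le> ennreal (c\<^sup>2)" "0 \<le> c"
  shows abs_mfun_mem_HI: "abs_mfun F \<in> H" and N_abs_mfun_le: "N (abs_mfun F) \<le> c"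
proof -
  show "abs_mfun F \<in> H"
    using le_less_trans[OF assms(2)] by (simp add: abs_mfun_mem_H_iff[OF assms(1)])
  have "enn2real (norm2_sq F) \<le> c\<^sup>2" using assms(2) by (intro enn2real_leI) auto
  then have "N (abs_mfun F) \<le> sqrt (c\<^sup>2)"
    unfolding N_abs_mfun[OF assms(1)] by (rule real_sqrt_le_mono)
  then show "N (abs_mfun F) \<le> c" using assms(3) by simp
qed

lemma csubspace_L2: "csubspace H"
proof (rule complex_vector.subspaceI)
  show "0 \<in> H" using abs_mfun_mem_H_iff[of "\<lambda>_. 0"] by (simp add: abs_mfun_zero norm2_sq_def)
next
  fix f g assume mem: "f \<in> H" "g \<in> H"
  have "norm2_sq (\<lambda>t. repr f t + repr g t) \<le> 2 * norm2_sq (repr f) + 2 * norm2_sq (repr g)"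
    by (rule norm2_sq_add_le) measurable
  also have "\<dots> < \<infinity>"
    using norm2_sq_finite[OF mem(1)] norm2_sq_finite[OF mem(2)] by (simp add: ennreal_mult_less_top)
  finally have "abs_mfun (\<lambda>t. repr f t + repr g t) \<in> H" by (simp add: abs_mfun_mem_H_iff)
  then show "f + g \<in> H" using abs_mfun_add[of "repr f" "repr g"] by simp
next
  fix c f assume f_mem: "f \<in> H"
  have "abs_mfun (\<lambda>t. c * repr f t) \<in> H"
    using norm2_sq_finite[OF f_mem]
    by (simp add: abs_mfun_mem_H_iff norm2_sq_scale ennreal_mult_less_top)
  then show "c *\<^sub>C f \<in> H" using abs_mfun_scale[of "repr f"] by simp
qed

subsection \<open>The Hilbert space structure\<close>

definition ip :: "mfun \<Rightarrow> mfun \<Rightarrow> complex"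
  where "ip f g = (LINT t|lborel. (w t)\<^sup>2 *\<^sub>R (repr f t * cnj (repr g t)))"

lemma borel_measurable_cnj [measurable]: "cnj \<in> borel_measurable borel"
  by (intro borel_measurable_continuous_onI continuous_intros)

lemma integrable_power2:
  assumes "f \<in> H"
  shows "integrable lborel (\<lambda>t. (w t * cmod (repr f t))\<^sup>2)"
proof (rule integrableI_nonneg)
  show "(\<integral>\<^sup>+ t. ennreal ((w t * cmod (repr f t))\<^sup>2) \<partial>lborel) < \<infinity>"
    using norm2_sq_finite[OF assms] by (simp add: norm2_sq_def nn_L2_def ennreal_power)
qed auto

lemma integrable_ip:
  assumes "f \<in> H" "g \<in> H"
  shows "integrable lborel (\<lambda>t. (w t)\<^sup>2 *\<^sub>R (repr f t * cnj (repr g t)))"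
proof (rule Bochner_Integration.integrable_bound)
  show "integrable lborel (\<lambda>t. (w t * cmod (repr f t))\<^sup>2 + (w t * cmod (repr g t))\<^sup>2)"
    by (intro Bochner_Integration.integrable_add integrable_power2 assms)
  have "norm ((w t)\<^sup>2 *\<^sub>R (repr f t * cnj (repr g t))) \<le>
      norm ((w t * cmod (repr f t))\<^sup>2 + (w t * cmod (repr g t))\<^sup>2)" for t
  proof -
    let ?a = "w t * cmod (repr f t)" and ?b = "w t * cmod (repr g t)"
    have nonneg: "0 \<le> ?a * ?b" by simp
    have "norm ((w t)\<^sup>2 *\<^sub>R (repr f t * cnj (repr g t))) = ?a * ?b"
      by (simp add: norm_mult power2_eq_square)
    also have "\<dots> \<le> ?a\<^sup>2 + ?b\<^sup>2"
      using sum_squares_bound[of ?a ?b] nonneg by linarith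
    finally show ?thesis by simp
  qed
  then show "AE t in lborel. norm ((w t)\<^sup>2 *\<^sub>R (repr f t * cnj (repr g t))) \<le>
      norm ((w t * cmod (repr f t))\<^sup>2 + (w t * cmod (repr g t))\<^sup>2)" by simp
qed measurable

lemma ip_self_eq:
  assumes "f \<in> H"
  shows "ip f f = complex_of_real ((N f)\<^sup>2)"
proof -
  have "ip f f = (LINT t|lborel. complex_of_real ((w t * cmod (repr f t))\<^sup>2))"
    unfolding ip_def by (intro Bochner_Integration.integral_cong)
      (simp_all add: power_mult_distrib complex_norm_square[symmetric] scaleR_conv_of_real)
  also have "\<dots> = complex_of_real (LINT t|lborel. (w t * cmod (repr f t))\<^sup>2)"
    by (rule integral_complex_of_real)
  also have "(LINT t|lborel. (w t * cmod (repr f t))\<^sup>2) = enn2real (norm2_sq (repr f))"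
    by (subst integral_eq_nn_integral) (auto simp: norm2_sq_def nn_L2_def ennreal_power)
  also have "\<dots> = (N f)\<^sup>2" using assms by (simp add: norm2_sq_repr)
  finally show ?thesis .
qed

lemma eq_0_if_N_eq_0:
  assumes "f \<in> H" "N f = 0"
  shows "f = 0"
proof -
  have "norm2_sq (repr f) = 0" using assms norm2_sq_repr by simp
  then have "AE t in lborel. (ennreal (norm (w t *\<^sub>R repr f t)))\<^sup>2 = 0"
    unfolding norm2_sq_def nn_L2_def by (subst (asm) nn_integral_0_iff_AE) auto
  then have "AE t in lborel. 0 \<le> t \<longrightarrow> repr f t = 0"
  proof eventually_elim
    case (elim t)
    then show ?case using w_pos[of t] by auto
  qed
  then have "abs_mfun (repr f) = abs_mfun (\<lambda>_. 0)"
    by (subst abs_mfun_eq_iff) auto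
  then show ?thesis by (simp add: abs_mfun_zero)
qed

lemma inner_product_on_L2: "inner_product_on H ip"
  unfolding inner_product_on_def
proof (intro conjI ballI allI)
  fix f g h assume f_mem: "f \<in> H" and g_mem: "g \<in> H" and h_mem: "h \<in> H"
  have "ip (f + g) h = (LINT t|lborel. (w t)\<^sup>2 *\<^sub>R (repr f t * cnj (repr h t)) +
      (w t)\<^sup>2 *\<^sub>R (repr g t * cnj (repr h t)))"
    unfolding ip_def
  proof (rule integral_cong_AE)
    show "AE t in lborel. (w t)\<^sup>2 *\<^sub>R (repr (f + g) t * cnj (repr h t)) =
        (w t)\<^sup>2 *\<^sub>R (repr f t * cnj (repr h t)) + (w t)\<^sup>2 *\<^sub>R (repr g t * cnj (repr h t))"
      using repr_add[of f g] by eventually_elim (simp add: algebra_simps)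
  qed measurable
  also have "\<dots> = ip f h + ip g h"
    unfolding ip_def
    by (intro Bochner_Integration.integral_add integrable_ip f_mem g_mem h_mem)
  finally show "ip (f + g) h = ip f h + ip g h" .
next
  fix c f g assume f_mem: "f \<in> H" and g_mem: "g \<in> H"
  have "ip (c *\<^sub>C f) g = (LINT t|lborel. c * ((w t)\<^sup>2 *\<^sub>R (repr f t * cnj (repr g t))))"
    unfolding ip_def
  proof (rule integral_cong_AE)
    show "AE t in lborel. (w t)\<^sup>2 *\<^sub>R (repr (c *\<^sub>C f) t * cnj (repr g t)) =
        c * ((w t)\<^sup>2 *\<^sub>R (repr f t * cnj (repr g t)))"
      using repr_scale[of c f] by eventually_elim (simp add: algebra_simps)
  qed measurable
  then show "ip (c *\<^sub>C f) g = c * ip f g" by (simp only: ip_def integral_mult_right_zero)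
next
  fix f g assume f_mem: "f \<in> H" and g_mem: "g \<in> H"
  show "ip g f = cnj (ip f g)"
    unfolding ip_def by (subst Bochner_Integration.integral_cnj[symmetric]) (simp add: mult.commute)
next
  fix f assume f_mem: "f \<in> H"
  show "0 \<le> Re (ip f f)" using ip_self_eq[OF f_mem] by simp
  have "N 0 = 0" using N_abs_mfun[of "\<lambda>_. 0"] by (simp add: abs_mfun_zero norm2_sq_def)
  then show "ip f f = 0 \<longleftrightarrow> f = 0" using ip_self_eq[OF f_mem] eq_0_if_N_eq_0[OF f_mem] by auto
qed

sublocale inner_product_space H N ip
proof
  show "N f = sqrt (Re (ip f f))" if "f \<in> H" for f
    using ip_self_eq[OF that] N_abs_mfun[OF repr_measurable, of f] by simp
qed (rule csubspace_L2 inner_product_on_L2)+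

lemma limitin_abs_mfunI:
  assumes x_mem: "\<And>n. x n \<in> H" and [measurable]: "G \<in> borel_measurable borel"
    and lim: "\<And>e::real. e > 0 \<Longrightarrow> \<exists>k. \<forall>n\<ge>k. norm2_sq (\<lambda>t. repr (x n) t - G t) \<le> ennreal e"
  shows "limitin (norm_topology H N) x (abs_mfun G) sequentially"
proof -
  have diff: "x n - abs_mfun G = abs_mfun (\<lambda>t. repr (x n) t - G t)" for n
    using abs_mfun_diff[of "repr (x n)" G] by simp
  have near: "\<exists>k. \<forall>n\<ge>k. x n - abs_mfun G \<in> H \<and> N (x n - abs_mfun G) \<le> e" if "e > 0" for e
  proof -
    have "e\<^sup>2 > 0" using that by simp
    then obtain k where "\<forall>n\<ge>k. norm2_sq (\<lambda>t. repr (x n) t - G t) \<le> ennreal (e\<^sup>2)"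
      using lim by blast
    then show ?thesis
      unfolding diff using that
      by (intro exI[of _ k] allI impI conjI abs_mfun_mem_HI[of _ e] N_abs_mfun_le) auto
  qed
  obtain n where "x n - abs_mfun G \<in> H" using near[of 1] by auto
  then have "x n - (x n - abs_mfun G) \<in> H" using x_mem diff_mem by blast
  then have G_mem: "abs_mfun G \<in> H" by simp
  have "(\<lambda>n. N (x n - abs_mfun G)) \<longlonglongrightarrow> 0"
  proof (rule LIMSEQ_I)
    fix e :: real assume "e > 0"
    then obtain k where eventually_near: "\<forall>n\<ge>k. x n - abs_mfun G \<in> H \<and> N (x n - abs_mfun G) \<le> e / 2"
      using near[of "e / 2"] by auto
    have "norm (N (x n - abs_mfun G) - 0) < e" if "n \<ge> k" for n
      using eventually_near that \<open>e > 0\<close> N_nonneg[OF diff_mem[OF x_mem G_mem], of n] by fastforce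
    then show "\<exists>k. \<forall>n\<ge>k. norm (N (x n - abs_mfun G) - 0) < e" by blast
  qed
  then show ?thesis using x_mem G_mem by (simp add: limitin_norm_iff)
qed

lemma banach_space_L2: "banach_space_on H N"
  unfolding banach_space_on_iff
proof (intro allI impI)
  fix x assume Cauchy: "M.MCauchy x"
  then have x_mem: "x n \<in> H" for n by (simp add: MCauchy_iff)
  define F where "F n t = w t *\<^sub>R repr (x n) t" for n t
  have F_mem: "F n \<in> borel_measurable lborel" for n unfolding F_def[abs_def] by measurable
  have F_diff: "nn_L2 lborel (\<lambda>t. F m t - F n t) = ennreal ((N (x m - x n))\<^sup>2)" for m n
    using norm2_sq_repr[OF diff_mem[OF x_mem x_mem], of m n]
    by (simp add: norm2_sq_repr_diff) (simp add: norm2_sq_def F_def scaleR_diff_right)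
  have "\<exists>k. \<forall>m\<ge>k. \<forall>n\<ge>k. nn_L2 lborel (\<lambda>t. F m t - F n t) \<le> ennreal e" if "e > 0" for e
  proof -
    have "sqrt e > 0" using that by simp
    then obtain k where N_diff_less: "\<forall>m\<ge>k. \<forall>n\<ge>k. N (x m - x n) < sqrt e"
      using Cauchy unfolding MCauchy_iff by blast
    have "(N (x m - x n))\<^sup>2 \<le> e" if "m \<ge> k" "n \<ge> k" for m n
    proof -
      have "(N (x m - x n))\<^sup>2 \<le> (sqrt e)\<^sup>2"
        using N_diff_less that x_mem by (intro power_mono) (auto intro: less_imp_le)
      then show ?thesis using \<open>e > 0\<close> by simp
    qed
    then show ?thesis unfolding F_diff by (intro exI[of _ k] allI impI ennreal_leI)
  qed
  from Riesz_Fischer_L2[of F lborel, OF F_mem this] obtain G where "G \<in> borel_measurable lborel"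
    and L2_convergent: "\<And>e::real. e > 0 \<Longrightarrow> \<exists>k. \<forall>n\<ge>k. nn_L2 lborel (\<lambda>t. F n t - G t) \<le> ennreal e"
    by blast
  then have [measurable]: "G \<in> borel_measurable borel" by simp
  have "norm2_sq (\<lambda>t. repr (x n) t - G t /\<^sub>R w t) \<le> nn_L2 lborel (\<lambda>t. F n t - G t)" for n
    unfolding norm2_sq_def
  proof (rule nn_L2_mono_AE, intro always_eventually allI)
    fix t show "norm (w t *\<^sub>R (repr (x n) t - G t /\<^sub>R w t)) \<le> norm (F n t - G t)"
      using w_pos[of t] by (cases "t < 0") (auto simp: w_neg F_def scaleR_diff_right)
  qed
  then have "\<exists>k. \<forall>n\<ge>k. norm2_sq (\<lambda>t. repr (x n) t - G t /\<^sub>R w t) \<le> ennreal e" if "e > 0" for e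
    using L2_convergent[OF that] by (meson order_trans)
  then have "limitin (norm_topology H N) x (abs_mfun (\<lambda>t. G t /\<^sub>R w t)) sequentially"
    by (intro limitin_abs_mfunI x_mem) measurable
  then show "\<exists>l. limitin (norm_topology H N) x l sequentially" by blast
qed

sublocale hilbert_space H N ip
  by unfold_locales (rule banach_space_L2)

lemma
  assumes [measurable]: "\<And>n. F n \<in> borel_measurable borel" "L \<in> borel_measurable borel"
    "G \<in> borel_measurable borel"
    and G_finite: "norm2_sq G < \<infinity>" and bound: "\<And>n. AE t in lborel. 0 \<le> t \<longrightarrow> cmod (F n t) \<le> cmod (G t)"
    and lim: "AE t in lborel. 0 \<le> t \<longrightarrow> (\<lambda>n. F n t) \<longlonglongrightarrow> L t"
  shows abs_mfun_mem_H_dominated: "abs_mfun (F n) \<in> H"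
    and limitin_abs_mfun_dominated:
      "limitin (norm_topology H N) (\<lambda>n. abs_mfun (F n)) (abs_mfun L) sequentially"
proof -
  show mem: "abs_mfun (F n) \<in> H" for n
    using le_less_trans[OF norm2_sq_mono_AE[OF bound] G_finite] by (simp add: abs_mfun_mem_H_iff)
  have "(\<lambda>n. nn_L2 lborel (\<lambda>t. w t *\<^sub>R F n t - w t *\<^sub>R L t)) \<longlonglongrightarrow> 0"
  proof (rule nn_L2_dominated_convergence[where G = "\<lambda>t. w t *\<^sub>R G t"])
    show "nn_L2 lborel (\<lambda>t. w t *\<^sub>R G t) < \<infinity>" using G_finite by (simp add: norm2_sq_def)
    show "AE t in lborel. norm (w t *\<^sub>R F n t) \<le> norm (w t *\<^sub>R G t)" for n
      using bound[of n]
    proof eventually_elim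
      case (elim t)
      then show ?case by (cases "t < 0") (auto simp: w_neg mult_left_mono)
    qed
    show "AE t in lborel. (\<lambda>n. w t *\<^sub>R F n t) \<longlonglongrightarrow> w t *\<^sub>R L t"
      using lim
    proof eventually_elim
      case (elim t)
      then show ?case by (cases "t < 0") (auto simp: w_neg intro: tendsto_intros)
    qed
  qed measurable
  then have lim_norm2_sq: "(\<lambda>n. norm2_sq (\<lambda>t. F n t - L t)) \<longlonglongrightarrow> 0"
    by (simp add: norm2_sq_def scaleR_diff_right)
  have "norm2_sq (\<lambda>t. repr (abs_mfun (F n)) t - L t) = norm2_sq (\<lambda>t. F n t - L t)" for n
    by (rule norm2_sq_cong_AE) (use AE_repr_abs_mfun[of "F n"] in \<open>auto elim: eventually_mono\<close>)
  moreover have "\<exists>k. \<forall>n\<ge>k. norm2_sq (\<lambda>t. F n t - L t) \<le> ennreal e" if "e > 0" for e :: real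
    using order_tendstoD(2)[OF lim_norm2_sq, of "ennreal e"] that
    by (auto simp: eventually_sequentially intro: less_imp_le)
  ultimately show "limitin (norm_topology H N) (\<lambda>n. abs_mfun (F n)) (abs_mfun L) sequentially"
    by (intro limitin_abs_mfunI mem) simp_all
qed

subsection \<open>Convolution operators\<close>

abbreviation L :: "mfun \<Rightarrow> mfun \<Rightarrow> mfun" where "L \<equiv> conv_op \<omega>"

definition norm2_sq_abs_conv :: "mfun \<Rightarrow> mfun \<Rightarrow> ennreal"
  where "norm2_sq_abs_conv f g =
    (\<integral>\<^sup>+ t. (ennreal (w t) * abs_conv (repr f) (repr g) t)\<^sup>2 \<partial>lborel)"

lemma convolvableI:
  assumes "norm2_sq_abs_conv f g < \<infinity>"
  shows "convolvable f g"
proof -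
  have "AE t in lborel. (ennreal (w t) * abs_conv (repr f) (repr g) t)\<^sup>2 \<noteq> \<infinity>"
    by (rule nn_integral_noteq_infinite) (use assms in \<open>auto simp: norm2_sq_abs_conv_def\<close>)
  then show ?thesis unfolding convolvable_def
  proof eventually_elim
    case (elim t)
    show ?case
    proof (cases "t < 0")
      case True
      then have "repr f (t - s) * repr g s = 0" for s
        by (cases "s < 0") (simp_all add: repr_neg)
      then show ?thesis by (simp only: integrable_zero)
    next
      case False
      then have "abs_conv (repr f) (repr g) t \<noteq> top"
        using elim w_pos[of t] by (auto simp: power2_eq_square ennreal_mult_top)
      then show ?thesis by (intro conv_integrable_if_abs_conv_finite) (simp_all add: less_top)
    qed
  qed
qed

lemma
  assumes "norm2_sq_abs_conv f g \<le> ennreal (c\<^sup>2)" "0 \<le> c"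
  shows convolvable_if_abs_conv_bound: "convolvable f g"
    and convolution_mem_H: "convolution f g \<in> H"
    and N_convolution_le: "N (convolution f g) \<le> c"
proof -
  show "convolvable f g" by (rule convolvableI) (use le_less_trans[OF assms(1)] in simp)
  have "norm2_sq (conv (repr f) (repr g)) \<le> norm2_sq_abs_conv f g"
    unfolding norm2_sq_def nn_L2_def norm2_sq_abs_conv_def
    by (intro nn_integral_mono power_mono)
      (simp_all add: ennreal_mult mult_left_mono norm_conv_le_abs_conv)
  then have bound: "norm2_sq (conv (repr f) (repr g)) \<le> ennreal (c\<^sup>2)" using assms(1)
    by (rule order_trans)
  show "convolution f g \<in> H" "N (convolution f g) \<le> c"
    unfolding convolution_eq_conv
    by (rule abs_mfun_mem_HI[OF _ bound assms(2)] N_abs_mfun_le[OF _ bound assms(2)]; measurable)+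
qed

lemma
  assumes "0 \<le> c" "\<And>g. g \<in> H \<Longrightarrow> norm2_sq_abs_conv f g \<le> ennreal ((c * N g)\<^sup>2)"
  shows conv_op_mem: "L f \<in> bounded_ops H N H N" and op_norm_conv_op_le: "op_norm H N N (L f) \<le> c"
proof -
  interpret HH: cnormed_pair H N H N ..
  have nonneg: "0 \<le> c * N g" if "g \<in> H" for g using assms(1) that by simp
  note convolvable = convolvable_if_abs_conv_bound[OF assms(2) nonneg]
  note bound = N_convolution_le[OF assms(2) nonneg]
  show "L f \<in> bounded_ops H N H N"
    by (rule HH.bounded_opsI[of _ c])
      (simp_all add: conv_op_def convolution_mem_H[OF assms(2) nonneg] bound convolution_add_right
        convolution_scale_right convolvable)
  show "op_norm H N N (L f) \<le> c"
    by (rule HH.op_norm_le[OF assms(1)]) (simp add: conv_op_def bound)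
qed

definition weighted :: "mfun \<Rightarrow> real \<Rightarrow> ennreal"
  where "weighted f t = ennreal (w t * cmod (repr f t))"

lemma weighted_measurable [measurable]: "weighted f \<in> borel_measurable borel"
  unfolding weighted_def[abs_def] by measurable

lemma nn_integral_weighted: "(\<integral>\<^sup>+ t. weighted f t \<partial>lborel) = norm1 (repr f)"
  by (simp add: weighted_def norm1_def)

lemma nn_integral_power2_weighted: "(\<integral>\<^sup>+ t. (weighted f t)\<^sup>2 \<partial>lborel) = norm2_sq (repr f)"
  by (simp add: weighted_def norm2_sq_def nn_L2_def)

lemma weighted_abs_conv_le:
  assumes [measurable]: "k \<in> borel_measurable borel"
    and integrand_le: "\<And>s. 0 \<le> s \<Longrightarrow> s \<le> t \<Longrightarrow>
      ennreal (w t) * (ennreal (cmod (repr f (t - s))) * ennreal (cmod (repr g s))) \<le> k s"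
  shows "ennreal (w t) * abs_conv (repr f) (repr g) t \<le> (\<integral>\<^sup>+ s. k s \<partial>lborel)"
proof -
  have "ennreal (w t) * abs_conv (repr f) (repr g) t =
      (\<integral>\<^sup>+ s. ennreal (w t) * (ennreal (cmod (repr f (t - s))) * ennreal (cmod (repr g s))) \<partial>lborel)"
    unfolding abs_conv_def nn_conv_def by (rule nn_integral_cmult[symmetric]) measurable
  also have "\<dots> \<le> (\<integral>\<^sup>+ s. k s \<partial>lborel)"
  proof (rule nn_integral_mono)
    fix s
    show "ennreal (w t) * (ennreal (cmod (repr f (t - s))) * ennreal (cmod (repr g s))) \<le> k s"
      using integrand_le[of s] repr_neg[of s g] repr_neg[of "t - s" f] by (cases "0 \<le> s \<and> s \<le> t") auto
  qed
  finally show ?thesis .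
qed

end

locale submultiplicative_weight = half_line_weight +
  assumes weight_mult: "0 \<le> r \<Longrightarrow> 0 \<le> s \<Longrightarrow> \<omega> (r + s) \<le> \<omega> r * \<omega> s"
begin

lemma weighted_abs_conv_le_nn_conv:
  "ennreal (w t) * abs_conv (repr f) (repr g) t \<le> nn_conv (weighted f) (weighted g) t"
  unfolding nn_conv_def
proof (rule weighted_abs_conv_le)
  fix s assume s_range: "0 \<le> s" "s \<le> t"
  then have "w t \<le> w (t - s) * w s" using weight_mult[of "t - s" s] by (simp add: w_eq)
  then have "w t * (cmod (repr f (t - s)) * cmod (repr g s)) \<le>
      w (t - s) * w s * (cmod (repr f (t - s)) * cmod (repr g s))"
    by (rule mult_right_mono) simp
  then show "ennreal (w t) * (ennreal (cmod (repr f (t - s))) * ennreal (cmod (repr g s))) \<le>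
      weighted f (t - s) * weighted g s"
    by (simp add: weighted_def ennreal_leI mult_ac flip: ennreal_mult)
qed measurable

lemma norm2_sq_abs_conv_le_L1:
  assumes "norm1 (repr f) \<le> ennreal c" "0 \<le> c" "g \<in> H"
  shows "norm2_sq_abs_conv f g \<le> ennreal ((c * N g)\<^sup>2)"
proof -
  have "norm2_sq_abs_conv f g \<le>
      (\<integral>\<^sup>+ t. (nn_conv (weighted f) (weighted g) t)\<^sup>2 \<partial>lborel)"
    unfolding norm2_sq_abs_conv_def
    by (intro nn_integral_mono power_mono weighted_abs_conv_le_nn_conv) simp
  also have "\<dots> \<le> (norm1 (repr f))\<^sup>2 * norm2_sq (repr g)"
    using Young_L1_L2[of "weighted f" "weighted g"]
    by (simp add: nn_integral_weighted nn_integral_power2_weighted)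
  also have "\<dots> \<le> (ennreal c)\<^sup>2 * norm2_sq (repr g)"
    using assms(1) by (intro mult_right_mono power_mono) auto
  also have "\<dots> = ennreal ((c * N g)\<^sup>2)"
    using assms(2,3) by (simp add: norm2_sq_repr ennreal_power power_mult_distrib flip: ennreal_mult)
  finally show ?thesis .
qed

lemma
  assumes "norm1 (repr f) \<le> ennreal c" "0 \<le> c"
  shows conv_op_mem_L1: "L f \<in> bounded_ops H N H N" and op_norm_conv_op_le_L1: "op_norm H N N (L f) \<le> c"
  using conv_op_mem[OF assms(2) norm2_sq_abs_conv_le_L1[OF assms]]
    op_norm_conv_op_le[OF assms(2) norm2_sq_abs_conv_le_L1[OF assms]] by blast+

lemma conv_op_add_L1:
  assumes "norm1 (repr f) < \<infinity>" "norm1 (repr g) < \<infinity>"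
  shows "L (f + g) = L f + L g"
proof -
  have "convolvable f h" if "norm1 (repr f) < \<infinity>" "h \<in> H" for f h
  proof (rule convolvable_if_abs_conv_bound[OF norm2_sq_abs_conv_le_L1])
    show "norm1 (repr f) \<le> ennreal (enn2real (norm1 (repr f)))" using that(1) by simp
  qed (simp_all add: that(2))
  then show ?thesis
    using assms by (intro ext) (simp add: conv_op_def convolution_add_left)
qed

end

text \<open>
  The factor \<open>d r + d s\<close> with square integrable \<open>d\<close> lets
  \<open>\<parallel>d f\<parallel>\<^sub>1 \<le> \<parallel>d\<parallel>\<^sub>2 \<parallel>f\<parallel>\<^sub>2\<close> replace the \<open>L\<^sup>1\<close>-norm in Young's inequality.
\<close>

locale L2_algebra_weight = half_line_weight +
  fixes d :: "real \<Rightarrow> real" and C :: real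
  assumes d_measurable [measurable]: "d \<in> borel_measurable borel"
    and d_nonneg: "0 \<le> d s" and C_nonneg: "0 \<le> C"
    and nn_integral_power2_d_le: "(\<integral>\<^sup>+ s. (ennreal (d s))\<^sup>2 \<partial>lborel) \<le> ennreal (C\<^sup>2)"
    and weight_mult_d: "0 \<le> r \<Longrightarrow> 0 \<le> s \<Longrightarrow> \<omega> (r + s) \<le> (d r + d s) * (\<omega> r * \<omega> s)"
begin

definition damped :: "mfun \<Rightarrow> real \<Rightarrow> ennreal"
  where "damped f s = ennreal (d s) * weighted f s"

lemma damped_measurable [measurable]: "damped f \<in> borel_measurable borel"
  unfolding damped_def[abs_def] by measurable

lemma weighted_abs_conv_le_damped:
  "ennreal (w t) * abs_conv (repr f) (repr g) t \<le>
    nn_conv (damped f) (weighted g) t + nn_conv (damped g) (weighted f) t"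
proof -
  have "ennreal (w t) * abs_conv (repr f) (repr g) t \<le>
      (\<integral>\<^sup>+ s. damped f (t - s) * weighted g s + weighted f (t - s) * damped g s \<partial>lborel)"
  proof (rule weighted_abs_conv_le)
    fix s assume s_range: "0 \<le> s" "s \<le> t"
    let ?u = "w (t - s) * cmod (repr f (t - s))" and ?v = "w s * cmod (repr g s)"
    have "w t \<le> (d (t - s) + d s) * (w (t - s) * w s)"
      using s_range weight_mult_d[of "t - s" s] by (simp add: w_eq)
    then have "w t * (cmod (repr f (t - s)) * cmod (repr g s)) \<le>
        (d (t - s) + d s) * (w (t - s) * w s) * (cmod (repr f (t - s)) * cmod (repr g s))"
      by (rule mult_right_mono) simp
    also have "\<dots> = d (t - s) * ?u * ?v + ?u * (d s * ?v)" by (simp add: algebra_simps)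
    finally have "ennreal (w t * (cmod (repr f (t - s)) * cmod (repr g s))) \<le>
        ennreal (d (t - s) * ?u * ?v) + ennreal (?u * (d s * ?v))"
      by (simp add: d_nonneg ennreal_leI flip: ennreal_plus)
    then show "ennreal (w t) * (ennreal (cmod (repr f (t - s))) * ennreal (cmod (repr g s))) \<le>
        damped f (t - s) * weighted g s + weighted f (t - s) * damped g s"
      by (simp add: damped_def weighted_def ennreal_mult d_nonneg)
  qed measurable
  also have "\<dots> = nn_conv (damped f) (weighted g) t + nn_conv (weighted f) (damped g) t"
    unfolding nn_conv_def by (rule nn_integral_add) measurable
  also have "nn_conv (weighted f) (damped g) t = nn_conv (damped g) (weighted f) t"
    by (rule nn_conv_commute) measurable
  finally show ?thesis .
qed

lemma nn_integral_power2_nn_conv_damped_le: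
  assumes "f \<in> H" "g \<in> H"
  shows "(\<integral>\<^sup>+ t. (nn_conv (damped f) (weighted g) t)\<^sup>2 \<partial>lborel) \<le> ennreal ((C * N f * N g)\<^sup>2)"
proof -
  have "(\<integral>\<^sup>+ t. (nn_conv (damped f) (weighted g) t)\<^sup>2 \<partial>lborel) \<le>
      (\<integral>\<^sup>+ s. damped f s \<partial>lborel)\<^sup>2 * norm2_sq (repr g)"
    using Young_L1_L2[of "damped f" "weighted g"] by (simp add: nn_integral_power2_weighted)
  also have "(\<integral>\<^sup>+ s. damped f s \<partial>lborel)\<^sup>2 \<le> (\<integral>\<^sup>+ s. (ennreal (d s))\<^sup>2 \<partial>lborel) * norm2_sq (repr f)"
    using Cauchy_Schwarz_nn_integral[of "\<lambda>s. ennreal (d s)" lborel "weighted f"]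
    by (simp add: damped_def nn_integral_power2_weighted)
  also have "\<dots> \<le> ennreal (C\<^sup>2) * norm2_sq (repr f)"
    by (intro mult_right_mono nn_integral_power2_d_le) simp
  finally have "(\<integral>\<^sup>+ t. (nn_conv (damped f) (weighted g) t)\<^sup>2 \<partial>lborel) \<le>
      ennreal (C\<^sup>2) * norm2_sq (repr f) * norm2_sq (repr g)"
    by (simp add: mult_right_mono)
  also have "\<dots> = ennreal ((C * N f * N g)\<^sup>2)"
    using assms by (simp add: norm2_sq_repr power_mult_distrib flip: ennreal_mult)
  finally show ?thesis .
qed

lemma norm2_sq_abs_conv_le_L2:
  assumes "f \<in> H" "g \<in> H"
  shows "norm2_sq_abs_conv f g \<le> ennreal ((2 * C * N f * N g)\<^sup>2)"
proof -
  have "norm2_sq_abs_conv f g \<le>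
      (\<integral>\<^sup>+ t. (nn_conv (damped f) (weighted g) t + nn_conv (damped g) (weighted f) t)\<^sup>2 \<partial>lborel)"
    unfolding norm2_sq_abs_conv_def
    by (intro nn_integral_mono power_mono weighted_abs_conv_le_damped) simp
  also have "\<dots> \<le> 2 * (\<integral>\<^sup>+ t. (nn_conv (damped f) (weighted g) t)\<^sup>2 \<partial>lborel) +
      2 * (\<integral>\<^sup>+ t. (nn_conv (damped g) (weighted f) t)\<^sup>2 \<partial>lborel)"
    by (rule nn_integral_power2_add_le) measurable
  also have "\<dots> \<le> 2 * ennreal ((C * N f * N g)\<^sup>2) + 2 * ennreal ((C * N g * N f)\<^sup>2)"
    by (intro add_mono mult_left_mono nn_integral_power2_nn_conv_damped_le assms) simp_all
  also have "\<dots> = ennreal (2 * (C * N f * N g)\<^sup>2 + 2 * (C * N g * N f)\<^sup>2)"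
    by (simp add: ennreal_mult)
  also have "2 * (C * N f * N g)\<^sup>2 + 2 * (C * N g * N f)\<^sup>2 = (2 * C * N f * N g)\<^sup>2"
    by (simp add: power_mult_distrib mult_ac)
  finally show ?thesis .
qed

lemma
  assumes "f \<in> H"
  shows conv_op_mem_L2: "L f \<in> bounded_ops H N H N"
    and op_norm_conv_op_le_L2: "op_norm H N N (L f) \<le> 2 * C * N f"
proof -
  have "0 \<le> 2 * C * N f" using C_nonneg assms by simp
  from conv_op_mem[OF this norm2_sq_abs_conv_le_L2[OF assms]]
    op_norm_conv_op_le[OF this norm2_sq_abs_conv_le_L2[OF assms]]
  show "L f \<in> bounded_ops H N H N" "op_norm H N N (L f) \<le> 2 * C * N f" by blast+
qed

lemma convolvable_L2: "f \<in> H \<Longrightarrow> g \<in> H \<Longrightarrow> convolvable f g"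
  by (rule convolvable_if_abs_conv_bound[OF norm2_sq_abs_conv_le_L2]) (simp_all add: C_nonneg)

end

section \<open>Density of the monomials\<close>

lemma nn_integral_exp_half_line: "(\<integral>\<^sup>+ s. ennreal (exp (- s)) * indicator {0..} s \<partial>lborel) = 1"
proof -
  have "(\<integral>\<^sup>+ s. ennreal (exp (- s)) * indicator {0..} s \<partial>lborel) = ennreal (0 - (- exp (- 0)))"
  proof (rule nn_integral_FTC_atLeast)
    show "((\<lambda>s. - exp (- s)) has_real_derivative exp (- s)) (at s)" if "0 \<le> s" for s :: real
      by (auto intro!: derivative_eq_intros)
    show "((\<lambda>s::real. - exp (- s)) \<longlongrightarrow> 0) at_top"
      using tendsto_minus[OF filterlim_compose[OF exp_at_bot filterlim_uminus_at_bot_at_top]] by simp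
  qed auto
  then show ?thesis by simp
qed

lemma has_real_derivative_power_fact:
  fixes s :: real
  shows "((\<lambda>s. s ^ Suc m / fact (Suc m)) has_real_derivative s ^ m / fact m) (at s within S)"
proof -
  have "((\<lambda>s. s ^ Suc m / fact (Suc m)) has_real_derivative
      real (Suc m) * s ^ m / fact (Suc m)) (at s within S)"
    using DERIV_pow[of "Suc m" s S] by (intro DERIV_cdivide) simp
  moreover have "real (Suc m) * s ^ m / fact (Suc m) = s ^ m / fact m"
    unfolding fact_Suc by (simp del: of_nat_Suc)
  ultimately show ?thesis by simp
qed

lemma has_integral_power_fact_convolution:
  fixes t :: real
  assumes "0 \<le> t"
  shows "((\<lambda>s. (t - s) ^ n / fact n * (s ^ m / fact m)) has_integral
    t ^ (n + m + 1) / fact (n + m + 1)) {0..t}"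
proof (induction n arbitrary: m)
  case 0
  have "((\<lambda>s. s ^ m / fact m) has_integral
      (t ^ Suc m / fact (Suc m) - 0 ^ Suc m / fact (Suc m))) {0..t}"
    using has_real_derivative_power_fact
    by (intro fundamental_theorem_of_calculus[OF assms])
      (simp flip: has_real_derivative_iff_has_vector_derivative)
  then show ?case by simp
next
  case (Suc n)
  let ?G = "\<lambda>s. (t - s) ^ Suc n / fact (Suc n) * (s ^ Suc m / fact (Suc m))"
  let ?g = "\<lambda>s. (t - s) ^ Suc n / fact (Suc n) * (s ^ m / fact m) -
    (t - s) ^ n / fact n * (s ^ Suc m / fact (Suc m))"
  have "(?g has_integral (?G t - ?G 0)) {0..t}"
  proof (rule fundamental_theorem_of_calculus[OF assms])
    fix s :: real
    have deriv: "((\<lambda>s. (t - s) ^ Suc n / fact (Suc n)) has_real_derivative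
        - ((t - s) ^ n / fact n)) (at s within {0..t})"
      by (rule DERIV_cong[OF DERIV_chain2[OF has_real_derivative_power_fact]])
        (auto intro!: derivative_eq_intros)
    have "(?G has_real_derivative ?g s) (at s within {0..t})"
      by (rule DERIV_cong[OF DERIV_mult[OF deriv has_real_derivative_power_fact]])
        (simp only: mult.commute mult_minus_left diff_conv_add_uminus add.commute)
    then show "(?G has_vector_derivative ?g s) (at s within {0..t})"
      unfolding has_real_derivative_iff_has_vector_derivative .
  qed
  then have "(?g has_integral 0) {0..t}" by simp
  from has_integral_add[OF this Suc[of "Suc m"]] show ?case by simp
qed

lemma exp_sums: "(\<lambda>k. x ^ k / fact k) sums exp x" for x :: real
  using exp_converges[of x] by (simp add: divide_inverse mult.commute)

lemma sum_power_fact_le_exp: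
  fixes x :: real
  assumes "0 \<le> x" "finite I"
  shows "(\<Sum>k\<in>I. x ^ k / fact k) \<le> exp x"
  using sum_le_suminf[OF sums_summable[OF exp_sums] assms(2), of x] assms(1)
    sums_unique[OF exp_sums, of x] by simp

text \<open>
  As in the proof of the Stone--Weierstrass theorem by Brosowski and Deutsch, the polynomials
  \<open>(1 - y\<^sup>n)\<^bsup>2\<^sup>n\<^esup>\<close> separate \<open>y < 1 / 2\<close> from \<open>y > 1 / 2\<close>.  With \<open>y = e\<^bsup>-lt\<^esup>\<close> they make
  the indicators of initial segments limits of polynomials in an exponential.
\<close>

lemma tendsto_one_minus_power_power_0:
  fixes y :: real
  assumes "1 / 2 < y" "y \<le> 1"
  shows "(\<lambda>n. (1 - y ^ n) ^ (2 ^ n)) \<longlonglongrightarrow> 0"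
proof (rule Lim_null_comparison)
  show "(\<lambda>n. (1 / (2 * y)) ^ n) \<longlonglongrightarrow> 0"
    using assms by (intro LIMSEQ_power_zero) simp
  have "norm ((1 - y ^ n) ^ (2 ^ n)) \<le> (1 / (2 * y)) ^ n" for n
  proof -
    have power_le: "0 \<le> 1 - y ^ n" using assms by (simp add: power_le_one)
    have "(1 - y ^ n) ^ (2 ^ n) \<le> exp (- (y ^ n)) ^ (2 ^ n)"
      using power_le exp_ge_add_one_self[of "- (y ^ n)"] by (intro power_mono) auto
    also have "\<dots> = exp (- ((2 * y) ^ n))"
      by (simp add: exp_of_nat_mult[symmetric] power_mult_distrib)
    also have "\<dots> \<le> 1 / (2 * y) ^ n"
    proof -
      have "(2 * y) ^ n \<le> exp ((2 * y) ^ n)"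
        using exp_ge_add_one_self[of "(2 * y) ^ n"] by linarith
      then show ?thesis
        unfolding exp_minus inverse_eq_divide using assms by (intro divide_left_mono) auto
    qed
    finally show ?thesis using power_le by (simp add: power_divide)
  qed
  then show "\<forall>\<^sub>F n in sequentially. norm ((1 - y ^ n) ^ (2 ^ n)) \<le> (1 / (2 * y)) ^ n" by simp
qed

lemma tendsto_one_minus_power_power_1:
  fixes y :: real
  assumes "0 \<le> y" "y < 1 / 2"
  shows "(\<lambda>n. (1 - y ^ n) ^ (2 ^ n)) \<longlonglongrightarrow> 1"
proof (rule LIM_zero_cancel, rule Lim_null_comparison)
  show "(\<lambda>n. (2 * y) ^ n) \<longlonglongrightarrow> 0"
    using assms by (intro LIMSEQ_power_zero) simp
  have "norm ((1 - y ^ n) ^ (2 ^ n) - 1) \<le> (2 * y) ^ n" for n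
  proof -
    have power_bounds: "0 \<le> y ^ n" "y ^ n \<le> 1" using assms by (simp_all add: power_le_one)
    then have "1 + real (2 ^ n) * (- (y ^ n)) \<le> (1 + - (y ^ n)) ^ (2 ^ n)"
      by (intro Bernoulli_inequality) simp
    moreover have "(1 - y ^ n) ^ (2 ^ n) \<le> 1" using power_bounds by (intro power_le_one) auto
    ultimately show ?thesis by (simp add: power_mult_distrib)
  qed
  then show "\<forall>\<^sub>F n in sequentially. norm ((1 - y ^ n) ^ (2 ^ n) - 1) \<le> (2 * y) ^ n" by simp
qed

lemma tendsto_indicator_lessThan:
  fixes c t :: real
  assumes c_pos: "c > 0" and t_range: "0 \<le> t" "t \<noteq> c"
  shows "(\<lambda>n. 1 - (1 - exp (- (ln 2 / c) * t) ^ n) ^ (2 ^ n)) \<longlonglongrightarrow> indicator {..<c} t"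
proof -
  have half: "exp (- ln 2 :: real) = 1 / 2" by (simp add: exp_minus)
  show ?thesis
  proof (cases "t < c")
    case True
    have "- ln 2 < - (ln 2 / c) * t" using True c_pos by (simp add: field_simps)
    then have "1 / 2 < exp (- (ln 2 / c) * t)" unfolding half[symmetric] by simp
    moreover have "exp (- (ln 2 / c) * t) \<le> 1" using c_pos t_range by simp
    ultimately have "(\<lambda>n. (1 - exp (- (ln 2 / c) * t) ^ n) ^ (2 ^ n)) \<longlonglongrightarrow> 0"
      by (rule tendsto_one_minus_power_power_0)
    from tendsto_diff[OF tendsto_const this, of 1] show ?thesis using True by simp
  next
    case False
    then have "- (ln 2 / c) * t < - ln 2" using t_range c_pos by (simp add: field_simps)
    then have "exp (- (ln 2 / c) * t) < 1 / 2" unfolding half[symmetric] by simp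
    then have "(\<lambda>n. (1 - exp (- (ln 2 / c) * t) ^ n) ^ (2 ^ n)) \<longlonglongrightarrow> 1"
      by (intro tendsto_one_minus_power_power_1) simp_all
    from tendsto_diff[OF tendsto_const this, of 1] show ?thesis using False by simp
  qed
qed

definition monomial :: "nat \<Rightarrow> real \<Rightarrow> complex"
  where "monomial n t = complex_of_real (indicator {0..} t * (t ^ n / fact n))"

lemma monomial_measurable [measurable]: "monomial n \<in> borel_measurable borel"
  unfolding monomial_def[abs_def] by measurable

lemma monomial_neg: "t < 0 \<Longrightarrow> monomial n t = 0"
  by (simp add: monomial_def)

lemma convolution_monomial:
  "convolution (abs_mfun (monomial n)) (abs_mfun (monomial m)) = abs_mfun (monomial (n + m + 1))"
proof -
  have "conv (monomial n) (monomial m) t = monomial (n + m + 1) t" if t_nonneg: "0 \<le> t" for t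
  proof -
    let ?f = "\<lambda>s. (t - s) ^ n / fact n * (s ^ m / fact m)"
    have "set_integrable lborel {0..t} ?f"
      by (intro borel_integrable_atLeastAtMost') (auto intro!: continuous_intros)
    from set_borel_integral_eq_integral(2)[OF this]
    have "(LINT s:{0..t}|lborel. ?f s) = t ^ (n + m + 1) / fact (n + m + 1)"
      unfolding integral_unique[OF has_integral_power_fact_convolution[OF t_nonneg, of n m]] .
    moreover have "conv (monomial n) (monomial m) t =
        (LINT s:{0..t}|lborel. monomial n (t - s) * monomial m s)"
      by (rule conv_eq_set_integral) (simp_all add: monomial_neg)
    moreover have "\<dots> = (LINT s:{0..t}|lborel. complex_of_real (?f s))"
      by (rule set_lebesgue_integral_cong) (auto simp: monomial_def)
    ultimately show ?thesis
      using t_nonneg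
      by (simp add: monomial_def set_integral_complex_of_real del: of_real_mult of_real_divide)
  qed
  then show ?thesis
    by (subst convolution_abs_mfun) (simp_all add: monomial_neg abs_mfun_eq_iff)
qed

locale rapidly_decreasing_weight = half_line_weight +
  assumes weight_decay: "\<exists>B. \<forall>t\<ge>0. \<omega> t \<le> B * exp (- q * t)"
begin

lemma norm2_sq_exp_finite: "norm2_sq (\<lambda>t. complex_of_real (exp (q * t))) < \<infinity>"
proof -
  obtain B where omega_le: "\<And>t. t \<ge> 0 \<Longrightarrow> \<omega> t \<le> B * exp (- (q + 1) * t)"
    using weight_decay[of "q + 1"] by blast
  have bound: "(w t * exp (q * t))\<^sup>2 \<le> B\<^sup>2 * (exp (- t) * indicator {0..} t)" for t
  proof (cases "0 \<le> t")
    case True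
    have "w t * exp (q * t) \<le> B * exp (- (q + 1) * t) * exp (q * t)"
      using omega_le[OF True] True by (intro mult_right_mono) (simp_all add: w_eq)
    also have "\<dots> = B * exp (- t)" by (simp add: exp_add[symmetric] algebra_simps)
    finally have "(w t * exp (q * t))\<^sup>2 \<le> (B * exp (- t))\<^sup>2" by (intro power_mono) simp_all
    also have "\<dots> = B\<^sup>2 * (exp (- t) * exp (- t))" by (simp add: power2_eq_square)
    also have "\<dots> \<le> B\<^sup>2 * (exp (- t) * 1)" using True by (intro mult_left_mono) simp_all
    finally show ?thesis using True by simp
  qed (simp add: w_neg)
  have "norm2_sq (\<lambda>t. complex_of_real (exp (q * t))) \<le>
      (\<integral>\<^sup>+ t. ennreal (B\<^sup>2) * (ennreal (exp (- t)) * indicator {0..} t) \<partial>lborel)"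
    unfolding norm2_sq_def nn_L2_def
  proof (rule nn_integral_mono)
    fix t
    have "(ennreal (norm (w t *\<^sub>R complex_of_real (exp (q * t)))))\<^sup>2 = ennreal ((w t * exp (q * t))\<^sup>2)"
      by (subst ennreal_power) simp_all
    also have "\<dots> \<le> ennreal (B\<^sup>2 * (exp (- t) * indicator {0..} t))" by (rule ennreal_leI[OF bound])
    also have "\<dots> = ennreal (B\<^sup>2) * (ennreal (exp (- t)) * indicator {0..} t)"
      by (simp add: ennreal_mult indicator_def)
    finally show "(ennreal (norm (w t *\<^sub>R complex_of_real (exp (q * t)))))\<^sup>2 \<le>
        ennreal (B\<^sup>2) * (ennreal (exp (- t)) * indicator {0..} t)" .
  qed
  also have "\<dots> = ennreal (B\<^sup>2)" by (simp add: nn_integral_cmult nn_integral_exp_half_line)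
  finally show ?thesis by (simp add: le_less_trans)
qed

lemma norm2_sq_const_finite: "norm2_sq (\<lambda>_. c) < \<infinity>"
proof -
  have "norm2_sq (\<lambda>t. c * complex_of_real (exp (0 * t))) < \<infinity>"
    using norm2_sq_exp_finite[of 0] by (subst norm2_sq_scale) (auto simp: ennreal_mult_less_top)
  then show ?thesis by simp
qed

lemma abs_mfun_mem_H_if_bounded:
  assumes "F \<in> borel_measurable borel" "\<And>t. 0 \<le> t \<Longrightarrow> cmod (F t) \<le> c"
  shows "abs_mfun F \<in> H"
proof -
  have "norm2_sq F \<le> norm2_sq (\<lambda>_. complex_of_real c)"
    by (rule norm2_sq_mono) (use assms(2) in force)
  then show ?thesis
    using le_less_trans[OF _ norm2_sq_const_finite] by (simp add: abs_mfun_mem_H_iff[OF assms(1)])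
qed

lemma exp_mem_H: "abs_mfun (\<lambda>t. complex_of_real (exp (q * t))) \<in> H"
  using norm2_sq_exp_finite[of q] by (subst abs_mfun_mem_H_iff) auto

lemma norm2_sq_monomial_le:
  assumes d_pos: "d > 0"
  shows "norm2_sq (monomial n) \<le>
    ennreal ((N (abs_mfun (\<lambda>t. complex_of_real (exp (1 / d * t)))) * d ^ n)\<^sup>2)"
proof -
  let ?E = "\<lambda>t. complex_of_real (exp (1 / d * t))"
  have "norm2_sq (monomial n) \<le> norm2_sq (\<lambda>t. complex_of_real (d ^ n) * ?E t)"
  proof (rule norm2_sq_mono)
    fix t :: real assume t_nonneg: "0 \<le> t"
    have "t ^ n / fact n = d ^ n * ((1 / d * t) ^ n / fact n)"
      using d_pos by (simp add: power_mult_distrib power_divide)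
    also have "\<dots> \<le> d ^ n * exp (1 / d * t)"
      using d_pos t_nonneg sum_power_fact_le_exp[of "1 / d * t" "{n}"] by (intro mult_left_mono) auto
    finally show "cmod (monomial n t) \<le> cmod (complex_of_real (d ^ n) * ?E t)"
      using t_nonneg d_pos by (simp add: monomial_def norm_mult norm_divide norm_power)
  qed
  also have "\<dots> = ennreal ((d ^ n)\<^sup>2) * norm2_sq ?E"
    using d_pos by (subst norm2_sq_scale) (auto simp: norm_power)
  also have "norm2_sq ?E = ennreal ((N (abs_mfun ?E))\<^sup>2)"
    by (rule norm2_sq_eq[OF _ exp_mem_H]) measurable
  also have "ennreal ((d ^ n)\<^sup>2) * ennreal ((N (abs_mfun ?E))\<^sup>2) =
      ennreal ((N (abs_mfun ?E) * d ^ n)\<^sup>2)"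
    by (simp add: ennreal_mult[symmetric] power_mult_distrib mult.commute)
  finally show ?thesis .
qed

lemma monomial_mem_H: "abs_mfun (monomial n) \<in> H"
  by (rule abs_mfun_mem_HI[OF _ norm2_sq_monomial_le[of 1]]) (use N_nonneg[OF exp_mem_H[of 1]] in simp_all)

lemma N_monomial_le:
  assumes "d > 0"
  shows "N (abs_mfun (monomial n)) \<le> N (abs_mfun (\<lambda>t. complex_of_real (exp (1 / d * t)))) * d ^ n"
  by (rule N_abs_mfun_le[OF _ norm2_sq_monomial_le[OF assms]])
    (use assms N_nonneg[OF exp_mem_H[of "1 / d"]] in simp_all)

context
  fixes Z :: "mfun set"
  assumes closed_subspace: "csubspace Z" "closedin (norm_topology H N) Z"
    and monomial_mem: "\<And>n. abs_mfun (monomial n) \<in> Z"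
begin

lemma dominated_limit_mem:
  assumes "\<And>n. F n \<in> borel_measurable borel" "G \<in> borel_measurable borel" "K \<in> borel_measurable borel"
    "norm2_sq K < \<infinity>" "\<And>n. AE t in lborel. 0 \<le> t \<longrightarrow> cmod (F n t) \<le> cmod (K t)"
    "AE t in lborel. 0 \<le> t \<longrightarrow> (\<lambda>n. F n t) \<longlonglongrightarrow> G t" "\<And>n. abs_mfun (F n) \<in> Z"
  shows "abs_mfun G \<in> Z"
  by (rule closedin_limit[OF closed_subspace(2) limitin_abs_mfun_dominated[OF assms(1-6)] assms(7)])
    simp

lemma linear_combination_mem:
  assumes "finite I" "\<And>i. i \<in> I \<Longrightarrow> F i \<in> borel_measurable borel" "\<And>i. i \<in> I \<Longrightarrow> abs_mfun (F i) \<in> Z"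
  shows "abs_mfun (\<lambda>t. \<Sum>i\<in>I. c i * F i t) \<in> Z"
proof -
  have "abs_mfun (\<lambda>t. \<Sum>i\<in>I. c i * F i t) = (\<Sum>i\<in>I. c i *\<^sub>C abs_mfun (F i))"
    by (rule abs_mfun_linear_combination[OF assms(1,2)])
  then show ?thesis
    using assms(3) by (auto intro!: complex_vector.subspace_sum[OF closed_subspace(1)]
        complex_vector.subspace_scale[OF closed_subspace(1)])
qed

lemma exp_mem: "abs_mfun (\<lambda>t. complex_of_real (exp (- q * t))) \<in> Z"
proof (rule dominated_limit_mem)
  let ?F = "\<lambda>n t. \<Sum>k<n. complex_of_real ((- q) ^ k) * monomial k t"
  show "abs_mfun (?F n) \<in> Z" for n by (rule linear_combination_mem) (use monomial_mem in auto)
  show "norm2_sq (\<lambda>t. complex_of_real (exp (\<bar>q\<bar> * t))) < \<infinity>" by (rule norm2_sq_exp_finite)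
  have F_eq: "?F n t = complex_of_real (\<Sum>k<n. (- q * t) ^ k / fact k)" if "0 \<le> t" for n t
    using that by (simp add: monomial_def power_mult_distrib[symmetric])
  show "AE t in lborel. 0 \<le> t \<longrightarrow> cmod (?F n t) \<le> cmod (complex_of_real (exp (\<bar>q\<bar> * t)))" for n
  proof (intro always_eventually allI impI)
    fix t :: real assume t_nonneg: "0 \<le> t"
    have "cmod (?F n t) = \<bar>\<Sum>k<n. (- q * t) ^ k / fact k\<bar>" unfolding F_eq[OF t_nonneg] norm_of_real ..
    also have "\<dots> \<le> (\<Sum>k<n. \<bar>(- q * t) ^ k / fact k\<bar>)" by (rule sum_abs)
    also have "\<dots> = (\<Sum>k<n. (\<bar>q\<bar> * t) ^ k / fact k)" using t_nonneg by (simp add: power_abs abs_mult)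
    also have "\<dots> \<le> exp (\<bar>q\<bar> * t)" using t_nonneg by (intro sum_power_fact_le_exp) auto
    finally show "cmod (?F n t) \<le> cmod (complex_of_real (exp (\<bar>q\<bar> * t)))" by simp
  qed
  show "AE t in lborel. 0 \<le> t \<longrightarrow> (\<lambda>n. ?F n t) \<longlonglongrightarrow> complex_of_real (exp (- q * t))"
  proof (intro always_eventually allI impI)
    fix t :: real assume t_nonneg: "0 \<le> t"
    have "(\<lambda>n. complex_of_real (\<Sum>k<n. (- q * t) ^ k / fact k)) \<longlonglongrightarrow> complex_of_real (exp (- q * t))"
      using exp_sums[of "- q * t"] unfolding sums_def by (rule tendsto_of_real)
    then show "(\<lambda>n. ?F n t) \<longlonglongrightarrow> complex_of_real (exp (- q * t))" unfolding F_eq[OF t_nonneg] .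
  qed
qed measurable

lemma poly_exp_mem: "abs_mfun (\<lambda>t. complex_of_real (poly r (exp (- q * t)))) \<in> Z"
proof -
  have "complex_of_real (poly r (exp (- q * t))) =
      (\<Sum>i\<le>degree r. complex_of_real (coeff r i) * complex_of_real (exp (- (q * real i) * t)))" for t
    by (simp add: poly_altdef exp_of_nat_mult[symmetric] mult_ac)
  then show ?thesis
    using linear_combination_mem[of "{..degree r}" "\<lambda>i t. complex_of_real (exp (- (q * real i) * t))"
        "\<lambda>i. complex_of_real (coeff r i)"] exp_mem by simp
qed

lemma indicator_lessThan_mem: "abs_mfun (\<lambda>t. complex_of_real (indicator {..<c} t)) \<in> Z"
proof (cases "c > 0")
  case False
  then have "abs_mfun (\<lambda>t. complex_of_real (indicator {..<c} t)) = abs_mfun (\<lambda>_. 0)"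
    by (subst abs_mfun_eq_iff) (auto simp: indicator_def)
  then show ?thesis using complex_vector.subspace_0[OF closed_subspace(1)] by (simp add: abs_mfun_zero)
next
  case True
  define l where "l = ln 2 / c"
  have l_pos: "l > 0" using True by (simp add: l_def)
  define F where "F n t = complex_of_real (1 - (1 - exp (- l * t) ^ n) ^ (2 ^ n))" for n :: nat and t
  show ?thesis
  proof (rule dominated_limit_mem)
    show "F n \<in> borel_measurable borel" for n unfolding F_def[abs_def] by measurable
    show "norm2_sq (\<lambda>_. 1) < \<infinity>" by (rule norm2_sq_const_finite)
    show "abs_mfun (F n) \<in> Z" for n
      using poly_exp_mem[of "1 - (1 - monom 1 n) ^ (2 ^ n)" l]
      by (simp add: F_def[abs_def] poly_monom poly_power)
    show "AE t in lborel. 0 \<le> t \<longrightarrow> cmod (F n t) \<le> cmod 1" for n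
    proof (intro always_eventually allI impI)
      fix t :: real assume "0 \<le> t"
      then have "exp (- l * t) ^ n \<le> 1" using l_pos by (intro power_le_one) auto
      then have "0 \<le> (1 - exp (- l * t) ^ n) ^ (2 ^ n)" "(1 - exp (- l * t) ^ n) ^ (2 ^ n) \<le> 1"
        by (auto intro!: power_le_one)
      then show "cmod (F n t) \<le> cmod 1" unfolding F_def norm_of_real by simp
    qed
    show "AE t in lborel. 0 \<le> t \<longrightarrow> (\<lambda>n. F n t) \<longlonglongrightarrow> complex_of_real (indicator {..<c} t)"
      using AE_lborel_singleton[of c]
    proof eventually_elim
      case (elim t)
      then show ?case
        unfolding F_def l_def using tendsto_of_real[OF tendsto_indicator_lessThan[OF True]] by blast
    qed
  qed measurable
qed

lemma indicator_disjoint_Union_mem: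
  fixes A :: "nat \<Rightarrow> real set"
  assumes [measurable]: "\<And>i. A i \<in> sets borel" and disjoint: "disjoint_family A"
    and mem: "\<And>i. abs_mfun (\<lambda>t. complex_of_real (indicator (A i) t)) \<in> Z"
  shows "abs_mfun (\<lambda>t. complex_of_real (indicator (\<Union> (range A)) t)) \<in> Z"
proof (rule dominated_limit_mem)
  let ?F = "\<lambda>n t. \<Sum>i<n. 1 * complex_of_real (indicator (A i) t)"
  have F_eq: "?F n t = complex_of_real (indicator (\<Union>i<n. A i) t)" for n t
    using disjoint by (subst indicator_UN_disjoint) (auto simp: disjoint_family_on_def)
  show "abs_mfun (?F n) \<in> Z" for n using mem by (intro linear_combination_mem) auto
  show "norm2_sq (\<lambda>_. 1) < \<infinity>" by (rule norm2_sq_const_finite)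
  show "AE t in lborel. 0 \<le> t \<longrightarrow> cmod (?F n t) \<le> cmod 1" for n
    unfolding F_eq by (simp add: indicator_def)
  show "AE t in lborel. 0 \<le> t \<longrightarrow> (\<lambda>n. ?F n t) \<longlonglongrightarrow> complex_of_real (indicator (\<Union> (range A)) t)"
    unfolding F_eq by (intro always_eventually allI impI tendsto_of_real LIMSEQ_indicator_UN)
qed measurable

lemma indicator_mem:
  assumes "E \<in> sets borel"
  shows "abs_mfun (\<lambda>t. complex_of_real (indicator E t)) \<in> Z"
proof -
  have sets_borel: "sets borel = sigma_sets UNIV (range (lessThan :: real \<Rightarrow> real set))"
    by (simp add: borel_Iio)
  have "Int_stable (range (lessThan :: real \<Rightarrow> real set))"
  proof -
    have "{..<u} \<inter> {..<v} = {..<min u v}" for u v :: real by auto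
    then show ?thesis by (auto simp: Int_stable_def)
  qed
  moreover have "range (lessThan :: real \<Rightarrow> real set) \<subseteq> Pow UNIV" by simp
  moreover have "E \<in> sigma_sets UNIV (range lessThan)" using assms sets_borel by simp
  ultimately show ?thesis
  proof (induction rule: sigma_sets_induct_disjoint)
    case (basic A)
    then show ?case using indicator_lessThan_mem by auto
  next
    case empty
    then show ?case using complex_vector.subspace_0[OF closed_subspace(1)] by (simp add: abs_mfun_zero)
  next
    case (compl A)
    then have [measurable]: "A \<in> sets borel" using sets_borel by simp
    have one: "abs_mfun (\<lambda>t. 1) \<in> Z" using exp_mem[of 0] by simp
    have "(\<lambda>t. complex_of_real (indicator (UNIV - A) t)) = (\<lambda>t. 1 - complex_of_real (indicator A t))"
      by (auto simp: indicator_def fun_eq_iff)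
    then have "abs_mfun (\<lambda>t. complex_of_real (indicator (UNIV - A) t)) =
        abs_mfun (\<lambda>t. 1) - abs_mfun (\<lambda>t. complex_of_real (indicator A t))"
      by (simp add: abs_mfun_diff)
    then show ?case using complex_vector.subspace_diff[OF closed_subspace(1) one compl(2)] by simp
  next
    case (union A)
    then show ?case using sets_borel by (intro indicator_disjoint_Union_mem) auto
  qed
qed

lemma simple_function_mem:
  assumes "simple_function borel S"
  shows "abs_mfun S \<in> Z"
proof -
  have fin: "finite (range S)" using simple_functionD(1)[OF assms] by simp
  have "S -` {y} \<in> sets borel" for y using simple_functionD(2)[OF assms, of "{y}"] by simp
  moreover have "S = (\<lambda>t. \<Sum>y\<in>range S. y * complex_of_real (indicator (S -` {y}) t))"
  proof
    fix t
    have "(\<Sum>y\<in>range S. y * complex_of_real (indicator (S -` {y}) t)) =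
        (\<Sum>y\<in>range S. if y = S t then y else 0)"
      by (intro sum.cong) (auto simp: indicator_def)
    then show "S t = (\<Sum>y\<in>range S. y * complex_of_real (indicator (S -` {y}) t))"
      using fin by simp
  qed
  ultimately show ?thesis
    using linear_combination_mem[OF fin, of "\<lambda>y t. complex_of_real (indicator (S -` {y}) t)" "\<lambda>y. y"]
      indicator_mem by simp
qed

lemma monomials_dense: "Z = H"
proof
  show "Z \<subseteq> H" using closedin_subset[OF closed_subspace(2)] by simp
  show "H \<subseteq> Z"
  proof
    fix h assume h_mem: "h \<in> H"
    obtain S where S_approx: "\<And>i. simple_function borel (S i)" "\<And>t. (\<lambda>i. S i t) \<longlonglongrightarrow> repr h t"
        "\<And>i t. cmod (S i t) \<le> 2 * cmod (repr h t)"
      using borel_measurable_implies_sequence_metric[OF repr_measurable[of h], of 0] by auto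
    have "abs_mfun (repr h) \<in> Z"
    proof (rule dominated_limit_mem)
      show "S i \<in> borel_measurable borel" for i using S_approx(1)
        by (rule borel_measurable_simple_function)
      show "norm2_sq (\<lambda>t. 2 * repr h t) < \<infinity>"
        using norm2_sq_finite[OF h_mem] by (subst norm2_sq_scale) (auto simp: ennreal_mult_less_top)
      show "AE t in lborel. 0 \<le> t \<longrightarrow> cmod (S i t) \<le> cmod (2 * repr h t)" for i
        using S_approx(3) by (simp add: norm_mult)
      show "AE t in lborel. 0 \<le> t \<longrightarrow> (\<lambda>i. S i t) \<longlonglongrightarrow> repr h t" using S_approx(2) by simp
      show "abs_mfun (S i) \<in> Z" for i by (rule simple_function_mem[OF S_approx(1)])
    qed measurable
    then show "h \<in> Z" by simp
  qed
qed

end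

end

section \<open>Identification of the algebra\<close>

definition truncate :: "nat \<Rightarrow> (real \<Rightarrow> complex) \<Rightarrow> real \<Rightarrow> complex"
  where "truncate n F t = (if t \<le> real n \<and> cmod (F t) \<le> real n then F t else 0)"

lemma truncate_measurable [measurable]:
  assumes [measurable]: "F \<in> borel_measurable borel"
  shows "truncate n F \<in> borel_measurable borel"
  unfolding truncate_def[abs_def] by measurable

lemma norm_truncate_le: "cmod (truncate n F t) \<le> cmod (F t)"
  by (simp add: truncate_def)

lemma tendsto_truncate: "(\<lambda>n. truncate n F t) \<longlonglongrightarrow> F t"
proof -
  obtain k :: nat where k_ge: "max t (cmod (F t)) \<le> real k" using real_arch_simple by blast
  then have "truncate n F t = F t" if "n \<ge> k" for n using that by (simp add: truncate_def)
  then show ?thesis by (intro tendsto_eventually eventually_sequentiallyI)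
qed

locale conv_algebra_weight =
  submultiplicative_weight \<omega> + L2_algebra_weight \<omega> d C + rapidly_decreasing_weight \<omega> for \<omega> d C
begin

sublocale hilbert_algebra H N ip L "2 * C" "\<lambda>n. abs_mfun (monomial n)"
proof
  show "abs_mfun (monomial n) \<in> H" for n by (rule monomial_mem_H)
  show "L (h + k) = L h + L k" if "h \<in> H" "k \<in> H" for h k
    using that by (intro ext) (simp add: conv_op_def convolution_add_left convolvable_L2)
  show "L (c *\<^sub>C h) = c *\<^sub>C L h" for c h
    by (intro ext) (simp add: conv_op_def convolution_scale_left scaleC_fun_def)
  show "L h k = L k h" if "h \<in> H" "k \<in> H" for h k
    using that convolution_commute by (simp add: conv_op_def)
  show "L (abs_mfun (monomial n)) (abs_mfun (monomial m)) = abs_mfun (monomial (n + m + 1))" for n m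
    using monomial_mem_H convolution_monomial by (simp add: conv_op_def)
  show "\<exists>K. \<forall>n. N (abs_mfun (monomial n)) \<le> K * r ^ n" if "r > 0" for r
    using N_monomial_le[OF that] by blast
  show "Z = H" if "csubspace Z" "closedin (norm_topology H N) Z"
    "range (\<lambda>n. abs_mfun (monomial n)) \<subseteq> Z" for Z
    using that by (intro monomials_dense) auto
qed (use conv_op_mem_L2 op_norm_conv_op_le_L2 in auto)

lemma norm1_truncate_finite:
  assumes [measurable]: "F \<in> borel_measurable borel"
  shows "norm1 (truncate n F) < \<infinity>"
proof -
  obtain B where w_le: "\<And>t. t \<ge> 0 \<Longrightarrow> w t \<le> B" using weight_decay[of 0] by (auto simp: w_eq)
  have "norm1 (truncate n F) \<le> (\<integral>\<^sup>+ t. ennreal (B * real n) * indicator {0..real n} t \<partial>lborel)"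
    unfolding norm1_def
  proof (rule nn_integral_mono)
    fix t
    have "w t * cmod (truncate n F t) \<le> B * real n" if "0 \<le> t"
      using that w_le[OF that] order_trans[OF w_nonneg w_le[OF that]]
      by (intro mult_mono) (auto simp: truncate_def)
    then show "ennreal (w t * cmod (truncate n F t)) \<le> ennreal (B * real n) * indicator {0..real n} t"
      by (cases "0 \<le> t \<and> t \<le> real n") (auto simp: truncate_def w_neg indicator_def intro: ennreal_leI)
  qed
  also have "\<dots> < \<infinity>" by (simp add: nn_integral_cmult_indicator ennreal_mult_less_top)
  finally show ?thesis .
qed

lemma truncate_mem_H: "F \<in> borel_measurable borel \<Longrightarrow> abs_mfun (truncate n F) \<in> H"
  by (rule abs_mfun_mem_H_if_bounded[of _ "real n"]) (simp_all add: truncate_def)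

lemma truncate_mem_L1: "F \<in> borel_measurable borel \<Longrightarrow> abs_mfun (truncate n F) \<in> Lp_space \<omega> 1"
  using norm1_truncate_finite[of F n] by (simp add: abs_mfun_mem_L1_iff)

lemma tendsto_norm1_truncate:
  assumes [measurable]: "F \<in> borel_measurable borel" and finite: "norm1 F < \<infinity>"
  shows "(\<lambda>n. norm1 (\<lambda>t. truncate n F t - F t)) \<longlonglongrightarrow> 0"
proof -
  have "(\<lambda>n. norm1 (\<lambda>t. truncate n F t - F t)) \<longlonglongrightarrow> (\<integral>\<^sup>+ t. 0 \<partial>(lborel :: real measure))"
    unfolding norm1_def
  proof (rule nn_integral_dominated_convergence[where w = "\<lambda>t. ennreal (w t * cmod (F t))"])
    show "(\<integral>\<^sup>+ t. ennreal (w t * cmod (F t)) \<partial>lborel) < \<infinity>" using finite by (simp add: norm1_def)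
    show "AE t in lborel. ennreal (w t * cmod (truncate n F t - F t)) \<le> ennreal (w t * cmod (F t))"
      for n
      by (intro always_eventually allI ennreal_leI mult_left_mono) (auto simp: truncate_def)
    have "(\<lambda>n. w t * cmod (truncate n F t - F t)) \<longlonglongrightarrow> 0" for t
      by (intro tendsto_mult_right_zero tendsto_norm_zero) (simp add: LIM_zero_iff tendsto_truncate)
    then show "AE t in lborel. (\<lambda>n. ennreal (w t * cmod (truncate n F t - F t))) \<longlonglongrightarrow> 0"
      by (intro always_eventually allI) (use tendsto_ennrealI in force)
  qed measurable
  then show ?thesis by simp
qed

lemma norm1_finite: "f \<in> Lp_space \<omega> 1 \<Longrightarrow> norm1 (repr f) < \<infinity>"
  using abs_mfun_mem_L1_iff[OF repr_measurable, of f] by simp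

lemma conv_op_mem_Ops_L1: "f \<in> Lp_space \<omega> 1 \<Longrightarrow> L f \<in> Ops"
  by (rule conv_op_mem_L1[of f "enn2real (norm1 (repr f))"]) (use norm1_finite[of f] in simp_all)

lemma limitin_conv_op_truncate_L1:
  assumes f_mem: "f \<in> Lp_space \<omega> 1"
  shows "limitin (norm_topology Ops opnorm) (\<lambda>n. L (abs_mfun (truncate n (repr f)))) (L f) sequentially"
proof (rule P.ops.limitin_normI)
  define c where "c n = enn2real (norm1 (\<lambda>t. truncate n (repr f) t - repr f t))" for n
  define D where "D n = abs_mfun (\<lambda>t. truncate n (repr f) t - repr f t)" for n
  have "norm1 (\<lambda>t. truncate n (repr f) t - repr f t) \<le> norm1 (repr f)" for n
    unfolding norm1_def by (intro nn_integral_mono ennreal_leI mult_left_mono) (auto simp: truncate_def)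
  then have "norm1 (\<lambda>t. truncate n (repr f) t - repr f t) < \<infinity>" for n
    using norm1_finite[OF f_mem] by (rule le_less_trans)
  then have norm1_D: "norm1 (repr (D n)) = ennreal (c n)" for n
    unfolding D_def c_def by (subst norm1_repr_abs_mfun) simp_all
  have "abs_mfun (truncate n (repr f)) = D n + f" for n
    using abs_mfun_add[of "\<lambda>t. truncate n (repr f) t - repr f t" "repr f"] by (simp add: D_def)
  then have "L (abs_mfun (truncate n (repr f))) - L f = L (D n)" for n
    using conv_op_add_L1[of "D n" f] norm1_finite[OF f_mem] by (simp add: norm1_D)
  then show "opnorm (L (abs_mfun (truncate n (repr f))) - L f) \<le> c n" for n
    using op_norm_conv_op_le_L1[of "D n" "c n"] by (simp add: norm1_D c_def)
  show "c \<longlonglongrightarrow> 0"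
    unfolding c_def using tendsto_norm1_truncate[OF repr_measurable norm1_finite[OF f_mem]]
    by (intro tendsto_enn2real[of _ 0, simplified]) simp_all
  show "L f \<in> Ops" by (rule conv_op_mem_Ops_L1[OF f_mem])
  show "L (abs_mfun (truncate n (repr f))) \<in> Ops" for n
    by (intro L_mem truncate_mem_H) measurable
qed

lemma limitin_conv_op_truncate_L2:
  assumes "h \<in> H"
  shows "limitin (norm_topology Ops opnorm) (\<lambda>n. L (abs_mfun (truncate n (repr h)))) (L h) sequentially"
proof -
  have "limitin (norm_topology H N) (\<lambda>n. abs_mfun (truncate n (repr h)))
      (abs_mfun (repr h)) sequentially"
    by (rule limitin_abs_mfun_dominated[OF _ _ _ norm2_sq_finite[OF assms]])
      (simp_all add: norm_truncate_le tendsto_truncate)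
  then show ?thesis by (intro limitin_L) simp
qed

theorem conv_algebra_eq_A: "conv_algebra \<omega> = A"
proof
  have image: "L ` Lp_space \<omega> 1 \<subseteq> Ops" using conv_op_mem_Ops_L1 by blast
  show "conv_algebra \<omega> \<subseteq> A"
    unfolding conv_algebra_def L2_ops_def L2_op_norm_def
  proof (rule closure_of_minimal[OF image_subsetI closedin_A])
    fix f assume "f \<in> Lp_space \<omega> 1"
    then show "L f \<in> A"
      by (rule P.ops.closedin_limit[OF closedin_A limitin_conv_op_truncate_L1])
        (simp_all add: L_mem_A truncate_mem_H)
  qed
  show "A \<subseteq> conv_algebra \<omega>"
    unfolding conv_algebra_def L2_ops_def L2_op_norm_def A_def
  proof (rule closure_of_minimal[OF image_subsetI closedin_closure_of])
    fix h assume "h \<in> H"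
    then show "L h \<in> norm_topology Ops opnorm closure_of (L ` Lp_space \<omega> 1)"
      by (rule P.ops.closedin_limit[OF closedin_closure_of limitin_conv_op_truncate_L2])
        (use P.ops.subset_closure_of[OF image] truncate_mem_L1[OF repr_measurable] in auto)
  qed
qed

end

section \<open>Weights that are constant between integers\<close>

locale step_weight = conv_algebra_weight +
  assumes weight_0: "\<omega> 0 = 1"
    and weight_step: "real n \<le> t \<Longrightarrow> t < real n + 1 \<Longrightarrow> \<omega> t = \<omega> (real n)"
begin

lemma w_step: "real n \<le> t \<Longrightarrow> t < real n + 1 \<Longrightarrow> w t = w (real n)"
  using weight_step[of n t] by (simp add: w_eq)

definition bump :: "nat \<Rightarrow> real \<Rightarrow> complex"
  where "bump n t = complex_of_real ((real n + 2) * indicator {0..1 / (real n + 2)} t)"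

lemma bump_measurable [measurable]: "bump n \<in> borel_measurable borel"
  unfolding bump_def[abs_def] by measurable

lemma norm_bump: "cmod (bump n t) = (real n + 2) * indicator {0..1 / (real n + 2)} t"
  unfolding bump_def norm_of_real by simp

lemma bump_neg: "t < 0 \<Longrightarrow> bump n t = 0"
  by (simp add: bump_def)

lemma bump_mem_H: "abs_mfun (bump n) \<in> H"
  by (rule abs_mfun_mem_H_if_bounded[of _ "real n + 2"])
    (measurable, simp add: norm_bump indicator_def)

lemma op_norm_bump_le: "opnorm (L (abs_mfun (bump n))) \<le> 1"
proof (rule op_norm_conv_op_le_L1)
  have w_1: "w t = 1" if "0 \<le> t" "t \<le> 1 / (real n + 2)" for t
  proof -
    have "t < 1" using that(2) by (rule order_le_less_trans) (simp add: divide_less_eq_1)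
    then show ?thesis using that(1) weight_step[of 0 t] weight_0 by (simp add: w_eq)
  qed
  have "norm1 (bump n) = (\<integral>\<^sup>+ t. ennreal (real n + 2) * indicator {0..1 / (real n + 2)} t \<partial>lborel)"
    unfolding norm1_def by (intro nn_integral_cong) (auto simp: norm_bump indicator_def w_1)
  also have "\<dots> = ennreal (real n + 2) * ennreal (1 / (real n + 2))"
    by (simp add: nn_integral_cmult_indicator)
  also have "\<dots> = ennreal ((real n + 2) * (1 / (real n + 2)))"
    by (rule ennreal_mult[symmetric]) simp_all
  also have "\<dots> = ennreal 1" by simp
  finally show "norm1 (repr (abs_mfun (bump n))) \<le> ennreal 1" by (simp add: norm1_repr_abs_mfun)
qed simp

lemma conv_bump_monomial_0:
  assumes "0 \<le> t"
  shows "conv (bump n) (monomial 0) t = complex_of_real (min 1 ((real n + 2) * t))"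
proof -
  let ?r = "1 / (real n + 2)"
  have "conv (bump n) (monomial 0) t = (LINT s|lborel. monomial 0 (t - s) * bump n s)"
    unfolding conv_commute[of "bump n"] by (simp add: conv_def)
  also have "\<dots> = (LINT s|lborel. complex_of_real ((real n + 2) * indicator {0..min t ?r} s))"
    by (intro Bochner_Integration.integral_cong) (auto simp: monomial_def bump_def indicator_def)
  also have "\<dots> = complex_of_real ((real n + 2) * min t ?r)"
    unfolding integral_complex_of_real using assms by (simp add: min_def)
  also have "(real n + 2) * min t ?r = min ((real n + 2) * t) ((real n + 2) * ?r)"
    by (rule min_mult_distrib_left[THEN trans]) simp
  also have "\<dots> = min 1 ((real n + 2) * t)" by (simp add: min.commute)
  finally show ?thesis .
qed

lemma tendsto_min_1_linear:
  assumes "0 < t"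
  shows "(\<lambda>n. min 1 ((real n + 2) * t)) \<longlonglongrightarrow> 1"
proof -
  obtain k :: nat where k_ge: "1 / t \<le> real k" using real_arch_simple by blast
  have "min 1 ((real n + 2) * t) = 1" if "n \<ge> k" for n
  proof -
    have "1 / t \<le> real n + 2" using k_ge that by simp
    then show ?thesis using assms by (simp add: field_simps)
  qed
  then show ?thesis by (intro tendsto_eventually eventually_sequentiallyI)
qed

lemma limitin_bump_monomial_0:
  "limitin (norm_topology H N) (\<lambda>n. L (abs_mfun (bump n)) (abs_mfun (monomial 0)))
    (abs_mfun (monomial 0)) sequentially"
proof -
  have "L (abs_mfun (bump n)) (abs_mfun (monomial 0)) = abs_mfun (conv (bump n) (monomial 0))" for n
    using p_mem[of 0] by (simp add: conv_op_def convolution_abs_mfun bump_neg monomial_neg)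
  moreover have "limitin (norm_topology H N) (\<lambda>n. abs_mfun (conv (bump n) (monomial 0)))
      (abs_mfun (monomial 0)) sequentially"
  proof (rule limitin_abs_mfun_dominated[OF _ _ _ norm2_sq_const_finite[of 1]])
    show "AE t in lborel. 0 \<le> t \<longrightarrow> cmod (conv (bump n) (monomial 0) t) \<le> cmod 1" for n
      by (intro always_eventually allI impI) (simp add: conv_bump_monomial_0)
    show "AE t in lborel. 0 \<le> t \<longrightarrow> (\<lambda>n. conv (bump n) (monomial 0) t) \<longlonglongrightarrow> monomial 0 t"
      using AE_lborel_singleton[of 0]
    proof eventually_elim
      case (elim t)
      then show ?case
        using tendsto_of_real[OF tendsto_min_1_linear[of t], where 'a = complex]
        by (auto simp: conv_bump_monomial_0 monomial_def)
    qed
  qed measurable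
  ultimately show ?thesis by simp
qed

definition window :: "nat \<Rightarrow> real \<Rightarrow> complex"
  where "window n t = complex_of_real (indicator {real n..<real n + 1} t / w (real n))"

lemma window_measurable [measurable]: "window n \<in> borel_measurable borel"
  unfolding window_def[abs_def] by measurable

lemma norm_window: "cmod (window n t) = indicator {real n..<real n + 1} t / w (real n)"
  unfolding window_def norm_of_real using w_nonneg[of "real n"] by simp

lemma window_neg: "t < 0 \<Longrightarrow> window n t = 0"
  by (simp add: window_def)

lemma window_mem_H: "abs_mfun (window n) \<in> H"
  by (rule abs_mfun_mem_H_if_bounded[of _ "1 / w (real n)"])
    (measurable, simp add: norm_window indicator_def)

lemma op_norm_window_le: "opnorm (L (abs_mfun (window n))) \<le> 1"
proof (rule op_norm_conv_op_le_L1)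
  have "w t * cmod (window n t) = indicator {real n..<real n + 1} t" for t
    using w_step[of n t] w_pos[of "real n"]
    by (cases "t \<in> {real n..<real n + 1}") (auto simp: norm_window)
  then have "norm1 (window n) = (\<integral>\<^sup>+ t. indicator {real n..<real n + 1} t \<partial>lborel)"
    unfolding norm1_def by (simp only: ennreal_indicator)
  also have "\<dots> = ennreal 1" by simp
  finally show "norm1 (repr (abs_mfun (window n))) \<le> ennreal 1" by (simp add: norm1_repr_abs_mfun)
qed simp

lemma L_monomial_window:
  "L (abs_mfun (monomial k)) (abs_mfun (window n)) = abs_mfun (conv (monomial k) (window n))"
  using window_mem_H by (simp add: conv_op_def convolution_abs_mfun monomial_neg window_neg)

lemma conv_monomial_window_eq_0: "t < real n \<Longrightarrow> conv (monomial k) (window n) t = 0"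
  unfolding conv_def by (rule integral_eq_zero_AE) (auto simp: window_def indicator_def monomial_def)

lemma has_integral_power2_diff:
  fixes a t :: real
  assumes "a \<le> t"
  shows "((\<lambda>s. (t - s)\<^sup>2 / 2) has_integral (t - a) ^ 3 / 6) {a..t}"
proof -
  have "((\<lambda>s. (t - s)\<^sup>2 / 2) has_integral (- ((t - t) ^ 3) / 6 - (- ((t - a) ^ 3) / 6))) {a..t}"
  proof (rule fundamental_theorem_of_calculus[OF assms])
    fix s
    have "((\<lambda>s. - ((t - s) ^ 3) / 6) has_real_derivative (t - s)\<^sup>2 / 2) (at s within {a..t})"
      by (auto intro!: derivative_eq_intros simp: power2_eq_square field_simps)
    then show "((\<lambda>s. - ((t - s) ^ 3) / 6) has_vector_derivative (t - s)\<^sup>2 / 2) (at s within {a..t})"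
      unfolding has_real_derivative_iff_has_vector_derivative .
  qed
  then show ?thesis by simp
qed

lemma conv_monomial_2_window:
  assumes "real n \<le> t" "t < real n + 1"
  shows "conv (monomial 2) (window n) t = complex_of_real ((t - real n) ^ 3 / 6 / w (real n))"
proof -
  have "set_integrable lborel {real n..t} (\<lambda>s. (t - s)\<^sup>2 / 2)"
    by (intro borel_integrable_atLeastAtMost') (auto intro!: continuous_intros)
  from set_borel_integral_eq_integral(2)[OF this]
  have integral: "(LINT s:{real n..t}|lborel. (t - s)\<^sup>2 / 2) = (t - real n) ^ 3 / 6"
    unfolding integral_unique[OF has_integral_power2_diff[OF assms(1)]] .
  have "conv (monomial 2) (window n) t =
      (LINT s|lborel. complex_of_real (indicator {real n..t} s *\<^sub>R ((t - s)\<^sup>2 / 2) / w (real n)))"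
    unfolding conv_def
    by (intro Bochner_Integration.integral_cong)
      (use assms in \<open>auto simp: monomial_def window_def indicator_def\<close>)
  also have "\<dots> = complex_of_real ((LINT s:{real n..t}|lborel. (t - s)\<^sup>2 / 2) / w (real n))"
    unfolding integral_complex_of_real set_lebesgue_integral_def by simp
  finally show ?thesis unfolding integral .
qed

lemma windows_separated:
  assumes "m < n"
  shows "1 / 100 \<le> N (L (abs_mfun (monomial 2)) (abs_mfun (window m)) -
      L (abs_mfun (monomial 2)) (abs_mfun (window n)))"
    (is "_ \<le> N ?D")
proof -
  define F where "F t = conv (monomial 2) (window m) t - conv (monomial 2) (window n) t" for t
  have diff_eq: "?D = abs_mfun F"
    unfolding L_monomial_window F_def[abs_def] by (rule abs_mfun_diff) measurable
  have D_mem: "?D \<in> H" by (intro diff_mem L_app_mem p_mem window_mem_H)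
  let ?E = "{real m + 1 / 2..<real m + 1}"
  have "ennreal ((1 / 48)\<^sup>2) * emeasure lborel ?E \<le> norm2_sq F"
  proof (rule norm2_sq_ge)
    fix t assume "t \<in> ?E"
    then have t_range: "real m \<le> t" "t < real m + 1" "t < real n" "1 / 2 \<le> t - real m"
      using assms by auto
    have "1 / 48 = (1 / 2) ^ 3 / (6 :: real)" by (simp add: power3_eq_cube)
    also have "\<dots> \<le> (t - real m) ^ 3 / 6" using t_range by (intro divide_right_mono power_mono) auto
    also have "\<dots> = w t * cmod (F t)"
      unfolding F_def conv_monomial_window_eq_0[OF t_range(3)]
        conv_monomial_2_window[OF t_range(1,2)] diff_zero norm_of_real
      using w_step[OF t_range(1,2)] w_pos[of "real m"] t_range by simp
    finally show "1 / 48 \<le> w t * cmod (F t)" .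
  qed simp_all
  moreover have "emeasure lborel ?E = ennreal (1 / 2)"
    using emeasure_lborel_Ico[of "real m + 1 / 2" "real m + 1"] by simp
  moreover have "norm2_sq F = ennreal ((N ?D)\<^sup>2)"
    unfolding diff_eq by (rule norm2_sq_eq) (use D_mem diff_eq in \<open>simp_all add: F_def[abs_def]\<close>)
  ultimately have "ennreal ((1 / 48)\<^sup>2 * (1 / 2)) \<le> ennreal ((N ?D)\<^sup>2)"
    by (simp only: ennreal_mult zero_le_power2 zero_le_divide_1_iff zero_le_numeral)
  then have "(1 / 48)\<^sup>2 * (1 / 2) \<le> (N ?D)\<^sup>2" by (subst (asm) ennreal_le_iff) simp_all
  then have "(1 / 100)\<^sup>2 \<le> (N ?D)\<^sup>2" by (simp add: power2_eq_square)
  then show ?thesis by (rule power2_le_imp_le) (use D_mem in simp)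
qed

lemma monomial_0_nonzero: "abs_mfun (monomial 0) \<noteq> 0"
proof
  assume "abs_mfun (monomial 0) = 0"
  then have "L (abs_mfun (monomial 2)) = 0"
    using L_p_comp_L_p[of 0 1] L_scale[OF zero_mem, of 0] by (simp add: fun_eq_iff numeral_2_eq_2)
  then show False using windows_separated[of 0 1] by simp
qed

theorem approximately_unital_conv_algebra: "approximately_unital A opnorm (\<circ>)"
  by (rule approximately_unital_A[OF bump_mem_H op_norm_bump_le limitin_bump_monomial_0])

theorem not_reflexive_conv_algebra: "\<not> reflexive_space A opnorm"
  by (rule not_reflexive_A[OF bump_mem_H op_norm_bump_le limitin_bump_monomial_0 monomial_0_nonzero])

theorem not_compact_conv_algebra: "\<not> compact_algebra A opnorm (\<circ>)"
  by (rule not_compact_algebra_A[OF window_mem_H op_norm_window_le _ windows_separated]) simp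

end

section \<open>The staircase weight\<close>

lemma exp_half_nat_le_2_power: "exp (real k / 2) \<le> 2 ^ k"
proof -
  have "exp (real k / 2) = exp (1 / 2) ^ k" by (simp add: exp_of_nat_mult[symmetric])
  also have "\<dots> \<le> 2 ^ k" using exp_half_le2 by (intro power_mono) auto
  finally show ?thesis .
qed

lemma inverse_2_power_le_exp:
  assumes "r < real k + 1"
  shows "1 / 2 ^ k \<le> 2 * exp (- r / 2)"
proof -
  have "exp (r / 2) \<le> exp (real (Suc k) / 2)" using assms by simp
  also have "\<dots> \<le> 2 * 2 ^ k" using exp_half_nat_le_2_power[of "Suc k"] by simp
  finally show ?thesis by (simp add: exp_minus field_simps)
qed

lemma nat_interval_cases:
  fixes t :: real
  assumes "0 \<le> t"
  obtains n :: nat where "real n \<le> t" "t < real n + 1"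
proof
  show "real (nat \<lfloor>t\<rfloor>) \<le> t" "t < real (nat \<lfloor>t\<rfloor>) + 1" using assms by simp_all
qed

locale staircase =
  fixes \<epsilon> :: "nat \<Rightarrow> real" and a :: "nat \<Rightarrow> nat" and \<omega> :: "real \<Rightarrow> real"
  assumes eps_pos: "\<And>n. n \<ge> 1 \<Longrightarrow> \<epsilon> n > 0"
    and eps_decreasing: "\<And>m n. m \<ge> 1 \<Longrightarrow> n \<ge> m \<Longrightarrow> \<epsilon> n \<le> \<epsilon> m"
    and a_strict_mono: "strict_mono a" and a_pos: "\<And>n. a n > 0"
    and a_mult: "\<And>n m. a (n + m) \<ge> a n * a m" and a_0: "a 0 = 1"
    and a_Max: "\<And>n. n \<ge> 2 \<Longrightarrow> real (a n) \<ge>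
      Max ((\<lambda>k. 2 ^ k / \<epsilon> (n - k) * real (a k) * real (a (n - k))) ` {1..n - 1})"
    and omega: "\<And>n t. t \<in> {real n..<real n + 1} \<Longrightarrow> \<omega> t = 1 / real (a n)"
begin

lemma a_growth:
  assumes "k \<ge> 1" "n \<ge> 1"
  shows "2 ^ k / \<epsilon> 1 * (real (a k) * real (a n)) \<le> real (a (n + k))"
proof -
  let ?f = "\<lambda>j. 2 ^ j / \<epsilon> (n + k - j) * real (a j) * real (a (n + k - j))"
  have "2 ^ k / \<epsilon> 1 * (real (a k) * real (a n)) \<le> 2 ^ k / \<epsilon> n * (real (a k) * real (a n))"
    using eps_decreasing[of 1 n] eps_pos[of n] eps_pos[of 1] assms
    by (intro mult_right_mono divide_left_mono) auto
  also have "\<dots> = ?f k" by simp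
  also have "?f k \<le> Max (?f ` {1..n + k - 1})"
    using assms by (intro Max_ge imageI) auto
  also have "\<dots> \<le> real (a (n + k))" using assms by (intro a_Max) auto
  finally show ?thesis by simp
qed

lemma omega_add_le:
  assumes "real k \<le> r" "r < real k + 1" "real n \<le> s" "s < real n + 1"
  shows "\<omega> (r + s) \<le> 1 / real (a (n + k))"
proof -
  obtain j :: nat where j_step: "real j \<le> r + s" "r + s < real j + 1"
    using nat_interval_cases[of "r + s"] assms by auto
  have "n + k \<le> j" using j_step assms by linarith
  then have "a (n + k) \<le> a j" using a_strict_mono by (simp add: strict_mono_less_eq)
  then show ?thesis using omega[of "r + s" j] j_step a_pos[of "n + k"] by (simp add: frac_le)
qed

lemma omega_mult:
  assumes "0 \<le> r" "0 \<le> s"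
  shows "\<omega> (r + s) \<le> \<omega> r * \<omega> s"
proof -
  obtain k :: nat where r_step: "real k \<le> r" "r < real k + 1" using nat_interval_cases[OF assms(1)] .
  obtain n :: nat where s_step: "real n \<le> s" "s < real n + 1" using nat_interval_cases[OF assms(2)] .
  have "\<omega> (r + s) \<le> 1 / real (a (n + k))" by (rule omega_add_le[OF r_step s_step])
  also have "\<dots> \<le> 1 / real (a n * a k)"
    using of_nat_mono[OF a_mult[of n k]] a_pos[of n] a_pos[of k] by (intro frac_le) simp_all
  also have "\<dots> = \<omega> r * \<omega> s" using omega[of r k] omega[of s n] r_step s_step by (simp add: mult.commute)
  finally show ?thesis .
qed

lemma omega_pos:
  assumes "0 \<le> t"
  shows "0 < \<omega> t"
proof -
  obtain n :: nat where t_step: "real n \<le> t" "t < real n + 1" using nat_interval_cases[OF assms] .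
  then show ?thesis using omega[of t n] a_pos[of n] by simp
qed

lemma omega_mult_exp_if_ge_1:
  assumes "1 \<le> r" "1 \<le> s"
  shows "\<omega> (r + s) \<le> 2 * \<epsilon> 1 * exp (- r / 2) * (\<omega> r * \<omega> s)"
proof -
  obtain k :: nat where r_step: "real k \<le> r" "r < real k + 1"
    using nat_interval_cases[of r] assms by auto
  obtain n :: nat where s_step: "real n \<le> s" "s < real n + 1"
    using nat_interval_cases[of s] assms by auto
  have "k \<ge> 1" "n \<ge> 1" using r_step s_step assms by linarith+
  have eps: "\<epsilon> 1 > 0" using eps_pos by simp
  have nonneg: "0 \<le> \<omega> r * \<omega> s" using omega_pos[of r] omega_pos[of s] assms by simp
  have "\<omega> (r + s) \<le> 1 / real (a (n + k))" by (rule omega_add_le[OF r_step s_step])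
  also have "\<dots> \<le> 1 / (2 ^ k / \<epsilon> 1 * (real (a k) * real (a n)))"
    using a_growth[OF \<open>k \<ge> 1\<close> \<open>n \<ge> 1\<close>] eps a_pos by (intro divide_left_mono) auto
  also have "\<dots> = \<epsilon> 1 * (1 / 2 ^ k) * (\<omega> r * \<omega> s)"
    using eps omega[of r k] omega[of s n] r_step s_step by (simp add: field_simps)
  also have "\<dots> \<le> \<epsilon> 1 * (2 * exp (- r / 2)) * (\<omega> r * \<omega> s)"
    using eps nonneg by (intro mult_right_mono mult_left_mono inverse_2_power_le_exp[OF r_step(2)]) auto
  finally show ?thesis by (simp add: mult_ac)
qed

lemma omega_mult_exp:
  assumes "0 \<le> r" "0 \<le> s"
  shows "\<omega> (r + s) \<le> (2 + 2 * \<epsilon> 1) * (exp (- r / 2) + exp (- s / 2)) * (\<omega> r * \<omega> s)"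
proof -
  have eps: "\<epsilon> 1 > 0" using eps_pos by simp
  have nonneg: "0 \<le> \<omega> r * \<omega> s" using omega_pos[OF assms(1)] omega_pos[OF assms(2)] by simp
  have "\<exists>c\<le>(2 + 2 * \<epsilon> 1) * (exp (- r / 2) + exp (- s / 2)). \<omega> (r + s) \<le> c * (\<omega> r * \<omega> s)"
  proof (cases "r < 1 \<or> s < 1")
    case True
    have "1 / 2 \<le> exp (- x / 2)" if "x < 1" for x :: real
      using inverse_2_power_le_exp[of x 0] that by simp
    then have "1 / 2 \<le> exp (- r / 2) + exp (- s / 2)"
      using True exp_ge_zero[of "- r / 2"] exp_ge_zero[of "- s / 2"]
      by (meson add_increasing add_increasing2)
    then have "2 * (1 / 2) \<le> (2 + 2 * \<epsilon> 1) * (exp (- r / 2) + exp (- s / 2))"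
      using eps by (intro mult_mono) auto
    then show ?thesis using omega_mult[OF assms] by (intro exI[of _ 1]) simp
  next
    case False
    have "2 * \<epsilon> 1 * exp (- r / 2) \<le> (2 + 2 * \<epsilon> 1) * (exp (- r / 2) + exp (- s / 2))"
      using eps by (intro mult_mono) auto
    then show ?thesis using omega_mult_exp_if_ge_1[of r s] False by auto
  qed
  then show ?thesis using mult_right_mono[OF _ nonneg] by (meson order_trans)
qed

lemma a_ratio_eventually_ge:
  obtains n0 where "\<And>n. n \<ge> n0 \<Longrightarrow> c * real (a n) \<le> real (a (Suc n))"
proof -
  have eps: "\<epsilon> 1 > 0" using eps_pos by simp
  obtain n1 where power_gt: "c * \<epsilon> 1 < 2 ^ n1" using real_arch_pow[of 2 "c * \<epsilon> 1"] by auto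
  have "c * real (a n) \<le> real (a (Suc n))" if "n \<ge> Suc n1" for n
  proof -
    have "c * \<epsilon> 1 \<le> 2 ^ n"
      using power_gt power_increasing[of n1 n "2 :: real"] that by linarith
    then have "c * real (a n) \<le> 2 ^ n / \<epsilon> 1 * real (a n)"
      using eps by (intro mult_right_mono) (simp_all add: field_simps)
    also have "\<dots> \<le> 2 ^ n / \<epsilon> 1 * (real (a n) * real (a 1))"
      using mult_left_mono[of 1 "real (a 1)" "real (a n)"] a_pos[of 1] eps
      by (intro mult_left_mono) auto
    also have "\<dots> \<le> real (a (Suc n))" using a_growth[of n 1] that by simp
    finally show ?thesis .
  qed
  then show ?thesis by (rule that)
qed

lemma power_over_a_bounded:
  assumes "0 \<le> c"
  shows "\<exists>B. \<forall>n. c ^ n / real (a n) \<le> B"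
proof -
  define b where "b n = c ^ n / real (a n)" for n
  obtain n0 where ratio_ge: "\<And>n. n \<ge> n0 \<Longrightarrow> c * real (a n) \<le> real (a (Suc n))"
    using a_ratio_eventually_ge[of c] by blast
  have decreasing: "b (Suc n) \<le> b n" if "n \<ge> n0" for n
    using mult_left_mono[OF ratio_ge[OF that], of "c ^ n"] assms a_pos[of n] a_pos[of "Suc n"]
    by (simp add: b_def field_simps)
  have "b n \<le> Max (b ` {..n0})" for n
  proof (cases "n \<le> n0")
    case False
    then have "n0 \<le> n" by simp
    then have "b n \<le> b n0"
      by (induction rule: dec_induct) (auto intro: order_trans[OF decreasing])
    also have "\<dots> \<le> Max (b ` {..n0})" by (intro Max_ge) auto
    finally show ?thesis .
  qed (intro Max_ge, auto)
  then show ?thesis unfolding b_def by blast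
qed

lemma omega_decay: "\<exists>B. \<forall>t\<ge>0. \<omega> t \<le> B * exp (- q * t)"
proof -
  obtain B where power_le: "\<And>n. exp \<bar>q\<bar> ^ n / real (a n) \<le> B"
    using power_over_a_bounded[of "exp \<bar>q\<bar>"] by auto
  have "\<omega> t \<le> (B * exp \<bar>q\<bar>) * exp (- q * t)" if t_nonneg: "t \<ge> 0" for t
  proof -
    obtain n :: nat where t_step: "real n \<le> t" "t < real n + 1" using nat_interval_cases[OF t_nonneg] .
    have "q * t \<le> \<bar>q\<bar> * (real n + 1)" using t_step t_nonneg by (intro mult_mono) auto
    then have "exp (q * t) \<le> exp \<bar>q\<bar> ^ n * exp \<bar>q\<bar>"
      by (simp add: exp_of_nat_mult[symmetric] exp_add[symmetric] algebra_simps)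
    from divide_right_mono[OF this, of "real (a n)"] have
       "exp (q * t) * \<omega> t \<le> exp \<bar>q\<bar> ^ n / real (a n) * exp \<bar>q\<bar>"
      using omega[of t n] t_step by simp
    also have "\<dots> \<le> B * exp \<bar>q\<bar>" by (intro mult_right_mono power_le) simp
    finally show ?thesis by (simp add: exp_minus field_simps)
  qed
  then show ?thesis by blast
qed

lemma omega_measurable: "\<omega> \<in> borel_measurable half_line"
proof -
  have "(\<lambda>t. 1 / real (a (nat \<lfloor>t\<rfloor>))) \<in> borel_measurable half_line"
    unfolding half_line_def by (rule measurable_restrict_space1) measurable
  moreover have "\<omega> t = 1 / real (a (nat \<lfloor>t\<rfloor>))" if "t \<in> space half_line" for t
    using that omega[of t "nat \<lfloor>t\<rfloor>"] by (simp add: half_line_def space_restrict_space)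
  ultimately show ?thesis by (simp cong: measurable_cong)
qed

sublocale step_weight \<omega> "\<lambda>s. (2 + 2 * \<epsilon> 1) * (indicator {0..} s * exp (- s / 2))" "2 + 2 * \<epsilon> 1"
proof
  have eps: "\<epsilon> 1 > 0" using eps_pos by simp
  show "\<omega> \<in> borel_measurable half_line" by (rule omega_measurable)
  show "0 \<le> (2 + 2 * \<epsilon> 1) * (indicator {0..} s * exp (- s / 2))" for s using eps by simp
  show "0 \<le> 2 + 2 * \<epsilon> 1" using eps by simp
  have "(ennreal ((2 + 2 * \<epsilon> 1) * (indicator {0..} s * exp (- s / 2))))\<^sup>2 =
      ennreal ((2 + 2 * \<epsilon> 1)\<^sup>2) * (ennreal (exp (- s)) * indicator {0..} s)" for s
    using eps by (cases "0 \<le> s")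
      (simp_all add: ennreal_power power_mult_distrib power2_eq_square flip: exp_add ennreal_mult)
  then show "(\<integral>\<^sup>+ s. (ennreal ((2 + 2 * \<epsilon> 1) * (indicator {0..} s * exp (- s / 2))))\<^sup>2 \<partial>lborel)
      \<le> ennreal ((2 + 2 * \<epsilon> 1)\<^sup>2)"
    by (simp add: nn_integral_cmult nn_integral_exp_half_line)
  show "\<omega> (r + s) \<le> ((2 + 2 * \<epsilon> 1) * (indicator {0..} r * exp (- r / 2)) +
      (2 + 2 * \<epsilon> 1) * (indicator {0..} s * exp (- s / 2))) * (\<omega> r * \<omega> s)" if "0 \<le> r" "0 \<le> s" for r s
    using omega_mult_exp[OF that] that by (simp add: distrib_left)
  show "\<omega> 0 = 1" using omega[of 0 0] a_0 by simp
  show "\<omega> t = \<omega> (real n)" if "real n \<le> t" "t < real n + 1" for n t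
    using omega[of t n] omega[of "real n" n] that by simp
qed (use omega_pos omega_mult omega_decay in auto)

end

theorem theorem6p4:
  fixes \<epsilon> :: "nat \<Rightarrow> real" and a :: "nat \<Rightarrow> nat" and \<omega> :: "real \<Rightarrow> real"
  assumes "\<forall>n\<ge>1. \<epsilon> n > 0"
    and "\<forall>m\<ge>1. \<forall>n\<ge>m. \<epsilon> n \<le> \<epsilon> m"
    and "\<epsilon> \<longlonglongrightarrow> 0"
    and "strict_mono a"
    and "\<forall>n. a n > 0"
    and "\<forall>n m. a (n + m) \<ge> a n * a m"
    and "a 0 = 1"
    and "\<forall>n\<ge>2. real (a n) \<ge>
      Max ((\<lambda>k. 2 ^ k / \<epsilon> (n - k) * real (a k) * real (a (n - k))) ` {1..n - 1})"
    and "\<forall>n. \<forall>t\<in>{real n..<real n + 1}. \<omega> t = 1 / real (a n)"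
  shows "\<not> compact_algebra (conv_algebra \<omega>) (L2_op_norm \<omega>) (\<circ>) \<and>
    weakly_compact_algebra (conv_algebra \<omega>) (L2_op_norm \<omega>) (\<circ>) \<and>
    ideal_in_bidual (conv_algebra \<omega>) (L2_op_norm \<omega>) (\<circ>) \<and>
    operator_algebra_on (Lp_space \<omega> 2) (Lp_norm \<omega> 2) (conv_algebra \<omega>) \<and>
    commutative_algebra (conv_algebra \<omega>) (\<circ>) \<and>
    approximately_unital (conv_algebra \<omega>) (L2_op_norm \<omega>) (\<circ>) \<and>
    radical_algebra (conv_algebra \<omega>) (\<circ>) \<and>
    \<not> reflexive_space (conv_algebra \<omega>) (L2_op_norm \<omega>) \<and>
    topologically_singly_generated (conv_algebra \<omega>) (L2_op_norm \<omega>) (\<circ>)"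
proof -
  interpret staircase \<epsilon> a \<omega>
    by unfold_locales (use assms in auto)
  show ?thesis
    unfolding conv_algebra_eq_A L2_op_norm_def
  proof (intro conjI)
    show "\<not> compact_algebra A opnorm (\<circ>)" by (rule not_compact_conv_algebra)
    show "weakly_compact_algebra A opnorm (\<circ>)" by (rule weakly_compact_algebra_A)
    show "ideal_in_bidual A opnorm (\<circ>)" by (rule ideal_in_bidual_A)
    show "operator_algebra_on H N A" by (rule operator_algebra_on_A)
    show "commutative_algebra A (\<circ>)" by (rule A.commutative_algebra)
    show "approximately_unital A opnorm (\<circ>)" by (rule approximately_unital_conv_algebra)
    show "radical_algebra A (\<circ>)" by (rule radical_algebra_A)
    show "\<not> reflexive_space A opnorm" by (rule not_reflexive_conv_algebra)
    show "topologically_singly_generated A opnorm (\<circ>)" by (rule topologically_singly_generated_A)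
  qed
qed

end
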